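(* Let $r\in\mathbb{N}$, $0\neq\mathtt{x}\in\Bbbk^2$, $s\in\mathbb{N}_0$ and $i\in\{0,1\}$. Then, as $\mathfrak{u}(\mathfrak{m})$-modules: (i) $\mathtt{A}_{\mathtt{x}}(r)\otimes\Omega^s(V_i)\simeq\mathtt{A}_{\mathtt{x}}(r)\oplus P(rs,rs)$ if $s+i$ is even, and $\mathtt{A}_{\mathtt{x}}(r)\otimes\Omega^s(V_i)\simeq\mathtt{B}_{\mathtt{x}}(r)\oplus P(0,r(2s+1))$ if $s+i$ is odd; (ii) $\mathtt{B}_{\mathtt{x}}(r)\otimes\Omega^s(V_i)\simeq\mathtt{B}_{\mathtt{x}}(r)\oplus P(0,2rs)$ if $s+i$ is even, and $\mathtt{B}_{\mathtt{x}}(r)\otimes\Omega^s(V_i)\simeq\mathtt{A}_{\mathtt{x}}(r)\oplus P(rs,r(s+1))$ if $s+i$ is odd.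
   Context: $\Bbbk$ is an algebraically closed field of characteristic $2$; $\mathbb{N}=\{1,2,\dots\}$, $\mathbb{N}_0=\mathbb N\cup\{0\}$. $\mathfrak{u}(\mathfrak{m})$ is the unital associative $\Bbbk$-algebra generated by $a,b,c$ with relations $ab+ba=c$, $ac+ca=a$, $bc+cb=b$, $a^4=b^4=0$, $c^2+c=0$; it is a Hopf algebra in which $a,b,c$ are primitive; tensor products of modules are over $\Bbbk$ with action through the comultiplication, and the dual $V^*$ of a module has action $(h\cdot\varphi)(v)=\varphi(\mathcal S(h)v)$, $\mathcal S$ the antipode. $V_0$ is the trivial one-dimensional module and $V_1$ is the simple module with basis $v_1,v_2,v_3$ and $av_1=v_2$, $av_2=v_3$, $av_3=0$, $bv_1=0$, $bv_2=v_1$, $bv_3=v_2$, $cv_1=v_1$, $cv_2=0$, $cv_3=v_3$. $P_i$ is the projective cover of $V_i$ and $P(m,n)=mP_0\oplus nP_1$. $\Omega(M)$ is the kernel of a projective cover $P(M)\to M$, $\Omega^0(V_i)=V_i$, $\Omega^{s+1}=\Omega\Omega^s$. For $r\in\mathbb{N}$ and $0\ne\mathtt{x}=(x_1,x_2)\in\Bbbk^2$, $\mathtt{A}_{\mathtt{x}}(r)$ is the module with basis $z_1,\dots,z_{4r}$ where $cz_i=z_i$ for $i$ even and $cz_i=0$ for $i$ odd; for $i\equiv2\ (4)$: $az_i=z_{i+1}$, $bz_i=0$; for $i\equiv3\ (4)$: $az_i=z_{i+1}$, $bz_i=z_{i-1}$; for $i\equiv0\ (4)$: $az_i=0$, $bz_i=z_{i-1}$;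 and for $i\equiv1\ (4)$: if $x_1\ne x_2$, then $az_1=x_1z_2$, $bz_1=x_2z_4$, and $az_{i}=x_1z_{i+1}+x_2z_{i-3}$, $bz_{i}=x_1z_{i-1}+x_2z_{i+3}$ for $i>1$; if $x_1=x_2$, then (by convention) $az_1=z_2$, $bz_1=z_4$, and $az_i=z_{i+1}$, $bz_i=z_{i-1}+z_{i+3}$ for $i>1$. Moreover $\mathtt{B}_{\mathtt{x}}(r)=\mathtt{A}_{\mathtt{x}}(r)^*$. *)

theory Defs
  imports
    "HOL-Computational_Algebra.Computational_Algebra"
    "Jordan_Normal_Form.Matrix_Kernel"
begin

text \<open>
  The algebra u(m) is 32-dimensional, and all modules here are finite-dimensional.  A
  finite-dimensional module over the algebra presented by the generators a, b, c and the
  relations in \<open>um_module\<close> is a space of column vectors, \<open>carrier_vec (um_dim M)\<close>, on which the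
  three generators act by matrices satisfying the relations.  Column \<open>j\<close> of a matrix is the image
  of the basis vector number \<open>j\<close>.
\<close>

record 'k um_mod =
  um_dim :: nat
  act_a :: "'k mat"
  act_b :: "'k mat"
  act_c :: "'k mat"

definition um_module :: "'k::field um_mod \<Rightarrow> bool" where
  "um_module M \<longleftrightarrow>
    (let n = um_dim M; A = act_a M; B = act_b M; C = act_c M in
      A \<in> carrier_mat n n \<and> B \<in> carrier_mat n n \<and> C \<in> carrier_mat n n \<and>
      A * B + B * A = C \<and>
      A * C + C * A = A \<and>
      B * C + C * B = B \<and>
      A ^\<^sub>m 4 = 0\<^sub>m n n \<and>
      B ^\<^sub>m 4 = 0\<^sub>m n n \<and>
      C ^\<^sub>m 2 + C = 0\<^sub>m n n)"

text \<open>Module homomorphisms, acting by \<open>v \<mapsto> X *\<^sub>v v\<close>.\<close>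

definition um_hom :: "'k::field um_mod \<Rightarrow> 'k um_mod \<Rightarrow> 'k mat \<Rightarrow> bool" where
  "um_hom M N X \<longleftrightarrow>
    X \<in> carrier_mat (um_dim N) (um_dim M) \<and>
    X * act_a M = act_a N * X \<and>
    X * act_b M = act_b N * X \<and>
    X * act_c M = act_c N * X"

definition um_mono :: "'k::field um_mod \<Rightarrow> 'k um_mod \<Rightarrow> 'k mat \<Rightarrow> bool" where
  "um_mono M N X \<longleftrightarrow> um_hom M N X \<and> inj_on ((*\<^sub>v) X) (carrier_vec (um_dim M))"

definition um_epi :: "'k::field um_mod \<Rightarrow> 'k um_mod \<Rightarrow> 'k mat \<Rightarrow> bool" where
  "um_epi M N X \<longleftrightarrow>
    um_hom M N X \<and> (*\<^sub>v) X ` carrier_vec (um_dim M) = carrier_vec (um_dim N)"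

definition um_iso :: "'k::field um_mod \<Rightarrow> 'k um_mod \<Rightarrow> bool" (infix "\<simeq>\<^sub>u" 50) where
  "M \<simeq>\<^sub>u N \<longleftrightarrow> um_module M \<and> um_module N \<and>
    (\<exists>X. um_hom M N X \<and>
      bij_betw ((*\<^sub>v) X) (carrier_vec (um_dim M)) (carrier_vec (um_dim N)))"

definition um_zero :: "'k::field um_mod" where
  "um_zero = \<lparr>um_dim = 0, act_a = 0\<^sub>m 0 0, act_b = 0\<^sub>m 0 0, act_c = 0\<^sub>m 0 0\<rparr>"

definition diag_sum :: "'k::field mat \<Rightarrow> 'k mat \<Rightarrow> 'k mat" where
  "diag_sum A B =
    four_block_mat A (0\<^sub>m (dim_row A) (dim_col B)) (0\<^sub>m (dim_row B) (dim_col A)) B"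

definition um_sum :: "'k::field um_mod \<Rightarrow> 'k um_mod \<Rightarrow> 'k um_mod" (infixr "\<oplus>\<^sub>u" 65) where
  "M \<oplus>\<^sub>u N =
    \<lparr>um_dim = um_dim M + um_dim N,
     act_a = diag_sum (act_a M) (act_a N),
     act_b = diag_sum (act_b M) (act_b N),
     act_c = diag_sum (act_c M) (act_c N)\<rparr>"

primrec um_mult :: "nat \<Rightarrow> 'k::field um_mod \<Rightarrow> 'k um_mod" where
  "um_mult 0 M = um_zero"
| "um_mult (Suc n) M = M \<oplus>\<^sub>u um_mult n M"

text \<open>
  The matrix of the tensor product of two linear maps; the basis vector \<open>v\<^sub>i \<otimes> w\<^sub>j\<close>
  has number \<open>i * n + j\<close>, where \<open>n\<close> is the dimension of the second factor.
\<close>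

definition kron :: "'k::field mat \<Rightarrow> 'k mat \<Rightarrow> 'k mat" where
  "kron A B =
    mat (dim_row A * dim_row B) (dim_col A * dim_col B)
      (\<lambda>(p, q). A $$ (p div dim_row B, q div dim_col B) * B $$ (p mod dim_row B, q mod dim_col B))"

text \<open>
  The generators are primitive: the comultiplication sends \<open>h\<close> to \<open>h \<otimes> 1 + 1 \<otimes> h\<close> and the
  antipode sends \<open>h\<close> to \<open>- h\<close>, for \<open>h\<close> any of a, b, c.
\<close>

definition um_tensor :: "'k::field um_mod \<Rightarrow> 'k um_mod \<Rightarrow> 'k um_mod" (infixr "\<otimes>\<^sub>u" 70) where
  "M \<otimes>\<^sub>u N =
    (let m = um_dim M; n = um_dim N in
     \<lparr>um_dim = m * n,
      act_a = kron (act_a M) (1\<^sub>m n) + kron (1\<^sub>m m) (act_a N),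
      act_b = kron (act_b M) (1\<^sub>m n) + kron (1\<^sub>m m) (act_b N),
      act_c = kron (act_c M) (1\<^sub>m n) + kron (1\<^sub>m m) (act_c N)\<rparr>)"

text \<open>In the dual basis, \<open>\<phi> \<mapsto> \<phi> \<circ> S(h)\<close> is the transpose of the matrix of \<open>S(h)\<close>.\<close>

definition um_dual :: "'k::field um_mod \<Rightarrow> 'k um_mod" where
  "um_dual M =
    \<lparr>um_dim = um_dim M,
     act_a = (- act_a M)\<^sup>T,
     act_b = (- act_b M)\<^sup>T,
     act_c = (- act_c M)\<^sup>T\<rparr>"

text \<open>
  Since the algebra is finite-dimensional, a finite-dimensional module is projective if and only
  if it has the lifting property with respect to surjections of finite-dimensional modules.
\<close>

definition um_projective :: "'k::field um_mod \<Rightarrow> bool" where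
  "um_projective P \<longleftrightarrow> um_module P \<and>
    (\<forall>M N g f. um_module M \<longrightarrow> um_module N \<longrightarrow> um_epi M N g \<longrightarrow> um_hom P N f \<longrightarrow>
      (\<exists>h. um_hom P M h \<and> g * h = f))"

definition um_essential_epi :: "'k::field um_mod \<Rightarrow> 'k um_mod \<Rightarrow> 'k mat \<Rightarrow> bool" where
  "um_essential_epi P M f \<longleftrightarrow> um_epi P M f \<and>
    (\<forall>N g. um_module N \<longrightarrow> um_hom N P g \<longrightarrow> um_epi N M (f * g) \<longrightarrow> um_epi N P g)"

definition um_projective_cover :: "'k::field um_mod \<Rightarrow> 'k um_mod \<Rightarrow> 'k mat \<Rightarrow> bool" where
  "um_projective_cover P M f \<longleftrightarrow>
    um_projective P \<and> um_module M \<and> um_essential_epi P M f"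

text \<open>
  Projective covers and their kernels are unique up to isomorphism; \<open>um_cover\<close> and \<open>um_Omega\<close>
  choose representatives.  The kernel is a subspace of the projective cover; choosing a basis of
  it amounts to choosing a module \<open>N\<close> with an injective homomorphism onto it.
\<close>

definition um_cover :: "'k::field um_mod \<Rightarrow> 'k um_mod" where
  "um_cover M = (SOME P. \<exists>f. um_projective_cover P M f)"

definition um_Omega :: "'k::field um_mod \<Rightarrow> 'k um_mod" where
  "um_Omega M = (SOME N. um_module N \<and>
    (\<exists>P f j. um_projective_cover P M f \<and> um_mono N P j \<and>
      (*\<^sub>v) j ` carrier_vec (um_dim N) = mat_kernel f))"

definition um_V0 :: "'k::field um_mod" where
  "um_V0 = \<lparr>um_dim = 1, act_a = 0\<^sub>m 1 1, act_b = 0\<^sub>m 1 1, act_c = 0\<^sub>m 1 1\<rparr>"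

definition um_V1 :: "'k::field um_mod" where
  "um_V1 =
    (let v = (\<lambda>i. unit_vec 3 (i - 1)); nul = 0\<^sub>v 3 in
     \<lparr>um_dim = 3,
      act_a = mat_of_cols 3 [v 2, v 3, nul],
      act_b = mat_of_cols 3 [nul, v 1, v 2],
      act_c = mat_of_cols 3 [v 1, nul, v 3]\<rparr>)"

definition um_V :: "nat \<Rightarrow> 'k::field um_mod" where
  "um_V i = (if i = 0 then um_V0 else um_V1)"

definition um_P :: "nat \<Rightarrow> nat \<Rightarrow> 'k::field um_mod" where
  "um_P m n = um_mult m (um_cover (um_V 0)) \<oplus>\<^sub>u um_mult n (um_cover (um_V 1))"

text \<open>
  The basis \<open>z\<^sub>1, \<dots>, z\<^sub>4\<^sub>r\<close> is numbered from 1, the standard basis of \<open>carrier_vec (4 * r)\<close>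
  from 0.
\<close>

definition um_z :: "nat \<Rightarrow> nat \<Rightarrow> 'k::field vec" where
  "um_z r i = unit_vec (4 * r) (i - 1)"

definition A_img_a :: "'k::field \<times> 'k \<Rightarrow> nat \<Rightarrow> nat \<Rightarrow> 'k vec" where
  "A_img_a x r i =
    (let x1 = fst x; x2 = snd x; z = um_z r in
     if i mod 4 = 2 then z (i + 1)
     else if i mod 4 = 3 then z (i + 1)
     else if i mod 4 = 0 then 0\<^sub>v (4 * r)
     else if x1 \<noteq> x2 then
       (if i = 1 then x1 \<cdot>\<^sub>v z 2 else x1 \<cdot>\<^sub>v z (i + 1) + x2 \<cdot>\<^sub>v z (i - 3))
     else
       (if i = 1 then z 2 else z (i + 1)))"

definition A_img_b :: "'k::field \<times> 'k \<Rightarrow> nat \<Rightarrow> nat \<Rightarrow> 'k vec" where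
  "A_img_b x r i =
    (let x1 = fst x; x2 = snd x; z = um_z r in
     if i mod 4 = 2 then 0\<^sub>v (4 * r)
     else if i mod 4 = 3 then z (i - 1)
     else if i mod 4 = 0 then z (i - 1)
     else if x1 \<noteq> x2 then
       (if i = 1 then x2 \<cdot>\<^sub>v z 4 else x1 \<cdot>\<^sub>v z (i - 1) + x2 \<cdot>\<^sub>v z (i + 3))
     else
       (if i = 1 then z 4 else z (i - 1) + z (i + 3)))"

definition A_img_c :: "nat \<Rightarrow> nat \<Rightarrow> 'k::field vec" where
  "A_img_c r i = (if even i then um_z r i else 0\<^sub>v (4 * r))"

definition um_A :: "'k::field \<times> 'k \<Rightarrow> nat \<Rightarrow> 'k um_mod" where
  "um_A x r =
    \<lparr>um_dim = 4 * r,
     act_a = mat_of_cols (4 * r) (map (A_img_a x r) [1..<4 * r + 1]),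
     act_b = mat_of_cols (4 * r) (map (A_img_b x r) [1..<4 * r + 1]),
     act_c = mat_of_cols (4 * r) (map (A_img_c r) [1..<4 * r + 1])\<rparr>"

definition um_B :: "'k::field \<times> 'k \<Rightarrow> nat \<Rightarrow> 'k um_mod" where
  "um_B x r = um_dual (um_A x r)"

end

theory Submission
  imports Defs "HOL-Library.Function_Algebras" "HOL-Library.Product_Plus"
begin

text \<open>
  Tensoring the sequence \<open>0 \<rightarrow> \<Omega>M \<rightarrow> P(M) \<rightarrow> M \<rightarrow> 0\<close> with a module and applying Schanuel's lemma
  shows that, up to projective summands, tensor products commute with \<open>\<Omega>\<close>; the projective
  summands are then determined by cancellation, because \<open>P\<^sub>0\<close> and \<open>P\<^sub>1\<close> have local endomorphism
  rings.  By induction on \<open>s\<close> everything reduces to \<open>\<Omega>A\<^sub>x(r) = B\<^sub>x(r)\<close>, \<open>\<Omega>B\<^sub>x(r) = A\<^sub>x(r)\<close>, to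
  \<open>A\<^sub>x(r) \<otimes> V\<^sub>1 = B\<^sub>x(r) \<oplus> P(0, r)\<close> and its counterpart for \<open>B\<^sub>x(r)\<close>, and to
  \<open>V\<^sub>1 \<otimes> P\<^sub>0 = 3P\<^sub>1\<close>, \<open>V\<^sub>1 \<otimes> P\<^sub>1 = P\<^sub>0 \<oplus> 2P\<^sub>1\<close>.

  All nonprojective modules that occur have Loewy length at most 2, with isotypic top and socle, so they
  are given by a pair of linear maps \<open>X\<^sub>1, X\<^sub>2 : V \<rightarrow> W\<close> on the multiplicity spaces.  The Heller
  operator replaces such a pair by the pair \<open>Y\<^sub>1, Y\<^sub>2\<close> for which \<open>(Y\<^sub>2, Y\<^sub>1)\<close> is the kernel of
  \<open>V\<^sup>2 \<rightarrow> W\<close>, \<open>(u, w) \<mapsto> X\<^sub>1 u + X\<^sub>2 w\<close>.  For \<open>A\<^sub>x(r)\<close> the maps \<open>X\<^sub>1, X\<^sub>2\<close> commute and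
  one of them is invertible, whence \<open>Y\<^sub>i = X\<^sub>i\<close>.
\<close>

subsection \<open>Modules as groups with operators\<close>

text \<open>The order \<open>(Y2, Y1)\<close> in the kernel comes from the shape of the covers. Both
  indecomposable projectives have dimension 8 and Loewy length 3: \<open>P0\<close> has
  \<open>V0\<close> as top and as socle with two copies of \<open>V1\<close> between, and for
  \<open>P1\<close> the roles of \<open>V0\<close> and \<open>V1\<close> are exchanged. The cover of
  a module of length 2 kills the socle and maps the middle copy reached from the top by
  \<open>a\<close> through \<open>X1\<close>, the one reached by \<open>b\<close> through
  \<open>X2\<close>. The copy reached by \<open>a\<close> is taken to the socle by \<open>b\<close>,
  and conversely; so the kernel is again given by a pair of maps, with the two simple types
  exchanged.

  For the syzygies of the simple modules the pair consists of the two maps from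
  \<open>k^(s+1)\<close> to \<open>k^s\<close> that drop an end coordinate, so dimensions grow with
  \<open>s\<close>; for \<open>A\<close> and \<open>B\<close> the pair stays the same and only the
  type changes. Since \<open>um_cover\<close> and \<open>um_Omega\<close> are arbitrary choices,
  everything is done for explicit models first and then compared with the chosen modules by the
  uniqueness of projective covers.\<close>

text \<open>
  Treating the scalars as further operators makes a homomorphism an additive map that commutes with
  all operators; a single underlying type can carry modules of varying dimension.
\<close>

datatype 'k gen = Ga | Gb | Gc | Gs 'k

record ('k, 'v) amod =
  car :: "'v set"
  act :: "'k gen \<Rightarrow> 'v \<Rightarrow> 'v"

locale umod =
  fixes M :: "('k::field, 'v::ab_group_add) amod"
  assumes zero_mem [simp]: "0 \<in> car M"
    and add_mem [simp]: "v \<in> car M \<Longrightarrow> w \<in> car M \<Longrightarrow> v + w \<in> car M"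
    and add_self [simp]: "v \<in> car M \<Longrightarrow> v + v = 0"
    and act_mem [simp]: "v \<in> car M \<Longrightarrow> act M g v \<in> car M"
    and act_add [simp]: "v \<in> car M \<Longrightarrow> w \<in> car M \<Longrightarrow> act M g (v + w) = act M g v + act M g w"
    and scale_one [simp]: "v \<in> car M \<Longrightarrow> act M (Gs 1) v = v"
    and scale_add: "v \<in> car M \<Longrightarrow> act M (Gs (k + l)) v = act M (Gs k) v + act M (Gs l) v"
    and scale_scale [simp]: "v \<in> car M \<Longrightarrow> act M (Gs k) (act M (Gs l) v) = act M (Gs (k * l)) v"
    and scale_act: "v \<in> car M \<Longrightarrow> g \<in> {Ga, Gb, Gc} \<Longrightarrow> act M g (act M (Gs k) v) = act M (Gs k) (act M g v)"
    and ab_rel: "v \<in> car M \<Longrightarrow> act M Ga (act M Gb v) + act M Gb (act M Ga v) = act M Gc v"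
    and ac_rel: "v \<in> car M \<Longrightarrow> act M Ga (act M Gc v) + act M Gc (act M Ga v) = act M Ga v"
    and bc_rel: "v \<in> car M \<Longrightarrow> act M Gb (act M Gc v) + act M Gc (act M Gb v) = act M Gb v"
    and a4 [simp]: "v \<in> car M \<Longrightarrow> act M Ga (act M Ga (act M Ga (act M Ga v))) = 0"
    and b4 [simp]: "v \<in> car M \<Longrightarrow> act M Gb (act M Gb (act M Gb (act M Gb v))) = 0"
    and cc_rel: "v \<in> car M \<Longrightarrow> act M Gc (act M Gc v) + act M Gc v = 0"
begin

abbreviation "a \<equiv> act M Ga"
abbreviation "b \<equiv> act M Gb"
abbreviation "c \<equiv> act M Gc"

lemma add_self_left [simp]: "v \<in> car M \<Longrightarrow> v + (v + w) = w"
  by (simp add: add.assoc[symmetric])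

lemma add_eq_0 [simp]: "v \<in> car M \<Longrightarrow> v + w = 0 \<longleftrightarrow> w = v"
  by (metis add_self add_left_cancel)

lemma uminus_eq [simp]: "v \<in> car M \<Longrightarrow> - v = v"
  by (metis add_self add_eq_0_iff)

lemma act_0 [simp]: "act M g 0 = 0"
  using act_add[of 0 0 g] by simp

lemma scale_0 [simp]: "v \<in> car M \<Longrightarrow> act M (Gs 0) v = 0"
  using scale_add[of v 0 0] by simp

lemma scale_act' [simp]:
  assumes "v \<in> car M"
  shows "a (act M (Gs k) v) = act M (Gs k) (a v)"
    "b (act M (Gs k) v) = act M (Gs k) (b v)"
    "c (act M (Gs k) v) = act M (Gs k) (c v)"
  using assms by (simp_all add: scale_act)

lemma c_idem [simp]: "v \<in> car M \<Longrightarrow> c (c v) = c v"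
  using cc_rel[of v] by (metis act_mem add_eq_0)

text \<open>
  As rewrite rules these lead to the PBW normal form \<open>b\<^sup>i a\<^sup>j c\<^sup>l\<close>, so that \<open>simp\<close> decides identities
  between words in the generators.
\<close>

lemma ab_swap: "v \<in> car M \<Longrightarrow> a (b v) = b (a v) + c v"
  using ab_rel[of v] by (metis act_mem add.commute add_self_left)

lemma ca_swap: "v \<in> car M \<Longrightarrow> c (a v) = a (c v) + a v"
  using ac_rel[of v] by (metis act_mem add_self_left)

lemma cb_swap: "v \<in> car M \<Longrightarrow> c (b v) = b (c v) + b v"
  using bc_rel[of v] by (metis act_mem add_self_left)

lemmas swaps = ab_swap ca_swap cb_swap

end

definition mhom :: "('k::field, 'v::ab_group_add) amod \<Rightarrow> ('k, 'w::ab_group_add) amod \<Rightarrow> ('v \<Rightarrow> 'w) \<Rightarrow> bool" where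
  "mhom M N f \<longleftrightarrow> (\<forall>v\<in>car M. f v \<in> car N) \<and> (\<forall>v\<in>car M. \<forall>w\<in>car M. f (v + w) = f v + f w) \<and>
    (\<forall>g. \<forall>v\<in>car M. f (act M g v) = act N g (f v))"

definition miso :: "('k::field, 'v::ab_group_add) amod \<Rightarrow> ('k, 'w::ab_group_add) amod
  \<Rightarrow> bool" (infix "\<approx>\<^sub>m" 50) where
  "M \<approx>\<^sub>m N \<longleftrightarrow> (\<exists>f. mhom M N f \<and> bij_betw f (car M) (car N))"

lemma mhomD:
  assumes "mhom M N f"
  shows "v \<in> car M \<Longrightarrow> f v \<in> car N"
    "v \<in> car M \<Longrightarrow> w \<in> car M \<Longrightarrow> f (v + w) = f v + f w"
    "v \<in> car M \<Longrightarrow> f (act M g v) = act N g (f v)"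
  using assms by (auto simp: mhom_def)

lemma mhom_0: "umod M \<Longrightarrow> mhom M N f \<Longrightarrow> f 0 = 0"
  using mhomD(2)[of M N f 0 0] by (auto simp: umod.zero_mem)

text \<open>\<open>Gc\<close> needs no case of its own because \<open>c = ab + ba\<close>.\<close>

lemma mhomI:
  assumes "umod M" "umod N" "\<And>v. v \<in> car M \<Longrightarrow> f v \<in> car N"
    "\<And>v w. v \<in> car M \<Longrightarrow> w \<in> car M \<Longrightarrow> f (v + w) = f v + f w"
    "\<And>v. v \<in> car M \<Longrightarrow> f (act M Ga v) = act N Ga (f v)"
    "\<And>v. v \<in> car M \<Longrightarrow> f (act M Gb v) = act N Gb (f v)"
    "\<And>v k. v \<in> car M \<Longrightarrow> f (act M (Gs k) v) = act N (Gs k) (f v)"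
  shows "mhom M N f"
proof -
  interpret M: umod M by fact
  interpret N: umod N by fact
  have "f (act M Gc v) = act N Gc (f v)" if "v \<in> car M" for v
    using that by (simp add: assms M.ab_rel[symmetric] N.ab_rel[symmetric])
  then have "f (act M g v) = act N g (f v)" if "v \<in> car M" for g v
    using that assms by (cases g) auto
  then show ?thesis using assms by (auto simp: mhom_def)
qed

lemma mhom_comp: "mhom M N f \<Longrightarrow> mhom N L g \<Longrightarrow> mhom M L (\<lambda>v. g (f v))"
  by (auto simp: mhom_def)

lemma mhom_id: "mhom M M (\<lambda>v. v)"
  by (auto simp: mhom_def)

lemma mhom_inv:
  assumes "umod M" "umod N" "mhom M N f" "bij_betw f (car M) (car N)"
  obtains g where "mhom N M g" "\<And>v. v \<in> car M \<Longrightarrow> g (f v) = v" "\<And>w. w \<in> car N \<Longrightarrow> f (g w) = w"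
    "\<And>w. w \<in> car N \<Longrightarrow> g w \<in> car M"
proof
  interpret M: umod M by fact
  interpret N: umod N by fact
  let ?g = "inv_into (car M) f"
  show gf: "?g (f v) = v" if "v \<in> car M" for v
    using that assms(4) by (simp add: bij_betw_inv_into_left)
  show fg: "f (?g w) = w" if "w \<in> car N" for w
    using that assms(4) by (simp add: bij_betw_inv_into_right)
  show mem: "?g w \<in> car M" if "w \<in> car N" for w
    using that assms(4) by (metis bij_betw_imp_surj_on inv_into_into)
  show "mhom N M ?g"
    unfolding mhom_def
  proof (intro conjI ballI allI)
    fix v w g assume vw: "v \<in> car N" "w \<in> car N"
    show "?g v \<in> car M" using vw mem by simp
    have "f (?g v + ?g w) = v + w" using vw mem fg mhomD[OF assms(3)] by simp
    then show "?g (v + w) = ?g v + ?g w" using gf[of "?g v + ?g w"] vw mem by simp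
    have "f (act M g (?g v)) = act N g v" using vw mem fg mhomD[OF assms(3)] by simp
    then show "?g (act N g v) = act M g (?g v)" using gf[of "act M g (?g v)"] vw mem by simp
  qed
qed

lemma misoI:
  assumes "mhom M N f" "\<And>w. w \<in> car N \<Longrightarrow> g w \<in> car M"
    "\<And>v. v \<in> car M \<Longrightarrow> g (f v) = v" "\<And>w. w \<in> car N \<Longrightarrow> f (g w) = w"
  shows "M \<approx>\<^sub>m N"
  unfolding miso_def
  by (rule exI[of _ f], intro conjI assms(1) bij_betwI[where g=g])
    (use assms mhomD[OF assms(1)] in auto)

lemma miso_refl [simp]: "M \<approx>\<^sub>m M"
  by (rule misoI[OF mhom_id, where g="\<lambda>v. v"]) auto

lemma misoE:
  assumes "M \<approx>\<^sub>m N" "umod M" "umod N"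
  obtains f g where "mhom M N f" "mhom N M g" "\<And>v. v \<in> car M \<Longrightarrow> g (f v) = v"
    "\<And>w. w \<in> car N \<Longrightarrow> f (g w) = w"
proof -
  from assms(1) obtain f where f: "mhom M N f" "bij_betw f (car M) (car N)"
    unfolding miso_def by blast
  with mhom_inv[OF assms(2,3) this] that show thesis by metis
qed

lemma miso_sym: "M \<approx>\<^sub>m N \<Longrightarrow> umod M \<Longrightarrow> umod N \<Longrightarrow> N \<approx>\<^sub>m M"
  by (elim misoE) (auto intro!: misoI dest: mhomD(1))

lemma miso_trans [trans]: "M \<approx>\<^sub>m N \<Longrightarrow> N \<approx>\<^sub>m L \<Longrightarrow> M \<approx>\<^sub>m L"
proof -
  assume "M \<approx>\<^sub>m N" "N \<approx>\<^sub>m L"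
  then obtain f g where "mhom M N f" "bij_betw f (car M) (car N)" "mhom N L g" "bij_betw g (car N) (car L)"
    unfolding miso_def by blast
  then show ?thesis unfolding miso_def
    by (intro exI[of _ "g \<circ> f"]) (auto simp: comp_def intro: mhom_comp bij_betw_trans[unfolded comp_def])
qed

text \<open>Every axiom is an identity between words in the operators, so it can be checked after
  applying the injective map \<open>f\<close>.\<close>

lemma umod_transport:
  assumes N: "umod N" and f: "mhom M N f" "inj_on f (car M)"
    and M: "0 \<in> car M" "\<And>v w. v \<in> car M \<Longrightarrow> w \<in> car M \<Longrightarrow> v + w \<in> car M"
      "\<And>v g. v \<in> car M \<Longrightarrow> act M g v \<in> car M"
  shows "umod M"
proof -
  interpret N: umod N by fact
  have f0: "f 0 = 0" using mhomD(2)[OF f(1), of 0 0] M(1) by simp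
  have eqI: "f v = f w \<Longrightarrow> v \<in> car M \<Longrightarrow> w \<in> car M \<Longrightarrow> v = w" for v w
    using f(2) by (auto dest: inj_onD)
  show ?thesis
    by unfold_locales
      (auto intro!: eqI M simp: f0 mhomD[OF f(1)] M N.scale_add N.scale_act N.ab_rel N.ac_rel N.bc_rel N.cc_rel)
qed

section \<open>Direct sums\<close>

definition msum :: "('k, 'v) amod \<Rightarrow> ('k, 'w) amod \<Rightarrow> ('k, 'v \<times> 'w) amod" (infixr "\<oplus>\<^sub>m" 65) where
  "M \<oplus>\<^sub>m N = \<lparr>car = car M \<times> car N, act = (\<lambda>g (v, w). (act M g v, act N g w))\<rparr>"

lemma msum_simps [simp]:
  "car (M \<oplus>\<^sub>m N) = car M \<times> car N" "act (M \<oplus>\<^sub>m N) g (v, w) = (act M g v, act N g w)"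
  by (simp_all add: msum_def)

lemma umod_msum [simp]:
  assumes "umod M" "umod N" shows "umod (M \<oplus>\<^sub>m N)"
proof -
  interpret M: umod M by fact
  interpret N: umod N by fact
  show ?thesis
    by unfold_locales
      (auto simp: zero_prod_def M.scale_add M.scale_act M.ab_rel M.ac_rel M.bc_rel M.cc_rel
        N.scale_add N.scale_act N.ab_rel N.ac_rel N.bc_rel N.cc_rel)
qed

lemma msum_cong:
  assumes "M \<approx>\<^sub>m M'" "N \<approx>\<^sub>m N'" shows "M \<oplus>\<^sub>m N \<approx>\<^sub>m M' \<oplus>\<^sub>m N'"
proof -
  from assms obtain f g where f: "mhom M M' f" "bij_betw f (car M) (car M')"
    and g: "mhom N N' g" "bij_betw g (car N) (car N')" unfolding miso_def by blast
  have "mhom (M \<oplus>\<^sub>m N) (M' \<oplus>\<^sub>m N') (map_prod f g)"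
    using f(1) g(1) by (auto simp: mhom_def)
  then show ?thesis unfolding miso_def
    using bij_betw_map_prod[OF f(2) g(2)] by auto
qed

lemma msum_comm: "M \<oplus>\<^sub>m N \<approx>\<^sub>m N \<oplus>\<^sub>m M"
  by (rule misoI[where f="\<lambda>(v, w). (w, v)" and g="\<lambda>(v, w). (w, v)"]) (auto simp: mhom_def)

lemma msum_assoc: "(M \<oplus>\<^sub>m N) \<oplus>\<^sub>m L \<approx>\<^sub>m M \<oplus>\<^sub>m N \<oplus>\<^sub>m L"
  by (rule misoI[where f="\<lambda>((u, v), w). (u, v, w)" and g="\<lambda>(u, v, w). ((u, v), w)"])
    (auto simp: mhom_def)

lemma msum_assoc': "M \<oplus>\<^sub>m N \<oplus>\<^sub>m L \<approx>\<^sub>m (M \<oplus>\<^sub>m N) \<oplus>\<^sub>m L"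
  by (rule misoI[where g="\<lambda>((u, v), w). (u, v, w)" and f="\<lambda>(u, v, w). ((u, v), w)"])
    (auto simp: mhom_def)

subsection \<open>Explicit modules\<close>

text \<open>\<open>V\<^sub>1 \<otimes> U\<close>, where \<open>(x, y, z)\<close> stands for \<open>v\<^sub>1 \<otimes> x + v\<^sub>2 \<otimes> y + v\<^sub>3 \<otimes> z\<close>.\<close>

definition V1t :: "('k, 'v::plus) amod \<Rightarrow> ('k, 'v \<times> 'v \<times> 'v) amod" where
  "V1t U = \<lparr>car = car U \<times> car U \<times> car U, act = (\<lambda>g (x, y, z). let h = act U g in
     case g of Ga \<Rightarrow> (h x, x + h y, y + h z) | Gb \<Rightarrow> (y + h x, z + h y, h z)
       | Gc \<Rightarrow> (x + h x, h y, z + h z) | Gs k \<Rightarrow> (h x, h y, h z))\<rparr>"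

lemma V1t_simps [simp]:
  "car (V1t U) = car U \<times> car U \<times> car U"
  "act (V1t U) Ga (x, y, z) = (act U Ga x, x + act U Ga y, y + act U Ga z)"
  "act (V1t U) Gb (x, y, z) = (y + act U Gb x, z + act U Gb y, act U Gb z)"
  "act (V1t U) Gc (x, y, z) = (x + act U Gc x, act U Gc y, z + act U Gc z)"
  "act (V1t U) (Gs k) (x, y, z) = (act U (Gs k) x, act U (Gs k) y, act U (Gs k) z)"
  by (simp_all add: V1t_def Let_def)

lemma umod_V1t [simp]:
  assumes "umod U" shows "umod (V1t U)"
proof -
  interpret U: umod U by fact
  note [simp] = U.swaps U.scale_add U.scale_act ac_simps zero_prod_def
  show ?thesis
  proof (unfold_locales, goal_cases)
    case (4 v g) then show ?case by (cases g) auto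
  next
    case (5 v w g) then show ?case by (cases g) auto
  qed auto
qed

text \<open>
  For \<open>V\<close>, \<open>W\<close> with trivial action of \<open>a, b, c\<close> this is a module with top \<open>V\<^sub>0 \<otimes> V\<close> and socle
  \<open>V\<^sub>1 \<otimes> W\<close> (\<open>d = False\<close>: \<open>(t, x, y, z)\<close> is \<open>t + v\<^sub>1 \<otimes> x + v\<^sub>2 \<otimes> y + v\<^sub>3 \<otimes> z\<close>, with
  \<open>a t = v\<^sub>1 \<otimes> X\<^sub>1 t\<close> and \<open>b t = v\<^sub>3 \<otimes> X\<^sub>2 t\<close>), or with top \<open>V\<^sub>1 \<otimes> V\<close> and socle \<open>V\<^sub>0 \<otimes> W\<close>
  (\<open>d = True\<close>: \<open>(x, y, z, t)\<close>, with \<open>a (v\<^sub>3 \<otimes> z) = X\<^sub>1 z\<close> and \<open>b (v\<^sub>1 \<otimes> x) = X\<^sub>2 x\<close> besides the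
  action on \<open>V\<^sub>1\<close>).  Letting \<open>V\<close> and \<open>W\<close> keep an action of their own covers tensor products of
  such modules as well.
\<close>

definition Kmod :: "bool \<Rightarrow> ('k, 'v::plus) amod \<Rightarrow> ('k, 'v) amod \<Rightarrow> ('v \<Rightarrow> 'v) \<Rightarrow> ('v \<Rightarrow> 'v)
  \<Rightarrow> ('k, 'v \<times> 'v \<times> 'v \<times> 'v) amod" where
  "Kmod d V W X1 X2 =
    (if d then
      \<lparr>car = car V \<times> car V \<times> car V \<times> car W, act = (\<lambda>g (x, y, z, t). let h = act V g; h' = act W g in
        case g of Ga \<Rightarrow> (h x, x + h y, y + h z, X1 z + h' t) | Gb \<Rightarrow> (y + h x, z + h y, h z, X2 x + h' t)
        | Gc \<Rightarrow> (x + h x, h y, z + h z, h' t) | Gs k \<Rightarrow> (h x, h y, h z, h' t))\<rparr>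
    else
      \<lparr>car = car V \<times> car W \<times> car W \<times> car W, act = (\<lambda>g (t, x, y, z). let h = act V g; h' = act W g in
        case g of Ga \<Rightarrow> (h t, X1 t + h' x, x + h' y, y + h' z) | Gb \<Rightarrow> (h t, y + h' x, z + h' y, X2 t + h' z)
        | Gc \<Rightarrow> (h t, x + h' x, h' y, z + h' z) | Gs k \<Rightarrow> (h t, h' x, h' y, h' z))\<rparr>)"

lemma Kmod_simps [simp]:
  "car (Kmod True V W X1 X2) = car V \<times> car V \<times> car V \<times> car W"
  "act (Kmod True V W X1 X2) Ga (x, y, z, t) = (act V Ga x, x + act V Ga y, y + act V Ga z, X1 z + act W Ga t)"
  "act (Kmod True V W X1 X2) Gb (x, y, z, t) = (y + act V Gb x, z + act V Gb y, act V Gb z, X2 x + act W Gb t)"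
  "act (Kmod True V W X1 X2) Gc (x, y, z, t) = (x + act V Gc x, act V Gc y, z + act V Gc z, act W Gc t)"
  "act (Kmod True V W X1 X2) (Gs k) (x, y, z, t) =
    (act V (Gs k) x, act V (Gs k) y, act V (Gs k) z, act W (Gs k) t)"
  "car (Kmod False V W X1 X2) = car V \<times> car W \<times> car W \<times> car W"
  "act (Kmod False V W X1 X2) Ga (t, x, y, z) = (act V Ga t, X1 t + act W Ga x, x + act W Ga y, y + act W Ga z)"
  "act (Kmod False V W X1 X2) Gb (t, x, y, z) = (act V Gb t, y + act W Gb x, z + act W Gb y, X2 t + act W Gb z)"
  "act (Kmod False V W X1 X2) Gc (t, x, y, z) = (act V Gc t, x + act W Gc x, act W Gc y, z + act W Gc z)"
  "act (Kmod False V W X1 X2) (Gs k) (t, x, y, z) =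
    (act V (Gs k) t, act W (Gs k) x, act W (Gs k) y, act W (Gs k) z)"
  by (simp_all add: Kmod_def Let_def)

lemma umod_Kmod [simp]:
  assumes "umod V" "umod W" "mhom V W X1" "mhom V W X2" shows "umod (Kmod d V W X1 X2)"
proof -
  interpret V: umod V by fact
  interpret W: umod W by fact
  note [simp] = V.swaps V.scale_add V.scale_act W.swaps W.scale_add W.scale_act ac_simps zero_prod_def
    mhomD[OF assms(3)] mhomD[OF assms(4)] mhom_0[OF assms(1) assms(3)] mhom_0[OF assms(1) assms(4)]
  show ?thesis
  proof (cases d)
    case True
    then have T: "d = True" by simp
    show ?thesis unfolding T
    proof (unfold_locales, goal_cases)
      case (4 v g) then show ?case by (cases g) auto
    next
      case (5 v w g) then show ?case by (cases g) auto
    qed auto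
  next
    case False
    then have F: "d = False" by simp
    show ?thesis unfolding F
    proof (unfold_locales, goal_cases)
      case (4 v g) then show ?case by (cases g) auto
    next
      case (5 v w g) then show ?case by (cases g) auto
    qed auto
  qed
qed

text \<open>
  \<open>P\<^sub>0 \<otimes> V\<close> (\<open>d = False\<close>) and \<open>P\<^sub>1 \<otimes> V\<close> (\<open>d = True\<close>) for a vector space \<open>V\<close>, whose own
  action is ignored.  The coordinates belong to the basis
  \<open>p, ap, a\<^sup>2p, a\<^sup>3p, b\<^sup>3p, b\<^sup>2p, bp, bap\<close> of \<open>P\<^sub>0\<close>, and to a basis \<open>p\<^sub>1, p\<^sub>2, p\<^sub>3, q\<^sub>1, q\<^sub>2, s\<^sub>1, s\<^sub>2, s\<^sub>3\<close> of
  \<open>P\<^sub>1\<close> in which the \<open>p\<^sub>i\<close> lift the basis of \<open>V\<^sub>1\<close>, the \<open>s\<^sub>i\<close> span the socle, \<open>q\<^sub>1 = a p\<^sub>3\<close> and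
  \<open>q\<^sub>2 = b p\<^sub>1\<close>; here \<open>b p\<^sub>2 = p\<^sub>1 + s\<^sub>1\<close> and \<open>b p\<^sub>3 = p\<^sub>2 + s\<^sub>2\<close>.
\<close>

definition Pmod :: "bool \<Rightarrow> ('k, 'v::{plus,zero}) amod \<Rightarrow> ('k, 'v \<times> 'v \<times> 'v \<times> 'v \<times> 'v \<times> 'v \<times> 'v \<times> 'v) amod" where
  "Pmod d V = \<lparr>car = car V \<times> car V \<times> car V \<times> car V \<times> car V \<times> car V \<times> car V \<times> car V,
    act = (\<lambda>g (p1, p2, p3, p4, p5, p6, p7, p8). case g of
      Ga \<Rightarrow> (0, p1, p2, p3, 0, p5, p6, p7)
    | Gb \<Rightarrow> if d then (p2, p3, 0, 0, p1, p2 + p7, p3 + p8, p4) else (0, p3, p4, 0, p6, p7, p1, p2)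
    | Gc \<Rightarrow> if d then (p1, 0, p3, 0, 0, p6, 0, p8) else (0, p2, 0, p4, p5, 0, p7, 0)
    | Gs k \<Rightarrow> (act V g p1, act V g p2, act V g p3, act V g p4, act V g p5, act V g p6, act V g p7, act V g p8))\<rparr>"

lemma Pmod_simps [simp]:
  "car (Pmod d V) = car V \<times> car V \<times> car V \<times> car V \<times> car V \<times> car V \<times> car V \<times> car V"
  "act (Pmod d V) Ga (p1, p2, p3, p4, p5, p6, p7, p8) = (0, p1, p2, p3, 0, p5, p6, p7)"
  "act (Pmod True V) Gb (p1, p2, p3, p4, p5, p6, p7, p8) = (p2, p3, 0, 0, p1, p2 + p7, p3 + p8, p4)"
  "act (Pmod False V) Gb (p1, p2, p3, p4, p5, p6, p7, p8) = (0, p3, p4, 0, p6, p7, p1, p2)"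
  "act (Pmod True V) Gc (p1, p2, p3, p4, p5, p6, p7, p8) = (p1, 0, p3, 0, 0, p6, 0, p8)"
  "act (Pmod False V) Gc (p1, p2, p3, p4, p5, p6, p7, p8) = (0, p2, 0, p4, p5, 0, p7, 0)"
  "act (Pmod d V) (Gs k) (p1, p2, p3, p4, p5, p6, p7, p8) =
    (act V (Gs k) p1, act V (Gs k) p2, act V (Gs k) p3, act V (Gs k) p4,
     act V (Gs k) p5, act V (Gs k) p6, act V (Gs k) p7, act V (Gs k) p8)"
  by (simp_all add: Pmod_def)

lemma umod_Pmod [simp]:
  assumes "umod V" shows "umod (Pmod d V)"
proof -
  interpret V: umod V by fact
  note [simp] = V.scale_add V.scale_act ac_simps zero_prod_def
  show ?thesis
  proof (cases d)
    case True
    then have T: "d = True" by simp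
    show ?thesis unfolding T
    proof (unfold_locales, goal_cases)
      case (4 v g) then show ?case by (cases g) clarsimp+
    next
      case (5 v w g) then show ?case by (cases g) clarsimp+
    next
      case (9 v g k) then show ?case by auto
    qed clarsimp+
  next
    case False
    then have F: "d = False" by simp
    show ?thesis unfolding F
    proof (unfold_locales, goal_cases)
      case (4 v g) then show ?case by (cases g) clarsimp+
    next
      case (5 v w g) then show ?case by (cases g) clarsimp+
    next
      case (9 v g k) then show ?case by auto
    qed clarsimp+
  qed
qed

subsection \<open>Lifting homomorphisms from projectives\<close>

text \<open>Functions that vanish from \<open>n\<close> on keep the type independent of
  \<open>n\<close>; \<open>F n\<close> below is the space \<open>k^n\<close>.\<close>

definition mpow :: "nat \<Rightarrow> ('k, 'v::zero) amod \<Rightarrow> ('k, nat \<Rightarrow> 'v) amod" where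
  "mpow n M = \<lparr>car = {f. (\<forall>i. f i \<in> car M) \<and> (\<forall>i\<ge>n. f i = 0)}, act = (\<lambda>g f i. act M g (f i))\<rparr>"

lemma car_mpow: "f \<in> car (mpow n M) \<longleftrightarrow> (\<forall>i. f i \<in> car M) \<and> (\<forall>i\<ge>n. f i = 0)"
  by (simp add: mpow_def)

lemma act_mpow: "act (mpow n M) g f = (\<lambda>i. act M g (f i))"
  by (simp add: mpow_def)

lemma umod_mpow [simp]:
  assumes "umod M" shows "umod (mpow n M)"
proof -
  interpret M: umod M by fact
  show ?thesis
    by unfold_locales
      (auto simp: car_mpow act_mpow fun_eq_iff M.scale_add M.scale_act M.ab_rel M.ac_rel M.bc_rel M.cc_rel)
qed

definition ground :: "('k::field, 'k) amod" where
  "ground = \<lparr>car = UNIV, act = (\<lambda>g v. case g of Gs k \<Rightarrow> k * v | _ \<Rightarrow> 0)\<rparr>"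

lemma ground_simps [simp]:
  "car ground = UNIV" "act ground Ga v = 0" "act ground Gb v = 0" "act ground Gc v = 0"
    "act ground (Gs k) v = k * v"
  by (simp_all add: ground_def)

lemma umod_ground [simp]:
  assumes "CHAR('k::field) = 2" shows "umod (ground :: ('k, 'k) amod)"
proof -
  have 2: "(2::'k) = 0" using of_nat_CHAR[where 'a='k] assms by simp
  have "v + v = 0" for v :: 'k
    using 2 by (metis mult_2 mult_zero_left)
  then show ?thesis by unfold_locales (auto simp: ground_def algebra_simps split: gen.splits)
qed

section \<open>Coordinate spaces and linear maps\<close>

abbreviation F :: "nat \<Rightarrow> ('k::field, nat \<Rightarrow> 'k) amod" where "F n \<equiv> mpow n ground"

text \<open>The operators \<open>a\<close>, \<open>b\<close>, \<open>c\<close> are left out on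
  purpose: sending a vector to the corresponding generator of \<open>Pmod\<close>
  (\<open>Pinj\<close>) is linear but not a homomorphism.\<close>

definition lin :: "('k::field, 'v::ab_group_add) amod \<Rightarrow> ('k, 'w::ab_group_add) amod \<Rightarrow> ('v \<Rightarrow> 'w) \<Rightarrow> bool" where
  "lin M N f \<longleftrightarrow> (\<forall>v\<in>car M. f v \<in> car N) \<and> (\<forall>v\<in>car M. \<forall>w\<in>car M. f (v + w) = f v + f w) \<and>
    (\<forall>k. \<forall>v\<in>car M. f (act M (Gs k) v) = act N (Gs k) (f v))"

lemma linD:
  assumes "lin M N f"
  shows "v \<in> car M \<Longrightarrow> f v \<in> car N"
    "v \<in> car M \<Longrightarrow> w \<in> car M \<Longrightarrow> f (v + w) = f v + f w"
    "v \<in> car M \<Longrightarrow> f (act M (Gs k) v) = act N (Gs k) (f v)"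
  using assms by (auto simp: lin_def)

lemma lin_0: "umod M \<Longrightarrow> lin M N f \<Longrightarrow> f 0 = 0"
  using linD(2)[of M N f 0 0] by (auto simp: umod.zero_mem)

lemma mhom_lin: "mhom M N f \<Longrightarrow> lin M N f"
  by (simp add: mhom_def lin_def)

lemma (in umod) sum_mem: "(\<And>i. i \<in> A \<Longrightarrow> f i \<in> car M) \<Longrightarrow> sum f A \<in> car M"
  by (induction A rule: infinite_finite_induct) auto

lemma lin_sum:
  assumes "umod M" "umod N" "lin M N f" "\<And>i. i \<in> A \<Longrightarrow> h i \<in> car M"
  shows "f (sum h A) = (\<Sum>i\<in>A. f (h i))"
proof -
  interpret M: umod M by fact
  show ?thesis using assms(4)
    by (induction A rule: infinite_finite_induct)
      (auto simp: lin_0[OF assms(1,3)] linD(2)[OF assms(3)] M.sum_mem)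
qed

definition unitF :: "nat \<Rightarrow> nat \<Rightarrow> 'k::field" where "unitF i = (\<lambda>j. if j = i then 1 else 0)"

lemma unitF_mem: "i < n \<Longrightarrow> unitF i \<in> car (F n)"
  by (auto simp: car_mpow unitF_def)

lemma sum_fun_apply: "sum f A x = (\<Sum>i\<in>A. f i x)"
  by (induction A rule: infinite_finite_induct) auto

lemma F_expand:
  assumes "v \<in> car (F n)" shows "v = (\<Sum>i<n. act (F n) (Gs (v i)) (unitF i))"
proof
  fix j
  have "(\<Sum>i<n. v i * (if j = i then 1 else 0)) = (if j < n then v j else 0)"
    by (simp add: if_distrib[of "\<lambda>x. _ * x"] cong: if_cong)
  then show "v j = (\<Sum>i<n. act (F n) (Gs (v i)) (unitF i)) j"
    using assms by (auto simp: sum_fun_apply act_mpow unitF_def car_mpow)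
qed

lemma F_lift:
  fixes \<phi> :: "(nat \<Rightarrow> 'k::field) \<Rightarrow> 'w::ab_group_add" and M :: "('k, 'v::ab_group_add) amod"
  assumes ch: "CHAR('k) = 2" and M: "umod M" and N: "umod N" and g: "mhom M N g" "g ` car M = car N"
    and \<phi>: "lin (F n) N \<phi>"
  obtains L where "lin (F n) M L" "\<And>v. v \<in> car (F n) \<Longrightarrow> g (L v) = \<phi> v"
proof -
  interpret M: umod M by fact
  interpret N: umod N by fact
  have "\<exists>m. m \<in> car M \<and> (i < n \<longrightarrow> g m = \<phi> (unitF i))" for i
  proof (cases "i < n")
    case True
    then have "\<phi> (unitF i) \<in> g ` car M" using linD(1)[OF \<phi> unitF_mem[of i n]] g(2) by simp
    then show ?thesis by auto
  qed (use M.zero_mem in blast)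
  then obtain m where m: "\<And>i. m i \<in> car M" "\<And>i. i < n \<Longrightarrow> g (m i) = \<phi> (unitF i)" by metis
  define L where "L v = (\<Sum>i<n. act M (Gs (v i)) (m i))" for v
  have "lin (F n) M L"
    unfolding lin_def
  proof (intro conjI ballI allI)
    fix v w k
    show "L v \<in> car M" by (simp add: L_def m M.sum_mem)
    show "L (v + w) = L v + L w" by (simp add: L_def m M.scale_add sum.distrib)
    have "lin M M (act M (Gs k))" by (auto simp: lin_def mult.commute)
    from lin_sum[OF M M this, of "{..<n}" "\<lambda>i. act M (Gs (v i)) (m i)"]
    have "act M (Gs k) (L v) = (\<Sum>i<n. act M (Gs k) (act M (Gs (v i)) (m i)))"
      by (simp add: L_def m)
    then show "L (act (F n) (Gs k) v) = act M (Gs k) (L v)"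
      by (simp add: L_def act_mpow m)
  qed
  moreover have "g (L v) = \<phi> v" if v: "v \<in> car (F n)" for v
  proof -
    have "g (L v) = (\<Sum>i<n. act N (Gs (v i)) (\<phi> (unitF i)))"
      unfolding L_def by (subst lin_sum[OF M N mhom_lin[OF g(1)]]) (auto simp: m mhomD[OF g(1)])
    also have "\<dots> = (\<Sum>i<n. \<phi> (act (F n) (Gs (v i)) (unitF i)))"
      by (rule sum.cong) (simp_all add: linD(3)[OF \<phi>] unitF_mem)
    also have "\<dots> = \<phi> (\<Sum>i<n. act (F n) (Gs (v i)) (unitF i))"
      using ch by (subst lin_sum[OF _ N \<phi>]) (auto simp: unitF_mem intro!: umod.act_mem)
    finally show ?thesis using F_expand[OF v] by simp
  qed
  ultimately show thesis using that by blast
qed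

context umod
begin

text \<open>
  On the kernel of \<open>c\<close> the element \<open>x = ba\<close> satisfies \<open>x\<^sup>4 = x\<^sup>2\<close>, so \<open>1 + x\<^sup>2\<close> and \<open>x\<^sup>2\<close> are
  idempotents there; they generate \<open>P\<^sub>0\<close> and \<open>P\<^sub>1\<close>.
\<close>

lemma proj0:
  assumes "z \<in> car M" "c z = 0" and m: "m = z + b (a (b (a z)))"
  shows "c m = 0" "b (a (a m)) = a m" "b (b (a m)) = 0"
  unfolding m using assms(1,2) by (simp_all add: swaps ac_simps)

lemma proj1:
  assumes "z \<in> car M" "c z = 0" and m: "m = b (a (b (a z)))"
  shows "c m = 0" "b (b (a (a m))) = b (a m) + m"
  unfolding m using assms(1,2) by (simp_all add: swaps ac_simps)

text \<open>Each application of \<open>a\<close> changes the eigenvalue of \<open>c\<close> by one,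
  so \<open>c\<close> kills \<open>a (a m)\<close>, and on such a vector \<open>a\<close> and
  \<open>b\<close> commute.\<close>

lemma rel0:
  assumes "m \<in> car M" "c m = 0" "b (a (a m)) = a m" "b (b (a m)) = 0"
  shows "b (a (a (a m))) = a (a m)"
proof -
  have "a (b (a (a m))) = a (a m)" using assms by simp
  moreover have "a (b (a (a m))) = b (a (a (a m)))" using assms(1,2) by (simp add: swaps ac_simps)
  ultimately show ?thesis by simp
qed

text \<open>The hypothesis says that \<open>m = (ba)^2 m\<close>, so \<open>m\<close> lies in the
  image of \<open>b\<close> and \<open>b^4 = 0\<close> gives the second claim. For the first,
  \<open>a^3\<close> commutes with \<open>b\<close> on vectors fixed by \<open>c\<close>, which
  produces \<open>a^4\<close>. The third is \<open>b^2\<close> applied to the hypothesis.\<close>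

lemma rel1:
  assumes "m \<in> car M" "c m = 0" "b (b (a (a m))) = b (a m) + m"
  shows "a (a (a m)) = 0" "b (b (b m)) = 0" "b (b (b (a m))) = b (b m)"
proof -
  have m: "m = b (a (b (a m)))" using assms by (simp add: swaps ac_simps)
  show "b (b (b m)) = 0" by (subst m) (use assms in simp)
  show "a (a (a m)) = 0" by (subst m) (use assms(1,2) in \<open>simp add: swaps ac_simps\<close>)
  have "b (b (b (b (a (a m))))) = 0" using assms(1) by simp
  then show "b (b (b (a m))) = b (b m)" unfolding assms(3) using assms(1) by (simp add: add_eq_0)
qed

end

text \<open>
  A homomorphism from \<open>P\<^sub>0\<close> is determined by the image \<open>m\<close> of \<open>p\<close>, one from \<open>P\<^sub>1\<close> by the image
  \<open>m\<close> of \<open>p\<^sub>2\<close>; \<open>Prel\<close> lists the relations that \<open>m\<close> has to satisfy.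
\<close>

definition Phom :: "bool \<Rightarrow> ('k, 'w::ab_group_add) amod \<Rightarrow> ('v \<Rightarrow> 'w) \<Rightarrow> 'v \<times> 'v \<times> 'v \<times> 'v \<times> 'v \<times> 'v \<times> 'v \<times> 'v
  \<Rightarrow> 'w" where
  "Phom d M L = (let a = act M Ga; b = act M Gb in (\<lambda>(p1, p2, p3, p4, p5, p6, p7, p8).
    if d then b (b (a (L p1))) + L p2 + a (L p3) + a (a (L p4)) + b (b (L p5))
      + (b (b (a (L p6))) + b (L p6)) + (b (a (L p7)) + L p7) + b (a (a (L p8)))
    else L p1 + a (L p2) + a (a (L p3)) + a (a (a (L p4))) + b (b (b (L p5))) + b (b (L p6))
      + b (L p7) + b (a (L p8))))"

definition Prel :: "bool \<Rightarrow> ('k, 'w::ab_group_add) amod \<Rightarrow> 'w \<Rightarrow> bool" where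
  "Prel d M m \<longleftrightarrow> (let a = act M Ga; b = act M Gb in act M Gc m = 0 \<and>
    (if d then b (b (a (a m))) = b (a m) + m else b (a (a m)) = a m \<and> b (b (a m)) = 0))"

definition Pinj :: "bool \<Rightarrow> 'v::zero \<Rightarrow> 'v \<times> 'v \<times> 'v \<times> 'v \<times> 'v \<times> 'v \<times> 'v \<times> 'v" where
  "Pinj d v = (if d then (0, v, 0, 0, 0, 0, 0, 0) else (v, 0, 0, 0, 0, 0, 0, 0))"

lemma mhom_Phom:
  assumes "umod V" "umod M" "lin V M L" "\<And>v. v \<in> car V \<Longrightarrow> Prel d M (L v)"
  shows "mhom (Pmod d V) M (Phom d M L)"
proof -
  interpret V: umod V by fact
  interpret M: umod M by fact
  note [simp] = linD[OF assms(3)] lin_0[OF assms(1,3)]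
  show ?thesis
  proof (cases d)
    case True
    then have d: "d = True" by simp
    have r: "M.c (L v) = 0" "M.b (M.b (M.a (M.a (L v)))) = M.b (M.a (L v)) + L v" if "v \<in> car V" for v
      using assms(4)[OF that] by (simp_all add: Prel_def Let_def d)
    note [simp] = r M.rel1[OF _ r, simplified] M.swaps ac_simps
    show ?thesis unfolding d
      by (rule mhomI) (clarsimp simp: Phom_def Let_def assms)+
  next
    case False
    then have d: "d = False" by simp
    have r: "M.c (L v) = 0" "M.b (M.a (M.a (L v))) = M.a (L v)" "M.b (M.b (M.a (L v))) = 0"
      if "v \<in> car V" for v
      using assms(4)[OF that] by (simp_all add: Prel_def Let_def d)
    note [simp] = r M.rel0[OF _ r, simplified] M.swaps ac_simps
    show ?thesis unfolding d
      by (rule mhomI) (clarsimp simp: Phom_def Let_def assms)+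
  qed
qed

text \<open>The words in \<open>Phom\<close> express the basis through the generator. For
  \<open>P1\<close> they are less evident because \<open>b p2 = p1 + s1\<close> and
  \<open>b p3 = p2 + s2\<close>: one finds \<open>p1 = b b a p2\<close> and
  \<open>s1 = b b a p2 + b p2\<close>, and likewise for the others.\<close>

lemma Phom_eq:
  assumes "umod V" "umod M" "mhom (Pmod d V) M f" "v \<in> car (Pmod d V)"
  shows "f v = Phom d M (\<lambda>v. f (Pinj d v)) v"
proof -
  interpret V: umod V by fact
  interpret M: umod M by fact
  note [simp] = mhomD(2,3)[OF assms(3), symmetric]
  obtain p1 p2 p3 p4 p5 p6 p7 p8 where v: "v = (p1, p2, p3, p4, p5, p6, p7, p8)" by (metis surj_pair)
  show ?thesis
    using assms(4) unfolding v
    by (cases d) (simp_all add: Phom_def Pinj_def Let_def ac_simps)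
qed

lemma Prel_Pinj:
  assumes "umod V" "v \<in> car V" shows "Prel d (Pmod d V) (Pinj d v)" "Pinj d v \<in> car (Pmod d V)"
proof -
  interpret V: umod V by fact
  show "Prel d (Pmod d V) (Pinj d v)" "Pinj d v \<in> car (Pmod d V)"
    using assms(2) by (cases d; simp add: Prel_def Let_def Pinj_def zero_prod_def)+
qed

lemma Prel_mhom:
  assumes "umod M" "mhom M N f" "v \<in> car M" "Prel d M v" shows "Prel d N (f v)"
proof -
  interpret M: umod M by fact
  note f = mhomD[OF assms(2)]
  have "act N Gc (f v) = f (act M Gc v)"
    "act N Gb (act N Gb (act N Ga (act N Ga (f v)))) = f (M.b (M.b (M.a (M.a v))))"
    "act N Gb (act N Ga (f v)) + f v = f (M.b (M.a v) + v)"
    "act N Gb (act N Ga (act N Ga (f v))) = f (M.b (M.a (M.a v)))"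
    "act N Gb (act N Gb (act N Ga (f v))) = f (M.b (M.b (M.a v)))"
    "act N Ga (f v) = f (M.a v)"
    using assms(3) by (simp_all add: f)
  then show ?thesis using assms(4) mhom_0[OF assms(1,2)] by (auto simp: Prel_def Let_def)
qed

text \<open>A linear lift of the images of the generators is chosen first and then corrected so as
  to satisfy \<open>Prel\<close>; \<open>mhom_Phom\<close> extends the corrected lift to a
  homomorphism.\<close>

lemma Pmod_lift:
  fixes M :: "('k::field, 'v::ab_group_add) amod" and N :: "('k, 'w::ab_group_add) amod"
  assumes ch: "CHAR('k) = 2" and M: "umod M" and N: "umod N" and g: "mhom M N g" "g ` car M = car N"
    and f: "mhom (Pmod d (F n)) N f"
  obtains h where "mhom (Pmod d (F n)) M h" "\<And>v. v \<in> car (Pmod d (F n)) \<Longrightarrow> g (h v) = f v"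
proof -
  interpret M: umod M by fact
  interpret N: umod N by fact
  have F: "umod (F n :: ('k, _) amod)" using ch by simp
  interpret F: umod "F n :: ('k, _) amod" by fact
  define \<phi> where "\<phi> v = f (Pinj d v)" for v
  have Pinj_add: "Pinj d (v + w) = Pinj d v + Pinj d w"
    "Pinj d (act (F n) (Gs k) v) = act (Pmod d (F n)) (Gs k) (Pinj d v)" for v w :: "nat \<Rightarrow> 'k" and k
    by (cases d; simp add: Pinj_def; fail)+
  have "lin (F n) N \<phi>"
    using F Prel_Pinj(2)[of "F n", OF F] by (auto simp: lin_def \<phi>_def mhomD[OF f] Pinj_add)
  then obtain L0 where L0: "lin (F n) M L0" "\<And>v. v \<in> car (F n) \<Longrightarrow> g (L0 v) = \<phi> v"
    using F_lift[OF ch M N g] by blast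
  have rel: "Prel d N (\<phi> v)" "\<phi> v \<in> car N" if "v \<in> car (F n)" for v
    unfolding \<phi>_def using Prel_mhom[OF _ f] F Prel_Pinj[OF F that] mhomD(1)[OF f] by simp_all
  \<comment> \<open>\<open>z + c z\<close> lies in the kernel of \<open>c\<close>, where the
    idempotents of \<open>proj0\<close> and \<open>proj1\<close> are available. Being built from the
    operators, \<open>e\<close> passes through \<open>g\<close>, and it fixes
    \<open>\<phi> v\<close>, which already satisfies the relations; so the corrected map is still a
    lift.\<close>
  define e where "e z = (if d then M.b (M.a (M.b (M.a (z + M.c z))))
     else z + M.c z + M.b (M.a (M.b (M.a (z + M.c z)))))" for z
  define L where "L v = e (L0 v)" for v
  have c0: "M.c (z + M.c z) = 0" if "z \<in> car M" for z using that by simp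
  have "Prel d M (L v)" if "v \<in> car (F n)" for v
    using linD(1)[OF L0(1) that] M.proj1[OF _ c0 refl] M.proj0[OF _ c0 refl]
    by (cases d) (simp_all add: L_def e_def Prel_def Let_def)
  moreover have linL: "lin (F n) M L"
    unfolding lin_def L_def e_def by (simp add: linD[OF L0(1)] ac_simps)
  ultimately have h: "mhom (Pmod d (F n)) M (Phom d M L)" by (intro mhom_Phom F M)
  have "g (L v) = \<phi> v" if v: "v \<in> car (F n)" for v
  proof -
    have "g (L v) = (if d then N.b (N.a (N.b (N.a (\<phi> v + N.c (\<phi> v)))))
       else \<phi> v + N.c (\<phi> v) + N.b (N.a (N.b (N.a (\<phi> v + N.c (\<phi> v))))))"
      using linD(1)[OF L0(1) v] rel(2)[OF v] by (simp add: L_def e_def mhomD[OF g(1)] L0(2) v)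
    also have "\<dots> = \<phi> v"
      using rel[OF v] by (cases d) (simp_all add: Prel_def Let_def N.swaps ac_simps)
    finally show ?thesis .
  qed
  then have "g (Phom d M L v) = Phom d N \<phi> v" if "v \<in> car (Pmod d (F n))" for v
    using that by (cases v) (clarsimp simp: Phom_def Let_def mhomD[OF g(1)] linD(1)[OF linL])
  then have "g (Phom d M L v) = f v" if "v \<in> car (Pmod d (F n))" for v
    using that Phom_eq[OF F N f that] by (simp add: \<phi>_def[abs_def])
  with h show thesis using that by blast
qed

subsection \<open>Exact sequences and cancellation\<close>

definition exact_seq :: "('v \<Rightarrow> 'w) \<Rightarrow> ('w \<Rightarrow> 'u) \<Rightarrow> ('k::field, 'v::ab_group_add) amod \<Rightarrow>
    ('k, 'w::ab_group_add) amod \<Rightarrow> ('k, 'u::ab_group_add) amod \<Rightarrow> bool" where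
  "exact_seq j f N P M \<longleftrightarrow> mhom N P j \<and> inj_on j (car N) \<and> mhom P M f \<and> f ` car P = car M \<and>
    (\<forall>v\<in>car P. f v = 0 \<longleftrightarrow> v \<in> j ` car N)"

lemma exact_seqD:
  assumes "exact_seq j f N P M"
  shows "mhom N P j" "inj_on j (car N)" "mhom P M f" "f ` car P = car M"
    "\<And>v. v \<in> car P \<Longrightarrow> f v = 0 \<longleftrightarrow> v \<in> j ` car N"
  using assms by (simp_all add: exact_seq_def)

lemma kernel_iso:
  assumes u: "umod N" "umod N'" "umod P'" and ex: "exact_seq j f N P M" "exact_seq j' f' N' P' M"
    and h: "mhom P P' h" "bij_betw h (car P) (car P')" "\<And>v. v \<in> car P \<Longrightarrow> f' (h v) = f v"
  shows "N \<approx>\<^sub>m N'"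
proof -
  note j = exact_seqD(1,2)[OF ex(1)] and f = exact_seqD(3)[OF ex(1)] and ker = exact_seqD(5)[OF ex(1)]
    and j' = exact_seqD(1,2)[OF ex(2)] and ker' = exact_seqD(5)[OF ex(2)]
  define i where "i = inv_into (car N') j'"
  have hj: "h (j n) \<in> j' ` car N'" if n: "n \<in> car N" for n
    using ker'[of "h (j n)"] h(3)[of "j n"] ker[of "j n"] mhomD(1)[OF j(1) n] mhomD(1)[OF h(1)] n by auto
  have i: "j' (i (h (j n))) = h (j n)" "i (h (j n)) \<in> car N'" if "n \<in> car N" for n
    using hj[OF that] by (simp_all add: i_def f_inv_into_f inv_into_into)
  have inj: "x = y" if "j' x = j' y" "x \<in> car N'" "y \<in> car N'" for x y
    using that j'(2) by (auto dest: inj_onD)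
  interpret N: umod N by fact
  interpret N': umod N' by fact
  have "mhom N N' (\<lambda>n. i (h (j n)))"
    unfolding mhom_def
  proof (intro conjI ballI allI)
    fix v w g assume v: "v \<in> car N"
    show "i (h (j v)) \<in> car N'" using i v by simp
    show "i (h (j (act N g v))) = act N' g (i (h (j v)))"
      by (rule inj) (simp_all add: v i mhomD[OF j'(1)], simp add: v mhomD[OF j(1)] mhomD[OF h(1)])
    assume w: "w \<in> car N"
    show "i (h (j (v + w))) = i (h (j v)) + i (h (j w))"
      by (rule inj) (simp_all add: v w i mhomD[OF j'(1)], simp add: v w mhomD[OF j(1)] mhomD[OF h(1)])
  qed
  moreover have "bij_betw (\<lambda>n. i (h (j n))) (car N) (car N')"
  proof (rule bij_betwI')
    fix x y assume xy: "x \<in> car N" "y \<in> car N"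
    have "x = y" if "i (h (j x)) = i (h (j y))"
    proof -
      have "h (j x) = h (j y)" using i(1)[OF xy(1)] i(1)[OF xy(2)] that by metis
      then have "j x = j y" using bij_betw_imp_inj_on[OF h(2)] xy mhomD(1)[OF j(1)] by (auto dest: inj_onD)
      then show ?thesis using j(2) xy by (auto dest: inj_onD)
    qed
    then show "(i (h (j x)) = i (h (j y))) = (x = y)" by auto
  next
    fix y assume y: "y \<in> car N'"
    have jy: "j' y \<in> car P'" using y mhomD(1)[OF j'(1)] by simp
    then obtain p where p: "p \<in> car P" "h p = j' y" using bij_betw_imp_surj_on[OF h(2)] by (metis imageE)
    have "f p = 0" using h(3)[OF p(1)] p(2) ker'[OF jy] y by auto
    then obtain x where x: "x \<in> car N" "p = j x" using ker[OF p(1)] by blast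
    have "y = i (h (j x))" by (rule inj) (use x p y i[OF x(1)] in simp_all)
    then show "\<exists>x\<in>car N. y = i (h (j x))" using x by blast
  qed (use i in simp)
  ultimately show ?thesis unfolding miso_def by blast
qed

lemma mhom_snd: "mhom (M \<oplus>\<^sub>m N) N snd"
  by (auto simp: mhom_def)

lemma mhom_fst: "mhom (M \<oplus>\<^sub>m N) M fst"
  by (auto simp: mhom_def)

lemma mhom_Pair: "mhom L M f \<Longrightarrow> mhom L N g \<Longrightarrow> mhom L (M \<oplus>\<^sub>m N) (\<lambda>v. (f v, g v))"
  by (auto simp: mhom_def)

lemma mhom_inl: "umod N \<Longrightarrow> mhom M (M \<oplus>\<^sub>m N) (\<lambda>v. (v, 0))"
  by (auto simp: mhom_def umod.zero_mem umod.act_0)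

lemma mhom_inr: "umod M \<Longrightarrow> mhom N (M \<oplus>\<^sub>m N) (\<lambda>v. (0, v))"
  by (auto simp: mhom_def umod.zero_mem umod.act_0)

lemma mhom_add:
  assumes "umod N" "mhom M N f" "mhom M N g" shows "mhom M N (\<lambda>v. f v + g v)"
proof -
  interpret N: umod N by fact
  show ?thesis
    using mhomD[OF assms(2)] mhomD[OF assms(3)] by (auto simp: mhom_def ac_simps)
qed

lemma exact_inl_snd:
  assumes "umod M" "umod Q"
  shows "exact_seq (\<lambda>v. (v, 0)) snd M (M \<oplus>\<^sub>m Q) Q"
proof -
  have "snd ` (car M \<times> car Q) = car Q" using umod.zero_mem[OF assms(1)] by force
  then show ?thesis
    using mhom_inl[OF assms(2)] mhom_snd by (auto simp: exact_seq_def inj_on_def)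
qed

text \<open>This and \<open>exact_fst\<close> give the two sequences on \<open>P \<oplus> P'\<close>
  whose kernels Schanuel's lemma compares.\<close>

lemma exact_snd:
  assumes "umod P" "exact_seq j' f' N' P' M"
  shows "exact_seq (\<lambda>(n, p). (p, j' n)) (\<lambda>v. f' (snd v)) (N' \<oplus>\<^sub>m P) (P \<oplus>\<^sub>m P') M"
proof -
  note j = exact_seqD(1,2)[OF assms(2)] and f = exact_seqD(3,4)[OF assms(2)]
    and ker = exact_seqD(5)[OF assms(2)]
  have "mhom (N' \<oplus>\<^sub>m P) (P \<oplus>\<^sub>m P') (\<lambda>(n, p). (p, j' n))" using j(1) by (auto simp: mhom_def)
  moreover have "(\<lambda>v. f' (snd v)) ` car (P \<oplus>\<^sub>m P') = car M"
    using f(2) umod.zero_mem[OF assms(1)] by force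
  ultimately show ?thesis
    using j f ker mhom_comp[OF mhom_snd f(1)] by (auto simp: exact_seq_def inj_on_def image_iff)
qed

lemma exact_fst:
  assumes "umod P'" "exact_seq j f N P M"
  shows "exact_seq (\<lambda>(n, p). (j n, p)) (\<lambda>v. f (fst v)) (N \<oplus>\<^sub>m P') (P \<oplus>\<^sub>m P') M"
proof -
  note j = exact_seqD(1,2)[OF assms(2)] and f = exact_seqD(3,4)[OF assms(2)]
    and ker = exact_seqD(5)[OF assms(2)]
  have "mhom (N \<oplus>\<^sub>m P') (P \<oplus>\<^sub>m P') (\<lambda>(n, p). (j n, p))" using j(1) by (auto simp: mhom_def)
  moreover have "(\<lambda>v. f (fst v)) ` car (P \<oplus>\<^sub>m P') = car M"
    using f(2) umod.zero_mem[OF assms(1)] by force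
  ultimately show ?thesis
    using j f ker mhom_comp[OF mhom_fst f(1)] by (auto simp: exact_seq_def inj_on_def image_iff)
qed

text \<open>The automorphism \<open>h1\<close> of \<open>P \<oplus> P'\<close> carries \<open>(0, f')\<close> to \<open>(f, 0)\<close>, hence one kernel to the other.\<close>

lemma schanuel:
  assumes u: "umod N" "umod P" "umod M" "umod N'" "umod P'"
    and ex: "exact_seq j f N P M" and ex': "exact_seq j' f' N' P' M"
    and h: "mhom P P' h" "\<And>v. v \<in> car P \<Longrightarrow> f' (h v) = f v"
    and h': "mhom P' P h'" "\<And>v. v \<in> car P' \<Longrightarrow> f (h' v) = f' v"
  shows "N' \<oplus>\<^sub>m P \<approx>\<^sub>m N \<oplus>\<^sub>m P'"
proof -
  interpret P: umod P by fact
  interpret M: umod M by fact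
  interpret P': umod P' by fact
  note f = exact_seqD(3)[OF ex] and f' = exact_seqD(3)[OF ex']
  note [simp] = mhomD[OF f] mhomD[OF f'] mhomD[OF h(1)] mhomD[OF h'(1)] h(2) h'(2)
  \<comment> \<open>\<open>?h1\<close> is a product of two shears, each of them an involution in
    characteristic 2; \<open>?h2\<close> applies them in the opposite order.\<close>
  let ?h1 = "\<lambda>(p, p'). (p + h' (p' + h p), p' + h p)" and ?h2 = "\<lambda>(p, p'). (p + h' p', p' + h (p + h' p'))"
  have 1: "mhom (P \<oplus>\<^sub>m P') (P \<oplus>\<^sub>m P') ?h1"
    by (rule mhomI) (auto simp: u ac_simps)
  have 2: "bij_betw ?h1 (car (P \<oplus>\<^sub>m P')) (car (P \<oplus>\<^sub>m P'))"
    by (rule bij_betwI[where g = ?h2]) (auto simp: ac_simps)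
  show ?thesis
    by (rule kernel_iso[OF _ _ _ exact_snd[OF u(2) ex'] exact_fst[OF u(5) ex] 1 2])
      (auto simp: u ac_simps)
qed

text \<open>Schanuel's lemma for the given sequence and the identity of \<open>Q\<close>, whose
  kernel is the zero module \<open>?Z\<close>.\<close>

lemma split_exact:
  assumes u: "umod K" "umod E" "umod Q" and ex: "exact_seq j f K E Q"
    and s: "mhom Q E s" "\<And>q. q \<in> car Q \<Longrightarrow> f (s q) = q"
  shows "E \<approx>\<^sub>m K \<oplus>\<^sub>m Q"
proof -
  let ?Z = "mpow 0 Q"
  have Z: "car ?Z = {0}" "umod ?Z" using u(3) by (auto simp: car_mpow fun_eq_iff umod.zero_mem)
  have "exact_seq (\<lambda>_. 0) (\<lambda>v. v) ?Z Q Q"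
    using umod.zero_mem[OF u(3)] umod.act_0[OF u(3)] by (auto simp: exact_seq_def mhom_def Z)
  moreover have "mhom E Q f" using ex by (simp add: exact_seq_def)
  ultimately have "?Z \<oplus>\<^sub>m E \<approx>\<^sub>m K \<oplus>\<^sub>m Q"
    by (rule schanuel[OF u Z(2) u(3) ex _ _ refl s])
  moreover have "E \<approx>\<^sub>m ?Z \<oplus>\<^sub>m E"
    by (rule misoI[where f = "\<lambda>v. (0, v)" and g = snd])
      (use umod.act_0[OF Z(2)] in \<open>auto simp: Z mhom_def\<close>)
  ultimately show ?thesis using miso_trans by blast
qed

text \<open>\<open>\<Lambda>\<close> is the residue map of the local ring \<open>End P\<close>.\<close>

lemma cancel_local:
  assumes "umod M" "umod N" "umod P" and iso: "M \<oplus>\<^sub>m P \<approx>\<^sub>m N \<oplus>\<^sub>m P"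
    and add: "\<And>\<theta> \<eta>. mhom P P \<theta> \<Longrightarrow> mhom P P \<eta> \<Longrightarrow> \<Lambda> (\<lambda>v. \<theta> v + \<eta> v) = \<Lambda> \<theta> + (\<Lambda> \<eta> :: 'a::field)"
    and mult: "\<And>\<theta> \<eta>. mhom P P \<theta> \<Longrightarrow> mhom P P \<eta> \<Longrightarrow> \<Lambda> (\<lambda>v. \<theta> (\<eta> v)) = \<Lambda> \<theta> * \<Lambda> \<eta>"
    and ident: "\<And>\<theta>. mhom P P \<theta> \<Longrightarrow> (\<And>v. v \<in> car P \<Longrightarrow> \<theta> v = v) \<Longrightarrow> \<Lambda> \<theta> = 1"
    and bij: "\<And>\<theta>. mhom P P \<theta> \<Longrightarrow> \<Lambda> \<theta> \<noteq> 0 \<Longrightarrow> bij_betw \<theta> (car P) (car P)"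
  shows "M \<approx>\<^sub>m N"
proof -
  interpret M: umod M by fact
  interpret N: umod N by fact
  interpret P: umod P by fact
  have MP: "umod (M \<oplus>\<^sub>m P)" "umod (N \<oplus>\<^sub>m P)" by (simp_all add: assms)
  \<comment> \<open>If the \<open>P\<close>-\<open>P\<close> entry of \<open>\<Phi>\<close> is
    bijective, then \<open>?h\<close> is an automorphism of the source that turns the second
    component of \<open>\<Phi>\<close> into the plain projection. The kernels of these two maps are
    \<open>N\<close>, embedded by \<open>\<Psi>\<close>, and \<open>M\<close>.\<close>
  have step: "M \<approx>\<^sub>m N"
    if \<Phi>: "mhom (M \<oplus>\<^sub>m P) (N \<oplus>\<^sub>m P) \<Phi>" "bij_betw \<Phi> (car (M \<oplus>\<^sub>m P)) (car (N \<oplus>\<^sub>m P))"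
      and b: "bij_betw (\<lambda>p. snd (\<Phi> (0, p))) (car P) (car P)" for \<Phi>
  proof -
    obtain \<Psi> where \<Psi>: "mhom (N \<oplus>\<^sub>m P) (M \<oplus>\<^sub>m P) \<Psi>" "\<And>v. v \<in> car (M \<oplus>\<^sub>m P) \<Longrightarrow> \<Psi> (\<Phi> v) = v"
      "\<And>v. v \<in> car (N \<oplus>\<^sub>m P) \<Longrightarrow> \<Phi> (\<Psi> v) = v" using mhom_inv[OF MP \<Phi>] by metis
    let ?h = "\<lambda>v. (fst v, snd (\<Phi> v))"
    have h: "mhom (M \<oplus>\<^sub>m P) (M \<oplus>\<^sub>m P) ?h"
      by (rule mhom_Pair[OF mhom_fst mhom_comp[OF \<Phi>(1) mhom_snd]])
    have \<Phi>P: "snd (\<Phi> (m, p)) \<in> car P" if "m \<in> car M" "p \<in> car P" for m p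
      using mhomD(1)[OF \<Phi>(1), of "(m, p)"] that by (simp add: mem_Times_iff)
    have split: "snd (\<Phi> (m, p)) = snd (\<Phi> (m, 0)) + snd (\<Phi> (0, p))" if "m \<in> car M" "p \<in> car P" for m p
      using mhomD(2)[OF \<Phi>(1), of "(m, 0)" "(0, p)"] that by simp
    have hb: "bij_betw ?h (car (M \<oplus>\<^sub>m P)) (car (M \<oplus>\<^sub>m P))"
    proof (rule bij_betwI')
      fix v w assume "v \<in> car (M \<oplus>\<^sub>m P)" "w \<in> car (M \<oplus>\<^sub>m P)"
      then have "fst v \<in> car M" "snd v \<in> car P" "fst w \<in> car M" "snd w \<in> car P" by (auto simp: mem_Times_iff)
      then show "(?h v = ?h w) = (v = w)"
        using split[of "fst v" "snd v"] split[of "fst w"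
          "snd w"] inj_onD[OF bij_betw_imp_inj_on[OF b], of "snd v" "snd w"]
        by (auto simp: prod_eq_iff)
    next
      fix v assume v: "v \<in> car (M \<oplus>\<^sub>m P)"
      then have m: "fst v \<in> car M" "snd v \<in> car P" by (auto simp: mem_Times_iff)
      then have "snd v + snd (\<Phi> (fst v, 0)) \<in> (\<lambda>p. snd (\<Phi> (0, p))) ` car P"
        using bij_betw_imp_surj_on[OF b] \<Phi>P by simp
      then obtain p where p: "p \<in> car P" "snd (\<Phi> (0, p)) = snd v + snd (\<Phi> (fst v, 0))" by auto
      show "\<exists>w\<in>car (M \<oplus>\<^sub>m P). v = ?h w"
        using split[OF m(1) p(1)] p m \<Phi>P[OF m(1) P.zero_mem]
        by (intro bexI[of _ "(fst v, p)"]) (simp_all add: prod_eq_iff ac_simps)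
    qed (use mhomD(1)[OF h] in simp)
    have \<Psi>m: "\<Psi> v \<in> car M \<times> car P" if "v \<in> car N \<times> car P" for v using mhomD(1)[OF \<Psi>(1)] that by simp
    have "exact_seq (\<lambda>n. \<Psi> (n, 0)) (\<lambda>v. snd (\<Phi> v)) N (M \<oplus>\<^sub>m P) P"
      unfolding exact_seq_def
    proof (intro conjI ballI)
      show "mhom N (M \<oplus>\<^sub>m P) (\<lambda>n. \<Psi> (n, 0))" by (rule mhom_comp[OF mhom_inl[OF assms(3)] \<Psi>(1)])
      show "mhom (M \<oplus>\<^sub>m P) P (\<lambda>v. snd (\<Phi> v))" by (rule mhom_comp[OF \<Phi>(1) mhom_snd])
      show "inj_on (\<lambda>n. \<Psi> (n, 0)) (car N)"
        by (rule inj_onI) (metis P.zero_mem SigmaI \<Psi>(3) fst_conv msum_simps(1))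
      show "(\<lambda>v. snd (\<Phi> v)) ` car (M \<oplus>\<^sub>m P) = car P"
      proof (intro equalityI subsetI)
        fix p assume "p \<in> car P"
        then show "p \<in> (\<lambda>v. snd (\<Phi> v)) ` car (M \<oplus>\<^sub>m P)"
          using \<Psi>(3)[of "(0, p)"] \<Psi>m[of "(0, p)"] by (intro rev_image_eqI[of "\<Psi> (0, p)"]) simp_all
      qed (use \<Phi>P in auto)
      fix v assume v: "v \<in> car (M \<oplus>\<^sub>m P)"
      then obtain n p where np: "\<Phi> v = (n, p)" "n \<in> car N" using mhomD(1)[OF \<Phi>(1), of v] by (cases "\<Phi> v") auto
      show "snd (\<Phi> v) = 0 \<longleftrightarrow> v \<in> (\<lambda>n. \<Psi> (n, 0)) ` car N"
        using \<Psi>(2)[OF v] \<Psi>(3) np by auto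
    qed
    from kernel_iso[OF assms(2,1) MP(1) this exact_inl_snd[OF assms(1,3)] h hb] have "N \<approx>\<^sub>m M" by simp
    then show ?thesis by (rule miso_sym) fact+
  qed
  obtain \<Phi> where \<Phi>0: "mhom (M \<oplus>\<^sub>m P) (N \<oplus>\<^sub>m P) \<Phi>" and \<Phi>b: "bij_betw \<Phi> (car (M \<oplus>\<^sub>m P)) (car (N \<oplus>\<^sub>m P))"
    using iso unfolding miso_def by blast
  obtain \<Psi> where \<Phi>: "mhom (M \<oplus>\<^sub>m P) (N \<oplus>\<^sub>m P) \<Phi>" "mhom (N \<oplus>\<^sub>m P) (M \<oplus>\<^sub>m P) \<Psi>"
      "\<And>v. v \<in> car (M \<oplus>\<^sub>m P) \<Longrightarrow> \<Psi> (\<Phi> v) = v" "\<And>v. v \<in> car (N \<oplus>\<^sub>m P) \<Longrightarrow> \<Phi> (\<Psi> v) = v"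
    using mhom_inv[OF MP \<Phi>0 \<Phi>b] \<Phi>0 by metis
  define \<delta> where "\<delta> p = snd (\<Phi> (0, p))" for p
  define \<delta>' where "\<delta>' p = snd (\<Psi> (0, p))" for p
  define \<beta> where "\<beta> p = fst (\<Psi> (0, p))" for p
  define \<epsilon> where "\<epsilon> p = snd (\<Phi> (\<beta> p, 0))" for p
  have \<delta>: "mhom P P \<delta>" and \<delta>': "mhom P P \<delta>'" and \<beta>: "mhom P M \<beta>" and \<epsilon>: "mhom P P \<epsilon>"
    unfolding \<delta>_def \<delta>'_def \<epsilon>_def \<beta>_def
    by (auto intro!: mhom_comp[OF _ mhom_snd] mhom_comp[OF _ mhom_fst] mhom_comp[OF _ \<Phi>(1)] mhom_comp[OF _ \<Phi>(2)]
       mhom_inr assms(1,2,3) mhom_comp[OF _ mhom_inl])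
  note [simp] = mhomD(1)[OF \<delta>] mhomD(1)[OF \<delta>'] mhomD(1)[OF \<epsilon>] mhomD[OF \<beta>] mhom_0[OF assms(3) \<beta>]
  have split: "snd (\<Phi> (\<beta> p, p')) = \<epsilon> p + \<delta> p'" if "p \<in> car P" "p' \<in> car P" for p p'
    using that mhomD(2)[OF \<Phi>(1), of "(\<beta> p, 0)" "(0, p')"] by (simp add: \<epsilon>_def \<delta>_def)
  \<comment> \<open>This is the \<open>P\<close>-\<open>P\<close> entry of
    \<open>\<Phi> \<Psi> = 1\<close>; \<open>\<epsilon>\<close> is the part that passes through
    \<open>M\<close>.\<close>
  have "\<delta> (\<delta>' p) + \<epsilon> p = p" if "p \<in> car P" for p
  proof -
    have "\<Phi> (\<beta> p, \<delta>' p) = (0, p)" using \<Phi>(4)[of "(0, p)"] that by (simp add: \<beta>_def \<delta>'_def)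
    then show ?thesis using split[of p "\<delta>' p"] that by (simp add: add.commute)
  qed
  moreover have \<delta>\<delta>: "mhom P P (\<lambda>p. \<delta> (\<delta>' p))" by (rule mhom_comp[OF \<delta>' \<delta>])
  ultimately have one: "\<Lambda> \<delta> * \<Lambda> \<delta>' + \<Lambda> \<epsilon> = 1"
    using add[OF \<delta>\<delta> \<epsilon>] mult[OF \<delta> \<delta>'] ident[OF mhom_add[OF assms(3) \<delta>\<delta> \<epsilon>]] by simp
  show ?thesis
  proof (cases "\<Lambda> \<delta> = 0")
    case False
    then show ?thesis using step[OF \<Phi>(1) \<Phi>b] bij[OF \<delta>] by (simp add: \<delta>_def[abs_def])
  next
    case True
    \<comment> \<open>Now \<open>\<epsilon>\<close> has residue 1. Composing \<open>\<Phi>\<close>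
      with the shear \<open>?s\<close> changes the \<open>P\<close>-\<open>P\<close> entry from
      \<open>\<delta>\<close> to \<open>\<epsilon> + \<delta>\<close>, which also has residue 1, so
      that \<open>step\<close> applies.\<close>
    let ?s = "\<lambda>(m, p). (m + \<beta> p, p)"
    have s: "mhom (M \<oplus>\<^sub>m P) (M \<oplus>\<^sub>m P) ?s" by (auto simp: mhom_def ac_simps)
    have sb: "bij_betw ?s (car (M \<oplus>\<^sub>m P)) (car (M \<oplus>\<^sub>m P))"
      by (rule bij_betwI[where g = ?s]) (auto simp: add.assoc)
    have "bij_betw (\<lambda>p. \<epsilon> p + \<delta> p) (car P) (car P)"
      using one True add[OF \<epsilon> \<delta>] by (intro bij mhom_add assms \<epsilon> \<delta>) simp
    then have "bij_betw (\<lambda>p. snd (\<Phi> (?s (0, p)))) (car P) (car P)"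
      by (rule bij_betw_cong[THEN iffD1, rotated]) (simp add: split)
    then show ?thesis
      by (rule step[OF mhom_comp[OF s \<Phi>(1)] bij_betw_trans[OF sb \<Phi>b, unfolded comp_def]])
  qed
qed

section \<open>Endomorphisms of the indecomposable projectives\<close>

lemma umod_ground_add_self: "CHAR('k::field) = 2 \<Longrightarrow> (v::'k) + v = 0"
  using umod.add_self[of "ground :: ('k, 'k) amod"] by simp

text \<open>This is \<open>l + m n\<close>, where \<open>n\<close> is the square-zero endomorphism
  that carries the top onto the socle.\<close>

fun endo :: "bool \<Rightarrow> 'k::field \<Rightarrow> 'k \<Rightarrow> 'k \<times> 'k \<times> 'k \<times> 'k \<times> 'k \<times> 'k \<times> 'k \<times> 'k
  \<Rightarrow> 'k \<times> 'k \<times> 'k \<times> 'k \<times> 'k \<times> 'k \<times> 'k \<times> 'k" where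
  "endo d l m (p1, p2, p3, p4, p5, p6, p7, p8) = (if d
    then (l * p1, l * p2, l * p3, l * p4, l * p5, l * p6 + m * p1, l * p7 + m * p2, l * p8 + m * p3)
    else (l * p1, l * p2, l * p3, l * p4, l * p5, l * p6, l * p7, l * p8 + m * p1))"

text \<open>An endomorphism is determined by the image of the generator, and \<open>Prel\<close>
  leaves only the component along the generator and the one along its copy in the socle.\<close>

lemma endo_form:
  fixes \<theta> :: "'k::field \<times> 'k \<times> 'k \<times> 'k \<times> 'k \<times> 'k \<times> 'k \<times> 'k \<Rightarrow> 'k \<times> 'k \<times> 'k \<times> 'k \<times> 'k \<times> 'k \<times> 'k \<times> 'k"
  assumes ch: "CHAR('k) = 2" and \<theta>: "mhom (Pmod d ground) (Pmod d ground) \<theta>"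
  obtains l m where "\<And>v. \<theta> v = endo d l m v"
proof -
  have um: "umod (ground :: ('k, 'k) amod)" by (rule umod_ground[OF ch])
  note [simp] = umod_ground_add_self[OF ch]
  have two [simp]: "(2::'k) = 0" by (metis umod_ground_add_self[OF ch] one_add_one)
  have three [simp]: "(3::'k) = 1" using two by (metis add.left_neutral numeral_Bit1 numeral_One one_add_one)
  have neg [simp]: "- v = v" for v :: 'k by (metis umod_ground_add_self[OF ch] add_eq_0_iff)
  obtain p1 p2 p3 p4 p5 p6 p7 p8 where p: "\<theta> (Pinj d 1) = (p1, p2, p3, p4, p5, p6, p7, p8)" by (metis surj_pair)
  have rel: "Prel d (Pmod d ground) (\<theta> (Pinj d 1))"
    by (rule Prel_mhom[OF _ \<theta>]) (use um Prel_Pinj[OF um, of 1] in auto)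
  have val: "\<theta> (Pinj d x) = act (Pmod d ground) (Gs x) (\<theta> (Pinj d 1))" for x
  proof -
    have "Pinj d x = act (Pmod d ground) (Gs x) (Pinj d 1)" by (cases d) (simp_all add: Pinj_def)
    then show ?thesis using mhomD(3)[OF \<theta>] Prel_Pinj(2)[OF um, of 1] by simp
  qed
  show thesis
  proof (cases d)
    case True
    then have d: "d = True" by simp
    have z1: "p1 = 0" "p3 = 0" "p6 = 0" "p8 = 0"
      using rel unfolding d p[unfolded d] by (simp_all add: Prel_def Let_def zero_prod_def)
    let ?m = "(p1, p2, p3, p4, p5, p6, p7, p8)"
    let ?a = "act (Pmod True ground) Ga" and ?b = "act (Pmod True ground) Gb"
    have e: "?b (?b (?a (?a ?m))) = ?b (?a ?m) + ?m"
      using rel unfolding d p[unfolded d] by (simp only: Prel_def Let_def if_True)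
    \<comment> \<open>In the coordinates of \<open>q1\<close> and \<open>q2\<close> the left side of
      \<open>e\<close> vanishes, while the right side is \<open>p4\<close> and
      \<open>p5\<close>.\<close>
    have z2: "p4 = 0" "p5 = 0"
      using arg_cong[OF e, of "\<lambda>v. fst (snd (snd (snd v)))"]
        arg_cong[OF e, of "\<lambda>v. fst (snd (snd (snd (snd v))))"] by (simp_all add: z1)
    note z = z1 z2
    have "\<theta> v = endo d p2 p7 v" for v
      using Phom_eq[OF um _ \<theta>, of v] um z unfolding d
      by (cases v) (clarsimp simp: Phom_def Let_def val[unfolded p, unfolded d] algebra_simps)
    then show thesis by (rule that)
  next
    case False
    then have d: "d = False" by simp
    have z: "p2 = 0" "p3 = 0" "p4 = 0" "p5 = 0" "p6 = 0" "p7 = 0"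
      using rel unfolding d p[unfolded d] by (simp_all add: Prel_def Let_def zero_prod_def)
    have "\<theta> v = endo d p1 p8 v" for v
      using Phom_eq[OF um _ \<theta>, of v] um z unfolding d
      by (cases v) (clarsimp simp: Phom_def Let_def val[unfolded p, unfolded d] algebra_simps)
    then show thesis by (rule that)
  qed
qed

lemma cancel_Pmod_ground:
  fixes M :: "('k::field, 'v::ab_group_add) amod" and N :: "('k, 'w::ab_group_add) amod"
  assumes ch: "CHAR('k) = 2" and M: "umod M" and N: "umod N"
    and iso: "M \<oplus>\<^sub>m Pmod d ground \<approx>\<^sub>m N \<oplus>\<^sub>m Pmod d ground"
  shows "M \<approx>\<^sub>m N"
proof -
  have um: "umod (ground :: ('k, 'k) amod)" by (rule umod_ground[OF ch])
  define pc where "pc v = (if d then fst (snd v) else fst v)" for v :: "'k \<times> 'k \<times> 'k \<times> 'k \<times> 'k \<times> 'k \<times> 'k \<times> 'k"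
  have pc_endo: "pc (endo d l m (Pinj d 1)) = l" for l m by (simp add: pc_def Pinj_def)
  show ?thesis
  proof (rule cancel_local[OF M N umod_Pmod[OF um] iso, where \<Lambda> = "\<lambda>\<theta>. pc (\<theta> (Pinj d 1))"], goal_cases)
    case 1 then show ?case by (simp add: pc_def)
  next
    case (2 \<theta> \<eta>)
    obtain l m where 1: "\<And>v. \<theta> v = endo d l m v" using endo_form[OF ch 2(1)] by metis
    obtain l' m' where 2: "\<And>v. \<eta> v = endo d l' m' v" using endo_form[OF ch 2(2)] by metis
    show ?case unfolding 1 2 pc_endo by (simp add: pc_def Pinj_def)
  next
    case (3 \<theta>)
    then have "\<theta> (Pinj d 1) = Pinj d 1" using Prel_Pinj(2)[OF um, of 1] by simp
    then show ?case by (simp add: pc_def Pinj_def)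
  next
    case (4 \<theta>)
    obtain l m where 1: "\<And>v. \<theta> v = endo d l m v" using endo_form[OF ch 4(1)] by metis
    from 4(2) have l: "l \<noteq> 0" unfolding 1 pc_endo .
    have 2: "v + v = 0" for v :: 'k using umod_ground_add_self[OF ch] .
    \<comment> \<open>The inverse of \<open>l + m n\<close> with \<open>n^2 = 0\<close> is
      \<open>1/l + (m/l^2) n\<close>, the sign being immaterial in characteristic 2.\<close>
    define i where "i = inverse l"
    define k where "k = i * i * m"
    have r: "l * (i * x) = x" "i * (l * x) = x" "l * (k * x) = m * (i * x)" "k * (l * x) = i * (m * x)" for x
      using l by (simp_all add: i_def k_def)
    have "endo d l m (endo d i k v) = v" "endo d i k (endo d l m v) = v" for v
      by (cases v; cases d; clarsimp simp: r distrib_left add.assoc 2)+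
    then have "bij_betw (endo d l m) UNIV UNIV" by (intro bij_betwI[where g="endo d i k"]) auto
    moreover have "\<theta> = endo d l m" using 1 by blast
    moreover have "car (Pmod d (ground :: ('k, 'k) amod)) = UNIV" by simp
    ultimately show ?case by simp
  qed
qed

section \<open>Functoriality and additivity in the multiplicity space\<close>

lemma mhom_Pmod:
  assumes "umod V" "umod W" "lin V W f"
  shows "mhom (Pmod d V) (Pmod d W) (\<lambda>(p1, p2, p3, p4, p5, p6, p7, p8).
    (f p1, f p2, f p3, f p4, f p5, f p6, f p7, f p8))"
proof -
  have [simp]: "f 0 = 0" by (rule lin_0[OF assms(1,3)])
  show ?thesis
    using linD[OF assms(3)] umod.zero_mem[OF assms(1)]
    by (intro mhomI umod_Pmod assms) (cases d; clarsimp; fail)+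
qed

lemma Pmod_cong:
  assumes "umod V" "umod W" "V \<approx>\<^sub>m W" shows "Pmod d V \<approx>\<^sub>m Pmod d W"
proof -
  obtain f g where f: "mhom V W f" and g: "mhom W V g" and fg: "\<And>v. v \<in> car V \<Longrightarrow> g (f v) = v"
    "\<And>w. w \<in> car W \<Longrightarrow> f (g w) = w" using misoE[OF assms(3,1,2)] by metis
  show ?thesis
    by (rule misoI[OF mhom_Pmod[OF assms(1,2) mhom_lin[OF f]], where
        g = "\<lambda>(p1, p2, p3, p4, p5, p6, p7, p8). (g p1, g p2, g p3, g p4, g p5, g p6, g p7, g p8)"])
      (auto simp: fg mhomD(1)[OF f] mhomD(1)[OF g])
qed

lemma Pmod_msum:
  assumes "umod V" "umod W"
  shows "Pmod d (V \<oplus>\<^sub>m W) \<approx>\<^sub>m Pmod d V \<oplus>\<^sub>m Pmod d W"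
  by (rule misoI[where f = "\<lambda>((p1, q1), (p2, q2), (p3, q3), (p4, q4), (p5, q5), (p6, q6), (p7, q7), (p8, q8)).
        ((p1, p2, p3, p4, p5, p6, p7, p8), (q1, q2, q3, q4, q5, q6, q7, q8))"
      and g = "\<lambda>((p1, p2, p3, p4, p5, p6, p7, p8), (q1, q2, q3, q4, q5, q6, q7, q8)).
        ((p1, q1), (p2, q2), (p3, q3), (p4, q4), (p5, q5), (p6, q6), (p7, q7), (p8, q8))"],
      rule mhomI) (use assms in \<open>cases d; clarsimp simp: zero_prod_def; fail\<close>)+

lemma mpow_add: "umod M \<Longrightarrow> mpow (m + n) M \<approx>\<^sub>m mpow m M \<oplus>\<^sub>m mpow n M"
  by (rule misoI[where f = "\<lambda>f. ((\<lambda>i. if i < m then f i else 0), (\<lambda>i. f (m + i)))"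
      and g = "\<lambda>(f, h) i. if i < m then f i else h (i - m)"])
    (auto simp: mhom_def car_mpow act_mpow fun_eq_iff umod.zero_mem umod.act_0)

lemma mpow_1: "umod M \<Longrightarrow> mpow 1 M \<approx>\<^sub>m M"
  by (rule misoI[where f = "\<lambda>f. f 0" and g = "\<lambda>v i. if i = 0 then v else 0"])
    (auto simp: mhom_def car_mpow act_mpow fun_eq_iff umod.zero_mem)

lemma msum_trivial:
  assumes "umod M" "umod N" "car N = {0}" shows "M \<oplus>\<^sub>m N \<approx>\<^sub>m M"
  by (rule misoI[where f = fst and g = "\<lambda>v. (v, 0)"]) (use assms in \<open>auto simp: mhom_def\<close>)

lemma car_mpow_0: "umod M \<Longrightarrow> car (mpow 0 M) = {0}"
  by (auto simp: car_mpow fun_eq_iff umod.zero_mem)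

lemma miso_zero:
  assumes "umod M" "umod N" "car M = {0}" "car N = {0}" shows "M \<approx>\<^sub>m N"
proof -
  have [simp]: "act M g 0 = 0" "act N g 0 = 0" for g using assms(1,2) by (simp_all add: umod.act_0)
  show ?thesis
    by (rule misoI[where f = "\<lambda>_. 0" and g = "\<lambda>_. 0"]) (auto simp: mhom_def assms(3,4))
qed

lemma mpow_Suc: "umod M \<Longrightarrow> mpow (Suc n) M \<approx>\<^sub>m mpow n M \<oplus>\<^sub>m M"
  using miso_trans[OF mpow_add[of M n 1] msum_cong[OF miso_refl mpow_1]] by simp

lemma mpow_mpow:
  assumes M: "umod M" shows "mpow m (mpow n M) \<approx>\<^sub>m mpow (m * n) M"
proof (induction m)
  case 0
  then show ?case using M by (intro miso_zero) (simp_all add: car_mpow_0)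
next
  case (Suc m)
  have "mpow (Suc m) (mpow n M) \<approx>\<^sub>m mpow m (mpow n M) \<oplus>\<^sub>m mpow n M"
    using M by (intro mpow_Suc) simp
  also have "\<dots> \<approx>\<^sub>m mpow (m * n) M \<oplus>\<^sub>m mpow n M" by (rule msum_cong[OF Suc miso_refl])
  also have "\<dots> \<approx>\<^sub>m mpow (m * n + n) M"
    using M by (intro miso_sym[OF mpow_add]) simp_all
  finally show ?case by (simp add: add.commute)
qed

lemma mpow_Pmod:
  assumes M: "umod M" shows "mpow n (Pmod d M) \<approx>\<^sub>m Pmod d (mpow n M)"
proof (induction n)
  case 0
  then show ?case using M by (intro miso_zero) (auto simp: car_mpow_0 zero_prod_def)
next
  case (Suc n)
  have "mpow (Suc n) (Pmod d M) \<approx>\<^sub>m mpow n (Pmod d M) \<oplus>\<^sub>m Pmod d M"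
    using M by (intro mpow_Suc) simp
  also have "\<dots> \<approx>\<^sub>m Pmod d (mpow n M) \<oplus>\<^sub>m Pmod d M" by (rule msum_cong[OF Suc miso_refl])
  also have "\<dots> \<approx>\<^sub>m Pmod d (mpow n M \<oplus>\<^sub>m M)"
    using M by (intro miso_sym[OF Pmod_msum]) simp_all
  also have "\<dots> \<approx>\<^sub>m Pmod d (mpow (Suc n) M)"
    using M by (intro Pmod_cong miso_sym[OF mpow_Suc]) simp_all
  finally show ?case .
qed

lemma V1t_cong:
  assumes "umod V" "umod W" "V \<approx>\<^sub>m W" shows "V1t V \<approx>\<^sub>m V1t W"
proof -
  obtain f g where f: "mhom V W f" and g: "mhom W V g" and fg: "\<And>v. v \<in> car V \<Longrightarrow> g (f v) = v"
    "\<And>w. w \<in> car W \<Longrightarrow> f (g w) = w" using misoE[OF assms(3,1,2)] by metis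
  interpret V: umod V by fact
  have "mhom (V1t V) (V1t W) (\<lambda>(x, y, z). (f x, f y, f z))"
    by (rule mhomI) (auto simp: assms mhomD[OF f])
  then show ?thesis
    by (rule misoI[where g = "\<lambda>(x, y, z). (g x, g y, g z)"]) (auto simp: fg mhomD(1)[OF g])
qed

subsection \<open>Tensor products with \<open>V\<^sub>1\<close>\<close>

text \<open>
  The isomorphisms of this subsection are determined by the images of the generators \<open>p\<close> and \<open>p\<^sub>2\<close>;
  these were found by solving linear equations over the field with two elements.
\<close>

lemma V1t_Pmod_False:
  assumes "umod V"
  shows "Pmod True V \<oplus>\<^sub>m Pmod True V \<oplus>\<^sub>m Pmod True V \<approx>\<^sub>m V1t (Pmod False V)"
proof -
  interpret V: umod V by fact
  let ?f = "\<lambda>((x1, x2, x3, x4, x5, x6, x7, x8), (y1, y2, y3, y4, y5, y6, y7, y8),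
    (z1, z2, z3, z4, z5, z6, z7, z8)).
      ((x1, x2 + z5, x3 + z6, x4 + z7, y5, y1 + y6, x5 + y2 + y7, x6 + y3 + y8),
      (x2, z1 + z6, x4 + z2, z3 + z8, y6, x5 + y2, y8, x7 + y4 + z5),
      (x3, x4 + z2 + z7, z8, z4, x5 + y7, x1 + y3 + y8, x2 + y4, x3 + x8 + z6))"
  let ?g = "\<lambda>((x1, x2, x3, x4, x5, x6, x7, x8), (y1, y2, y3, y4, y5, y6, y7, y8),
    (z1, z2, z3, z4, z5, z6, z7, z8)).
      ((x1, y1, z1, x4 + y3 + z2, x7 + y6 + z5, x1 + x8 + z6, x2 + y8 + z7, x3 + z8),
      (x6 + y5, x7 + z5, x1 + y7 + z6, y1 + z7, x5, y5, x7 + y6, y7),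
      (x3 + y2 + z1, x4 + z2, y4 + z3, z4, x2 + y1, x3 + z1, y3 + z2, z3))"
  have "mhom (Pmod True V \<oplus>\<^sub>m Pmod True V \<oplus>\<^sub>m Pmod True V) (V1t (Pmod False V)) ?f"
    by (rule mhomI) (clarsimp simp: assms ac_simps; fail)+
  then show ?thesis
    by (rule misoI[where g = ?g]) (clarsimp simp: ac_simps; fail)+
qed

lemma V1t_Pmod_True:
  assumes "umod V"
  shows "Pmod False V \<oplus>\<^sub>m Pmod True V \<oplus>\<^sub>m Pmod True V \<approx>\<^sub>m V1t (Pmod True V)"
proof -
  interpret V: umod V by fact
  let ?f = "\<lambda>((x1, x2, x3, x4, x5, x6, x7, x8), (y1, y2, y3, y4, y5, y6, y7, y8),
    (z1, z2, z3, z4, z5, z6, z7, z8)).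
      ((y5, y6, x1 + y7, x2 + y8, x5, x6 + y5 + z5, x7 + y1 + y6 + z1 + z6, x8 + y2 + y7 + z2 + z7),
      (y1 + y6, x1 + y2, y3 + y8, x3 + y4, x6 + y5, z6, x8 + y2 + y7 + z2, z8),
      (x1 + y2 + y7, y8, y4, x4, x7 + y6, x1 + x8 + y7 + z7, x2 + y3 + z3 + z8, x3 + y4 + z4))"
  let ?g = "\<lambda>((x1, x2, x3, x4, x5, x6, x7, x8), (y1, y2, y3, y4, y5, y6, y7, y8),
    (z1, z2, z3, z4, z5, z6, z7, z8)).
      ((x3 + y2 + z1, x4 + z2, y4 + z3, z4, x5, x1 + y5, x2 + z5, x3 + x8 + y7 + z6),
      (x2 + y1, x3 + z1, y3 + z2, z3, x1, x2, y2 + z1, z2),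
      (x2 + x7 + y1 + y6 + z5, x8 + y2 + z6, x4 + y3 + y8 + z7, y4 + z8, x6 + y5, y6, x8 + y7, y8))"
  have "mhom (Pmod False V \<oplus>\<^sub>m Pmod True V \<oplus>\<^sub>m Pmod True V) (V1t (Pmod True V)) ?f"
    by (rule mhomI) (clarsimp simp: assms ac_simps; fail)+
  then show ?thesis
    by (rule misoI[where g = ?g]) (clarsimp simp: ac_simps; fail)+
qed

definition triv :: "('k, 'v::zero) amod \<Rightarrow> bool" where
  "triv V \<longleftrightarrow> (\<forall>v\<in>car V. act V Ga v = 0 \<and> act V Gb v = 0 \<and> act V Gc v = 0)"

definition map3 :: "('v \<Rightarrow> 'w) \<Rightarrow> 'v \<times> 'v \<times> 'v \<Rightarrow> 'w \<times> 'w \<times> 'w" where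
  "map3 f = (\<lambda>(x, y, z). (f x, f y, f z))"

lemma map3_simp [simp]: "map3 f (x, y, z) = (f x, f y, f z)"
  by (simp add: map3_def)

lemma mhom_map3:
  assumes "umod V" "umod W" "mhom V W f" shows "mhom (V1t V) (V1t W) (map3 f)"
  by (rule mhomI) (auto simp: assms mhomD[OF assms(3)] umod.act_mem)

text \<open>On the right the socle is \<open>V1 \<otimes> V1\<close> up to multiplicity, and
  \<open>V1 \<otimes> V1 = V0 \<oplus> P1\<close>, where \<open>V0\<close> is spanned by
  \<open>v1 \<otimes> v3 + v2 \<otimes> v2 + v3 \<otimes> v1\<close>; this is how \<open>x4\<close>
  enters \<open>?f\<close>. The summand \<open>P1\<close> splits off, leaving \<open>V1\<close> as
  top and \<open>V0\<close> as socle. The terms with \<open>X1\<close> and \<open>X2\<close> in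
  \<open>?g\<close> correct the splitting.\<close>

lemma Kmod_V1t_False:
  assumes "umod V" "triv V" and X: "mhom V V X1" "mhom V V X2"
  shows "Kmod True V V X1 X2 \<oplus>\<^sub>m Pmod True V \<approx>\<^sub>m Kmod False (V1t V) (V1t V) (map3 X1) (map3 X2)"
proof -
  interpret V: umod V by fact
  note [simp] = mhomD[OF X(1)] mhomD[OF X(2)] mhom_0[OF assms(1) X(1)] mhom_0[OF assms(1) X(2)]
  have [simp]: "act V Ga v = 0" "act V Gb v = 0" "act V Gc v = 0" if "v \<in> car V" for v
    using assms(2) that by (auto simp: triv_def)
  let ?f = "\<lambda>((x1, x2, x3, x4), (p1, p2, p3, p4, p5, p6, p7, p8)).
      ((x1, x2, x3), (X1 x2 + p5, p6, x4 + p7), (X1 x3 + p1 + p6, x4 + p2, X2 x1 + p3 + p8),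
        (x4 + p2 + p7, p8, X2 x2 + p4))"
  let ?g = "\<lambda>((t1, t2, t3), (x1, x2, x3), (y1, y2, y3), (z1, z2, z3)).
      ((t1, t2, t3, x3 + y2 + z1),
       (X1 t3 + x2 + y1, x3 + z1, X2 t1 + y3 + z2, X2 t2 + z3, X1 t2 + x1, x2, y2 + z1, z2))"
  have "mhom (Kmod True V V X1 X2 \<oplus>\<^sub>m Pmod True V) (Kmod False (V1t V) (V1t V) (map3 X1) (map3 X2)) ?f"
    by (rule mhomI) (clarsimp simp: assms mhom_map3 ac_simps; fail)+
  then show ?thesis
    by (rule misoI[where g = ?g]) (clarsimp simp: ac_simps; fail)+
qed

text \<open>Here \<open>V1 \<otimes> V1 = V0 \<oplus> P1\<close> is the top; \<open>P1\<close>
  splits off, and \<open>V0\<close> remains as top over the socle \<open>V1\<close>.\<close>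

lemma Kmod_V1t_True:
  assumes "umod V" "triv V" and X: "mhom V V X1" "mhom V V X2"
  shows "Kmod False V V X1 X2 \<oplus>\<^sub>m Pmod True V \<approx>\<^sub>m Kmod True (V1t V) (V1t V) (map3 X1) (map3 X2)"
proof -
  interpret V: umod V by fact
  note [simp] = mhomD[OF X(1)] mhomD[OF X(2)] mhom_0[OF assms(1) X(1)] mhom_0[OF assms(1) X(2)]
  have [simp]: "act V Ga v = 0" "act V Gb v = 0" "act V Gc v = 0" if "v \<in> car V" for v
    using assms(2) that by (auto simp: triv_def)
  let ?f = "\<lambda>((x1, x2, x3, x4), (p1, p2, p3, p4, p5, p6, p7, p8)).
      ((p5, p1 + p6, x1 + p2 + p7), (p6, x1 + p2, p8), (x1 + p7, p3 + p8, p4),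
        (x2 + X1 p8, x3 + X1 p4 + X2 p5, x4 + X2 p6))"
  let ?g = "\<lambda>((t1, t2, t3), (x1, x2, x3), (y1, y2, y3), (z1, z2, z3)).
      ((t3 + x2 + y1, X1 x3 + z1, X2 t1 + X1 y3 + z2, X2 x1 + z3),
       (t2 + x1, t3 + y1, x3 + y2, y3, t1, x1, t3 + x2, x3))"
  have "mhom (Kmod False V V X1 X2 \<oplus>\<^sub>m Pmod True V) (Kmod True (V1t V) (V1t V) (map3 X1) (map3 X2)) ?f"
    by (rule mhomI) (clarsimp simp: assms mhom_map3 ac_simps; fail)+
  then show ?thesis
    by (rule misoI[where g = ?g]) (clarsimp simp: ac_simps; fail)+
qed

subsection \<open>Sums of indecomposable projectives\<close>

definition PP :: "nat \<Rightarrow> nat \<Rightarrow> ('k::field, _) amod" where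
  "PP m n = Pmod False (F m) \<oplus>\<^sub>m Pmod True (F n)"

lemma umod_PP [simp]: "CHAR('k::field) = 2 \<Longrightarrow> umod (PP m n :: ('k, _) amod)"
  by (simp add: PP_def)

lemma PP_lift:
  fixes M :: "('k::field, 'v::ab_group_add) amod" and N :: "('k, 'w::ab_group_add) amod"
  assumes ch: "CHAR('k) = 2" and M: "umod M" and N: "umod N" and g: "mhom M N g" "g ` car M = car N"
    and f: "mhom (PP m n) N f"
  obtains h where "mhom (PP m n) M h" "\<And>v. v \<in> car (PP m n) \<Longrightarrow> g (h v) = f v"
proof -
  interpret M: umod M by fact
  interpret N: umod N by fact
  have u: "umod (Pmod False (F m) :: ('k, _) amod)" "umod (Pmod True (F n) :: ('k, _) amod)"
    using ch by simp_all
  note f' = f[unfolded PP_def]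
  obtain h1 where h1: "mhom (Pmod False (F m)) M h1"
    "\<And>v. v \<in> car (Pmod False (F m)) \<Longrightarrow> g (h1 v) = f (v, 0)"
    using Pmod_lift[OF ch M N g mhom_comp[OF mhom_inl[OF u(2)] f']] by metis
  obtain h2 where h2: "mhom (Pmod True (F n)) M h2"
    "\<And>v. v \<in> car (Pmod True (F n)) \<Longrightarrow> g (h2 v) = f (0, v)"
    using Pmod_lift[OF ch M N g mhom_comp[OF mhom_inr[OF u(1)] f']] by metis
  have h: "mhom (PP m n) M (\<lambda>v. h1 (fst v) + h2 (snd v))"
    unfolding PP_def
    by (intro mhom_add M mhom_comp[OF mhom_fst h1(1)] mhom_comp[OF mhom_snd h2(1)])
  have "g (h1 (fst v) + h2 (snd v)) = f v" if "v \<in> car (PP m n)" for v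
  proof -
    obtain v1 v2 where v: "v = (v1, v2)" by (cases v)
    have v12: "v1 \<in> car (Pmod False (F m))" "v2 \<in> car (Pmod True (F n))"
      using that by (auto simp: PP_def v simp del: Pmod_simps)
    have "f ((v1, 0) + (0, v2)) = f (v1, 0) + f (0, v2)"
      by (rule mhomD(2)[OF f']) (use v12 u umod.zero_mem in \<open>simp_all del: Pmod_simps\<close>)
    then show ?thesis using v12 by (simp add: v mhomD[OF g(1)] mhomD(1)[OF h1(1)] mhomD(1)[OF h2(1)] h1(2) h2(2)
      del: Pmod_simps)
  qed
  with h show thesis using that by blast
qed

lemma proj_lift:
  fixes M :: "('k::field, 'v::ab_group_add) amod" and N :: "('k, 'w::ab_group_add) amod"
  assumes ch: "CHAR('k) = 2" and M: "umod M" and N: "umod N" and g: "mhom M N g" "g ` car M = car N"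
    and Q: "umod Q" "Q \<approx>\<^sub>m PP m n" and f: "mhom Q N f"
  obtains h where "mhom Q M h" "\<And>v. v \<in> car Q \<Longrightarrow> g (h v) = f v"
proof -
  obtain \<alpha> \<beta> where a: "mhom Q (PP m n) \<alpha>" "mhom (PP m n) Q \<beta>" "\<And>v. v \<in> car Q \<Longrightarrow> \<beta> (\<alpha> v) = v"
    using misoE[OF Q(2,1) umod_PP[OF ch]] by metis
  obtain h where h: "mhom (PP m n) M h" "\<And>v. v \<in> car (PP m n) \<Longrightarrow> g (h v) = f (\<beta> v)"
    using PP_lift[OF ch M N g mhom_comp[OF a(2) f]] by metis
  show thesis
    by (rule that[OF mhom_comp[OF a(1) h(1)]]) (simp add: h(2) mhomD(1)[OF a(1)] a(3))
qed

lemma msum_swap: "(A \<oplus>\<^sub>m B) \<oplus>\<^sub>m (C \<oplus>\<^sub>m D) \<approx>\<^sub>m (A \<oplus>\<^sub>m C) \<oplus>\<^sub>m (B \<oplus>\<^sub>m D)"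
  by (rule misoI[where f = "\<lambda>((a, b), (c, d)). ((a, c), (b, d))" and g = "\<lambda>((a, b), (c, d)). ((a, c), (b, d))"])
    (auto simp: mhom_def)

context
  assumes ch: "CHAR('k::field) = 2"
begin

lemma Pmod_add: "Pmod d (F (m + n) :: ('k, _) amod) \<approx>\<^sub>m Pmod d (F m) \<oplus>\<^sub>m Pmod d (F n)"
  by (rule miso_trans[OF Pmod_cong[OF _ _ mpow_add] Pmod_msum]) (simp_all add: ch)

lemma PP_add: "PP m n \<oplus>\<^sub>m PP m' n' \<approx>\<^sub>m (PP (m + m') (n + n') :: ('k, _) amod)"
proof -
  have "PP (m + m') (n + n') \<approx>\<^sub>m (Pmod False (F m) \<oplus>\<^sub>m Pmod False (F m' :: ('k, _) amod)) \<oplus>\<^sub>m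
    (Pmod True (F n) \<oplus>\<^sub>m Pmod True (F n' :: ('k, _) amod))"
    unfolding PP_def by (intro msum_cong Pmod_add)
  also have "\<dots> \<approx>\<^sub>m PP m n \<oplus>\<^sub>m PP m' n'" unfolding PP_def by (rule msum_swap)
  finally show ?thesis by (rule miso_sym) (simp_all add: ch)
qed

lemma car_Pmod_0: "car (Pmod d (F 0 :: ('k, _) amod)) = {0}"
  using car_mpow_0[OF umod_ground[OF ch]] by (auto simp: zero_prod_def)

lemma Pmod_PP: "Pmod d (F n :: ('k, _) amod) \<approx>\<^sub>m PP (if d then 0 else n) (if d then n else 0)"
proof (cases d)
  case True
  have "PP 0 n \<approx>\<^sub>m Pmod True (F n :: ('k, _) amod) \<oplus>\<^sub>m Pmod False (F 0 :: ('k, _) amod)"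
    unfolding PP_def by (rule msum_comm)
  also have "\<dots> \<approx>\<^sub>m Pmod True (F n)"
    using ch car_Pmod_0 by (intro msum_trivial) simp_all
  finally have "PP 0 n \<approx>\<^sub>m Pmod True (F n :: ('k, _) amod)" .
  with True show ?thesis using ch by (simp add: miso_sym)
next
  case False
  have "PP n 0 \<approx>\<^sub>m Pmod False (F n :: ('k, _) amod)"
    unfolding PP_def using ch car_Pmod_0 by (intro msum_trivial) simp_all
  with False show ?thesis using ch by (simp add: miso_sym)
qed

lemma cancel_Pmod:
  fixes M :: "('k, 'v::ab_group_add) amod" and N :: "('k, 'w::ab_group_add) amod"
  assumes M: "umod M" and N: "umod N"
  shows "M \<oplus>\<^sub>m Pmod d (F n) \<approx>\<^sub>m N \<oplus>\<^sub>m Pmod d (F n) \<Longrightarrow> M \<approx>\<^sub>m N"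
proof (induction n)
  case 0
  have "M \<approx>\<^sub>m M \<oplus>\<^sub>m Pmod d (F 0)"
    using ch M car_Pmod_0 by (intro miso_sym[OF msum_trivial]) simp_all
  also note 0
  also have "N \<oplus>\<^sub>m Pmod d (F 0) \<approx>\<^sub>m N"
    using ch N car_Pmod_0 by (intro msum_trivial) simp_all
  finally show ?case .
next
  case (Suc n)
  have s: "L \<oplus>\<^sub>m Pmod d (F (Suc n)) \<approx>\<^sub>m (L \<oplus>\<^sub>m Pmod d (F n)) \<oplus>\<^sub>m Pmod d ground"
    if "umod L" for L :: "('k, 'u::ab_group_add) amod"
  proof -
    have "Pmod d (F (Suc n) :: ('k, _) amod) \<approx>\<^sub>m Pmod d (F n) \<oplus>\<^sub>m Pmod d ground"
      by (rule miso_trans[OF Pmod_cong[OF _ _ mpow_Suc] Pmod_msum]) (simp_all add: ch)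
    then show ?thesis using miso_trans[OF msum_cong[OF miso_refl] msum_assoc'] by blast
  qed
  have "(M \<oplus>\<^sub>m Pmod d (F n)) \<oplus>\<^sub>m Pmod d ground \<approx>\<^sub>m M \<oplus>\<^sub>m Pmod d (F (Suc n))"
    using ch M by (intro miso_sym[OF s]) simp_all
  also note Suc.prems
  also note s[OF N]
  finally have "M \<oplus>\<^sub>m Pmod d (F n) \<approx>\<^sub>m N \<oplus>\<^sub>m Pmod d (F n)"
    by (rule cancel_Pmod_ground[OF ch, rotated 2]) (simp_all add: M N ch)
  then show ?case by (rule Suc.IH)
qed

lemma cancel_PP:
  fixes M :: "('k, 'v::ab_group_add) amod" and N :: "('k, 'w::ab_group_add) amod"
  assumes M: "umod M" and N: "umod N" and "M \<oplus>\<^sub>m PP m n \<approx>\<^sub>m N \<oplus>\<^sub>m PP m n"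
  shows "M \<approx>\<^sub>m N"
proof -
  have "(M \<oplus>\<^sub>m Pmod False (F m)) \<oplus>\<^sub>m Pmod True (F n) \<approx>\<^sub>m M \<oplus>\<^sub>m PP m n"
    unfolding PP_def by (rule msum_assoc)
  also note assms(3)
  also have "N \<oplus>\<^sub>m PP m n \<approx>\<^sub>m (N \<oplus>\<^sub>m Pmod False (F m)) \<oplus>\<^sub>m Pmod True (F n)"
    unfolding PP_def by (rule msum_assoc')
  finally have "M \<oplus>\<^sub>m Pmod False (F m) \<approx>\<^sub>m N \<oplus>\<^sub>m Pmod False (F m)"
    by (rule cancel_Pmod[rotated 2]) (simp_all add: M N ch)
  then show ?thesis by (rule cancel_Pmod[OF M N])
qed

lemma V1t_Pmod: "V1t (Pmod d (F n :: ('k, _) amod)) \<approx>\<^sub>m PP (if d then n else 0) (if d then 2 * n else 3 * n)"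
proof -
  have u: "umod (F n :: ('k, _) amod)" using ch by simp
  let ?P = "\<lambda>d. Pmod d (F n :: ('k, _) amod)"
  have P0: "?P False \<approx>\<^sub>m PP n 0" and P1: "?P True \<approx>\<^sub>m PP 0 n"
    using Pmod_PP[of False n] Pmod_PP[of True n] by simp_all
  have two: "?P True \<oplus>\<^sub>m ?P True \<approx>\<^sub>m PP 0 (n + n)"
    using miso_trans[OF msum_cong[OF P1 P1] PP_add] by simp
  show ?thesis
  proof (cases d)
    case True
    have "V1t (?P True) \<approx>\<^sub>m ?P False \<oplus>\<^sub>m ?P True \<oplus>\<^sub>m ?P True"
      using ch by (intro miso_sym[OF V1t_Pmod_True]) simp_all
    also have "\<dots> \<approx>\<^sub>m PP n 0 \<oplus>\<^sub>m PP 0 (n + n)" by (intro msum_cong P0 two)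
    also have "\<dots> \<approx>\<^sub>m PP (n + 0) (0 + (n + n))" by (rule PP_add)
    finally show ?thesis using True by (simp add: mult_2)
  next
    case False
    have "V1t (?P False) \<approx>\<^sub>m ?P True \<oplus>\<^sub>m ?P True \<oplus>\<^sub>m ?P True"
      using ch by (intro miso_sym[OF V1t_Pmod_False]) simp_all
    also have "\<dots> \<approx>\<^sub>m PP 0 n \<oplus>\<^sub>m PP 0 (n + n)" by (intro msum_cong P1 two)
    also have "\<dots> \<approx>\<^sub>m PP (0 + 0) (n + (n + n))" by (rule PP_add)
    finally show ?thesis using False by (simp add: numeral_3_eq_3)
  qed
qed

text \<open>The module is an extension between \<open>U\<close> and \<open>V1 \<otimes> U\<close>.
  Both are projective, so it splits whatever the maps \<open>X1\<close> and \<open>X2\<close> are,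
  and only the multiplicities have to be added.\<close>

lemma Kmod_split:
  fixes U :: "('k, 'v::ab_group_add) amod"
  assumes U: "umod U" and X: "mhom U U X1" "mhom U U X2"
    and p: "U \<approx>\<^sub>m PP m n" "V1t U \<approx>\<^sub>m PP m' n'"
  shows "Kmod d U U X1 X2 \<approx>\<^sub>m PP (m + m') (n + n')"
proof -
  interpret U: umod U by fact
  note [simp] = mhomD[OF X(1)] mhomD[OF X(2)] mhom_0[OF U X(1)] mhom_0[OF U X(2)]
  have K: "umod (Kmod d U U X1 X2)" using U X by simp
  have V: "umod (V1t U)" using U by simp
  show ?thesis
  proof (cases d)
    case True
    then have d: "d = True" by simp
    let ?j = "\<lambda>t. (0, 0, 0, t)" and ?f = "\<lambda>(x, y, z, t). (x, y, z)"
    have j: "mhom U (Kmod d U U X1 X2) ?j" unfolding d using U X by (intro mhomI) (auto simp: zero_prod_def)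
    have f: "mhom (Kmod d U U X1 X2) (V1t U) ?f" unfolding d using U X by (intro mhomI) auto
    have fs: "?f ` car (Kmod d U U X1 X2) = car (V1t U)" unfolding d
      by (auto simp: image_def Bex_def intro: U.zero_mem)
    have ex: "exact_seq ?j ?f U (Kmod d U U X1 X2) (V1t U)"
      unfolding exact_seq_def using j f fs by (auto simp: d inj_on_def zero_prod_def)
    obtain s where "mhom (V1t U) (Kmod d U U X1 X2) s" "\<And>v. v \<in> car (V1t U) \<Longrightarrow> ?f (s v) = v"
      using proj_lift[OF ch K V f fs V p(2) mhom_id] by metis
    from split_exact[OF U K V ex this]
    have "Kmod d U U X1 X2 \<approx>\<^sub>m U \<oplus>\<^sub>m V1t U" .
    also have "\<dots> \<approx>\<^sub>m PP m n \<oplus>\<^sub>m PP m' n'" by (intro msum_cong p)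
    also have "\<dots> \<approx>\<^sub>m PP (m + m') (n + n')" by (rule PP_add)
    finally show ?thesis .
  next
    case False
    then have d: "d = False" by simp
    let ?j = "\<lambda>(x, y, z). (0, x, y, z)" and ?f = "\<lambda>(t, x, y, z). t"
    have j: "mhom (V1t U) (Kmod d U U X1 X2) ?j" unfolding d using U X
      by (intro mhomI) (auto simp: zero_prod_def)
    have f: "mhom (Kmod d U U X1 X2) U ?f" unfolding d using U X by (intro mhomI) auto
    have fs: "?f ` car (Kmod d U U X1 X2) = car U" unfolding d
      by (auto simp: image_def Bex_def intro: U.zero_mem)
    have ex: "exact_seq ?j ?f (V1t U) (Kmod d U U X1 X2) U"
      unfolding exact_seq_def using j f fs by (auto simp: d inj_on_def zero_prod_def)
    obtain s where "mhom U (Kmod d U U X1 X2) s" "\<And>v. v \<in> car U \<Longrightarrow> ?f (s v) = v"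
      using proj_lift[OF ch K U f fs U p(1) mhom_id] by metis
    from split_exact[OF V K U ex this]
    have "Kmod d U U X1 X2 \<approx>\<^sub>m V1t U \<oplus>\<^sub>m U" .
    also have "\<dots> \<approx>\<^sub>m PP m' n' \<oplus>\<^sub>m PP m n" by (intro msum_cong p)
    also have "\<dots> \<approx>\<^sub>m PP (m' + m) (n' + n)" by (rule PP_add)
    finally show ?thesis by (simp add: add.commute)
  qed
qed

end

section \<open>Exactness of tensoring, coordinate by coordinate\<close>

definition Kmap :: "('v \<Rightarrow> 'w) \<Rightarrow> 'v \<times> 'v \<times> 'v \<times> 'v \<Rightarrow> 'w \<times> 'w \<times> 'w \<times> 'w" where
  "Kmap f = (\<lambda>(x, y, z, t). (f x, f y, f z, f t))"

lemma Kmap_simp [simp]: "Kmap f (x, y, z, t) = (f x, f y, f z, f t)"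
  by (simp add: Kmap_def)

lemma mhom_Kmap:
  assumes u: "umod U" "umod U'" and X: "mhom U U X1" "mhom U U X2" "mhom U' U' X1'" "mhom U' U' X2'"
    and f: "mhom U U' f" and c: "\<And>v. v \<in> car U \<Longrightarrow> f (X1 v) = X1' (f v)" "\<And>v. v \<in> car U \<Longrightarrow> f (X2 v) = X2' (f v)"
  shows "mhom (Kmod d U U X1 X2) (Kmod d U' U' X1' X2') (Kmap f)"
proof -
  interpret U: umod U by fact
  note [simp] = mhomD[OF f] c mhomD(1)[OF X(1)] mhomD(1)[OF X(2)]
  show ?thesis
    using u X by (cases d; intro mhomI) auto
qed

lemma Kmod_cong:
  assumes u: "umod U" "umod U'" and X: "mhom U U X1" "mhom U U X2" "mhom U' U' X1'" "mhom U' U' X2'"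
    and f: "mhom U U' f" "bij_betw f (car U) (car U')"
    and c: "\<And>v. v \<in> car U \<Longrightarrow> f (X1 v) = X1' (f v)" "\<And>v. v \<in> car U \<Longrightarrow> f (X2 v) = X2' (f v)"
  shows "Kmod d U U X1 X2 \<approx>\<^sub>m Kmod d U' U' X1' X2'"
proof -
  obtain g where g: "mhom U' U g" "\<And>v. v \<in> car U \<Longrightarrow> g (f v) = v" "\<And>w. w \<in> car U' \<Longrightarrow> f (g w) = w"
    using mhom_inv[OF u f] by metis
  show ?thesis
    by (rule misoI[OF mhom_Kmap[OF u X f(1) c], where g = "Kmap g"])
      (cases d; auto simp: g mhomD(1)[OF g(1)])+
qed

text \<open>All four coordinates carry the same sequence. With \<open>exact_mpow\<close> this
  becomes the exactness of tensoring with \<open>A\<close> and \<open>B\<close>.\<close>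

lemma exact_Kmap:
  assumes u: "umod U'" "umod U" "umod U''"
    and X: "mhom U' U' X1'" "mhom U' U' X2'" "mhom U U X1" "mhom U U X2" "mhom U'' U'' X1''" "mhom U'' U'' X2''"
    and ex: "exact_seq j f U' U U''"
    and c: "\<And>v. v \<in> car U' \<Longrightarrow> j (X1' v) = X1 (j v)" "\<And>v. v \<in> car U' \<Longrightarrow> j (X2' v) = X2 (j v)"
     "\<And>v. v \<in> car U \<Longrightarrow> f (X1 v) = X1'' (f v)" "\<And>v. v \<in> car U \<Longrightarrow> f (X2 v) = X2'' (f v)"
  shows "exact_seq (Kmap j) (Kmap f) (Kmod d U' U' X1' X2') (Kmod d U U X1 X2) (Kmod d U'' U'' X1'' X2'')"
proof -
  note j = exact_seqD(1,2)[OF ex] and f = exact_seqD(3,4)[OF ex] and ker = exact_seqD(5)[OF ex]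
  have car: "car (Kmod d V V Y1 Y2) = car V \<times> car V \<times> car V \<times> car V" for V :: "('a, 'z::plus) amod" and Y1 Y2
    by (cases d) simp_all
  have im: "Kmap h ` (A \<times> A \<times> A \<times> A) = h ` A \<times> h ` A \<times> h ` A \<times> h ` A" for h :: "'x \<Rightarrow> 'y" and A
    by (auto simp: image_iff Kmap_def split: prod.splits)
  show ?thesis
    unfolding exact_seq_def
  proof (intro conjI)
    show "mhom (Kmod d U' U' X1' X2') (Kmod d U U X1 X2) (Kmap j)"
      by (rule mhom_Kmap) (use u X j c in auto)
    show "mhom (Kmod d U U X1 X2) (Kmod d U'' U'' X1'' X2'') (Kmap f)"
      by (rule mhom_Kmap) (use u X f c in auto)
    show "inj_on (Kmap j) (car (Kmod d U' U' X1' X2'))"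
      unfolding car using j(2) by (auto simp: inj_on_def)
    show "Kmap f ` car (Kmod d U U X1 X2) = car (Kmod d U'' U'' X1'' X2'')"
      unfolding car im f(2) ..
    show "\<forall>v\<in>car (Kmod d U U X1 X2). (Kmap f v = 0) = (v \<in> Kmap j ` car (Kmod d U' U' X1' X2'))"
      unfolding car im by (auto simp: ker zero_prod_def)
  qed
qed

lemma mhom_mpow:
  assumes "umod U" "umod V" "mhom U V f" shows "mhom (mpow n U) (mpow n V) (\<lambda>v i. f (v i))"
  using assms(3) mhom_0[OF assms(1,3)] by (auto simp: mhom_def car_mpow act_mpow fun_eq_iff)

lemma exact_mpow:
  assumes u: "umod U'" "umod U" "umod U''" and ex: "exact_seq j f U' U U''"
  shows "exact_seq (\<lambda>v i. j (v i)) (\<lambda>v i. f (v i)) (mpow n U') (mpow n U) (mpow n U'')"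
proof -
  note j = exact_seqD(1,2)[OF ex] and f = exact_seqD(3,4)[OF ex] and ker = exact_seqD(5)[OF ex]
  have j0: "j 0 = 0" and f0: "f 0 = 0" using u j f by (auto intro: mhom_0)
  \<comment> \<open>The preimage of 0 is fixed to be 0, so that a preimage taken pointwise still
    vanishes from \<open>n\<close> on; the same holds for \<open>h\<close> below.\<close>
  define g where "g w = (if w = 0 then 0 else inv_into (car U) f w)" for w
  have g: "f (g w) = w" "g w \<in> car U" if "w \<in> car U''" for w
    using that f(2) f0 umod.zero_mem[OF u(2)] by (auto simp: g_def f_inv_into_f inv_into_into)
  define h where "h w = (if w = 0 then 0 else inv_into (car U') j w)" for w
  have h: "j (h w) = w" "h w \<in> car U'" if "w \<in> car U" "f w = 0" for w
    using that ker j0 umod.zero_mem[OF u(1)] by (auto simp: h_def f_inv_into_f inv_into_into)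
  show ?thesis
    unfolding exact_seq_def
  proof (intro conjI mhom_mpow u j f)
    show "inj_on (\<lambda>v i. j (v i)) (car (mpow n U'))"
      using j(2) by (auto simp: inj_on_def car_mpow fun_eq_iff)
    show "(\<lambda>v i. f (v i)) ` car (mpow n U) = car (mpow n U'')"
    proof (intro equalityI subsetI)
      fix w assume "w \<in> (\<lambda>v i. f (v i)) ` car (mpow n U)"
      then show "w \<in> car (mpow n U'')" using f0 mhomD(1)[OF f(1)] by (auto simp: car_mpow)
    next
      fix w assume "w \<in> car (mpow n U'')"
      then show "w \<in> (\<lambda>v i. f (v i)) ` car (mpow n U)"
        by (intro rev_image_eqI[of "\<lambda>i. g (w i)"]) (auto simp: car_mpow g, simp add: g_def)
    qed
    show "\<forall>v\<in>car (mpow n U). ((\<lambda>i. f (v i)) = 0) = (v \<in> (\<lambda>v i. j (v i)) ` car (mpow n U'))"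
    proof (intro ballI iffI)
      fix v assume v: "v \<in> car (mpow n U)" "(\<lambda>i. f (v i)) = 0"
      then show "v \<in> (\<lambda>v i. j (v i)) ` car (mpow n U')"
        by (intro rev_image_eqI[of "\<lambda>i. h (v i)"]) (auto simp: car_mpow fun_eq_iff h, simp add: h_def)
    next
      fix v assume v: "v \<in> car (mpow n U)" "v \<in> (\<lambda>v i. j (v i)) ` car (mpow n U')"
      then show "(\<lambda>i. f (v i)) = 0" using ker by (auto simp: car_mpow fun_eq_iff)
    qed
  qed
qed

subsection \<open>The Heller operator on pairs of linear maps\<close>

text \<open>\<open>\<alpha> + \<beta>N\<close> for \<open>q = (\<alpha>, \<beta>)\<close> and the nilpotent shift \<open>N\<close>.\<close>

definition bidiag :: "('k, 'v::plus) amod \<Rightarrow> 'k \<times> 'k \<Rightarrow> (nat \<Rightarrow> 'v) \<Rightarrow> nat \<Rightarrow> 'v" where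
  "bidiag W q f = (\<lambda>k. act W (Gs (fst q)) (f k) + act W (Gs (snd q)) (f (Suc k)))"

lemma mhom_bidiag:
  assumes "umod W" shows "mhom (mpow r W) (mpow r W) (bidiag W q)"
proof -
  interpret W: umod W by fact
  show ?thesis
    by (rule mhomI) (auto simp: assms car_mpow act_mpow bidiag_def fun_eq_iff ac_simps)
qed

lemma bidiag_mhom:
  assumes "umod W" "mhom W W' f" "v \<in> car (mpow r W)"
  shows "(\<lambda>i. f (bidiag W q v i)) = bidiag W' q (\<lambda>i. f (v i))"
proof -
  interpret W: umod W by fact
  show ?thesis using assms(3) by (auto simp: bidiag_def car_mpow mhomD[OF assms(2)])
qed

lemma bidiag_comm:
  assumes "umod W" "v \<in> car (mpow r W)" shows "bidiag W p (bidiag W q v) = bidiag W q (bidiag W p v)"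
proof -
  interpret W: umod W by fact
  show ?thesis using assms(2) by (auto simp: bidiag_def car_mpow fun_eq_iff ac_simps)
qed

text \<open>The shift contributes nothing to the last coordinate, so the last coordinate of
  \<open>v\<close> vanishes and \<open>v\<close> lies in a smaller power.\<close>

lemma bidiag_inj:
  assumes W: "umod W" and q: "fst q \<noteq> 0" and v: "v \<in> car (mpow r W)" "bidiag W q v = 0" shows "v = 0"
  using v
proof (induction r arbitrary: v)
  case 0
  then show ?case using car_mpow_0[OF W] by auto
next
  case (Suc r)
  interpret W: umod W by fact
  have "bidiag W q v r = 0" using Suc.prems by simp
  then have "act W (Gs (fst q)) (v r) = 0"
    using Suc.prems by (simp add: bidiag_def car_mpow)
  then have "act W (Gs (inverse (fst q))) (act W (Gs (fst q)) (v r)) = 0" by simp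
  then have "v r = 0" using q Suc.prems by (simp add: car_mpow)
  then have "v \<in> car (mpow r W)" using Suc.prems by (auto simp: car_mpow) (metis le_antisym not_less_eq_eq)
  then show ?case using Suc by blast
qed

text \<open>For \<open>q = (\<alpha>, \<beta>)\<close> the vector \<open>v / \<alpha>\<close> is
  mapped to \<open>v\<close> plus \<open>\<beta> / \<alpha>\<close> times the shift of
  \<open>v\<close>. The error has shorter support, and the induction on the support length
  \<open>j\<close> inside the fixed power \<open>r\<close> removes it.\<close>

lemma bidiag_surj:
  assumes W: "umod W" and q: "fst q \<noteq> 0" and v: "v \<in> car (mpow r W)"
  shows "\<exists>u\<in>car (mpow r W). bidiag W q u = v"
proof -
  interpret W: umod W by fact
  interpret Wr: umod "mpow r W" using W by simp
  note bidiag = mhomD[OF mhom_bidiag[OF W, of r]]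
  have "v \<in> bidiag W q ` car (mpow r W)" if "j \<le> r" "v \<in> car (mpow j W)" for j
    using that
  proof (induction j arbitrary: v)
    case 0
    then have "v = bidiag W q 0" using car_mpow_0[OF W] mhom_0[OF _ mhom_bidiag[OF W]] W by auto
    then show ?case using Wr.zero_mem by blast
  next
    case (Suc j)
    let ?u = "\<lambda>i. act W (Gs (inverse (fst q))) (v i)"
    let ?w = "\<lambda>i. act W (Gs (snd q * inverse (fst q))) (v (Suc i))"
    have u: "?u \<in> car (mpow r W)" using Suc.prems by (auto simp: car_mpow)
    have "?w \<in> car (mpow j W)" using Suc.prems by (auto simp: car_mpow)
    then obtain w' where w': "w' \<in> car (mpow r W)" "?w = bidiag W q w'" using Suc by force
    have "bidiag W q ?u = v + ?w" using Suc.prems q by (auto simp: bidiag_def car_mpow)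
    then have "v = bidiag W q ?u + ?w" using Suc.prems by (auto simp: car_mpow fun_eq_iff add.assoc)
    also have "\<dots> = bidiag W q (?u + w')" unfolding w'(2) by (rule bidiag(2)[symmetric, OF u w'(1)])
    finally show ?case using Wr.add_mem[OF u w'(1)] by blast
  qed
  from this[OF order_refl v] show ?thesis by auto
qed

text \<open>Elementwise form of the exactness of \<open>0 \<rightarrow> V' \<rightarrow> V \<oplus>
  V \<rightarrow> W \<rightarrow> 0\<close>, with first map \<open>(Y2, Y1)\<close> and second map
  \<open>(X1, X2)\<close>.\<close>

definition pencil_exact where
  "pencil_exact V' V W Y1 Y2 X1 X2 \<longleftrightarrow> mhom V' V Y1 \<and> mhom V' V Y2 \<and> mhom V W X1 \<and> mhom V W X2 \<and>
    (\<forall>y\<in>car V'. X1 (Y2 y) + X2 (Y1 y) = 0) \<and> (\<forall>y\<in>car V'. Y1 y = 0 \<longrightarrow> Y2 y = 0 \<longrightarrow> y = 0) \<and>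
    (\<forall>u\<in>car V. \<forall>w\<in>car V. X1 u + X2 w = 0 \<longrightarrow> (\<exists>y\<in>car V'. Y2 y = u \<and> Y1 y = w)) \<and>
    (\<forall>z\<in>car W. \<exists>u\<in>car V. \<exists>w\<in>car V. X1 u + X2 w = z)"

text \<open>If \<open>X1\<close> is invertible and \<open>X1 u = X2 w\<close>, put \<open>y\<close>
  equal to the preimage of \<open>w\<close> under \<open>X1\<close>; as the maps commute,
  \<open>X1 (X2 y) = X1 u\<close>, hence \<open>u = X2 y\<close>. The other case is
  symmetric.\<close>

lemma pencil_exact_bidiag:
  assumes W: "umod W" and q: "fst q1 \<noteq> 0 \<or> fst q2 \<noteq> 0"
  shows "pencil_exact (mpow r W) (mpow r W) (mpow r W) (bidiag W q1) (bidiag W q2) (bidiag W q1) (bidiag W q2)"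
proof -
  interpret Wr: umod "mpow r W" using W by simp
  note bidiag = mhomD[OF mhom_bidiag[OF W, of r]]
  note [simp] = bidiag(1) mhom_0[OF Wr.umod_axioms mhom_bidiag[OF W]]
  note comm = bidiag_comm[OF W, of _ r]
  show ?thesis
    unfolding pencil_exact_def
  proof (intro conjI ballI impI mhom_bidiag W)
    fix y assume "y \<in> car (mpow r W)"
    then show "bidiag W q1 (bidiag W q2 y) + bidiag W q2 (bidiag W q1 y) = 0"
      using comm[of y q1 q2] by simp
  next
    fix y assume "y \<in> car (mpow r W)" "bidiag W q1 y = 0" "bidiag W q2 y = 0"
    then show "y = 0" using bidiag_inj[OF W] q by blast
  next
    fix u w assume uw: "u \<in> car (mpow r W)" "w \<in> car (mpow r W)" "bidiag W q1 u + bidiag W q2 w = 0"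
    then have e: "bidiag W q1 u = bidiag W q2 w" by (metis Wr.add_eq_0 bidiag(1))
    from q show "\<exists>y\<in>car (mpow r W). bidiag W q2 y = u \<and> bidiag W q1 y = w"
    proof
      assume q1: "fst q1 \<noteq> 0"
      then obtain y where y: "y \<in> car (mpow r W)" "bidiag W q1 y = w" using bidiag_surj[OF W _ uw(2)] by blast
      have "bidiag W q1 (bidiag W q2 y + u) = 0" using e y uw comm[of y q1 q2] by (simp add: bidiag(2))
      then have "bidiag W q2 y + u = 0" by (rule bidiag_inj[OF W q1, where r = r, rotated]) (use y uw in simp)
      then show ?thesis using y uw by (metis Wr.add_eq_0 bidiag(1))
    next
      assume q2: "fst q2 \<noteq> 0"
      then obtain y where y: "y \<in> car (mpow r W)" "bidiag W q2 y = u" using bidiag_surj[OF W _ uw(1)] by blast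
      have "bidiag W q2 (bidiag W q1 y + w) = 0" using e y uw comm[of y q1 q2] by (simp add: bidiag(2))
      then have "bidiag W q1 y + w = 0" by (rule bidiag_inj[OF W q2, where r = r, rotated]) (use y uw in simp)
      then show ?thesis using y uw by (metis Wr.add_eq_0 bidiag(1))
    qed
  next
    fix z assume z: "z \<in> car (mpow r W)"
    from q show "\<exists>u\<in>car (mpow r W). \<exists>w\<in>car (mpow r W). bidiag W q1 u + bidiag W q2 w = z"
    proof
      assume "fst q1 \<noteq> 0"
      then obtain y where "y \<in> car (mpow r W)" "bidiag W q1 y = z" using bidiag_surj[OF W _ z] by blast
      then show ?thesis by (intro bexI[of _ y] bexI[of _ 0]) auto
    next
      assume "fst q2 \<noteq> 0"
      then obtain y where "y \<in> car (mpow r W)" "bidiag W q2 y = z" using bidiag_surj[OF W _ z] by blast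
      then show ?thesis by (intro bexI[of _ 0] bexI[of _ y]) auto
    qed
  qed
qed

section \<open>The pairs of maps that belong to syzygies of simple modules\<close>

definition trunc :: "nat \<Rightarrow> (nat \<Rightarrow> 'v::zero) \<Rightarrow> nat \<Rightarrow> 'v" where
  "trunc s f = (\<lambda>k. if k < s then f k else 0)"

definition shift :: "(nat \<Rightarrow> 'v) \<Rightarrow> nat \<Rightarrow> 'v" where
  "shift f = (\<lambda>k. f (Suc k))"

lemma mhom_trunc: "umod W \<Longrightarrow> mhom (mpow (Suc s) W) (mpow s W) (trunc s)"
  by (auto simp: mhom_def car_mpow act_mpow trunc_def fun_eq_iff umod.zero_mem umod.act_0)

lemma mhom_shift: "umod W \<Longrightarrow> mhom (mpow (Suc s) W) (mpow s W) shift"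
  by (auto simp: mhom_def car_mpow act_mpow shift_def fun_eq_iff)

text \<open>A pair \<open>(u, w)\<close> of vectors of length \<open>s + 1\<close> is killed exactly
  when \<open>u k = w (k + 1)\<close> for all \<open>k < s\<close>. Then \<open>w\<close> and
  \<open>u\<close> are the overlapping initial and final segments of one vector of length
  \<open>s + 2\<close>.\<close>

lemma pencil_exact_trunc:
  assumes W: "umod W"
  shows "pencil_exact (mpow (Suc (Suc s)) W) (mpow (Suc s) W) (mpow s W) (trunc (Suc s)) shift (trunc s) shift"
proof -
  interpret W: umod W by fact
  show ?thesis
    unfolding pencil_exact_def
  proof (intro conjI ballI impI mhom_trunc mhom_shift W)
    fix y assume "y \<in> car (mpow (Suc (Suc s)) W)"
    then show "trunc s (shift y) + shift (trunc (Suc s) y) = 0"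
      by (auto simp: trunc_def shift_def car_mpow fun_eq_iff)
  next
    fix y assume y: "y \<in> car (mpow (Suc (Suc s)) W)" "trunc (Suc s) y = 0" "shift y = 0"
    have "y i = 0" for i
      using fun_cong[OF y(2), of i] fun_cong[OF y(3), of "i - 1"]
      by (cases i) (auto simp: trunc_def shift_def)
    then show "y = 0" by (simp add: fun_eq_iff)
  next
    fix u w assume uw: "u \<in> car (mpow (Suc s) W)" "w \<in> car (mpow (Suc s) W)" "trunc s u + shift w = 0"
    have e: "u k = w (Suc k)" if "k < s" for k
      using fun_cong[OF uw(3), of k] that uw(1,2) by (simp add: trunc_def shift_def car_mpow)
    show "\<exists>y\<in>car (mpow (Suc (Suc s)) W). shift y = u \<and> trunc (Suc s) y = w"
      by (rule bexI[of _ "\<lambda>k. case k of 0 \<Rightarrow> w 0 | Suc k \<Rightarrow> u k"])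
        (use uw(1,2) e in \<open>auto simp: shift_def trunc_def car_mpow fun_eq_iff split: nat.splits\<close>)
  next
    fix z assume "z \<in> car (mpow s W)"
    then show "\<exists>u\<in>car (mpow (Suc s) W). \<exists>w\<in>car (mpow (Suc s) W). trunc s u + shift w = z"
      by (intro bexI[of _ z] bexI[of _ 0]) (auto simp: shift_def trunc_def car_mpow fun_eq_iff)
  qed
qed

definition Kcov :: "bool \<Rightarrow> ('v \<Rightarrow> 'v) \<Rightarrow> ('v \<Rightarrow> 'v) \<Rightarrow> 'v \<times> 'v \<times> 'v \<times> 'v \<times> 'v \<times> 'v \<times> 'v \<times> 'v
  \<Rightarrow> 'v::plus \<times> 'v \<times> 'v \<times> 'v" where
  "Kcov d X1 X2 = (\<lambda>(p1, p2, p3, p4, p5, p6, p7, p8).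
    if d then (p1, p2, p3, X1 p4 + X2 p5) else (p1, X1 p2 + X2 p5, X1 p3 + X2 p6, X1 p4 + X2 p7))"

definition Kker :: "bool \<Rightarrow> ('v \<Rightarrow> 'v) \<Rightarrow> ('v \<Rightarrow> 'v) \<Rightarrow> 'v \<times> 'v \<times> 'v \<times> 'v
  \<Rightarrow> 'v \<times> 'v \<times> 'v \<times> 'v \<times> 'v \<times> 'v \<times> 'v \<times> 'v::zero" where
  "Kker d Y1 Y2 = (\<lambda>(x, y, z, t).
    if d then (0, 0, 0, Y2 x, Y1 x, y, z, t) else (0, Y2 x, Y2 y, Y2 z, Y1 x, Y1 y, Y1 z, t))"

text \<open>For \<open>d = True\<close> the sequence of \<open>pencil_exact\<close> occurs once, in
  the two copies of \<open>V0\<close> in the middle; for \<open>d = False\<close> it occurs once for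
  each of the three coordinates of \<open>V1\<close>.\<close>

lemma exact_Kcov:
  assumes V': "umod V'" "triv V'" and V: "umod V" "triv V" and W: "umod W" "triv W"
    and k: "pencil_exact V' V W Y1 Y2 X1 X2"
  shows "exact_seq (Kker d Y1 Y2) (Kcov d X1 X2) (Kmod (\<not> d) V' V Y1 Y2) (Pmod d V) (Kmod d V W X1 X2)"
proof -
  interpret V': umod V' by fact
  interpret V: umod V by fact
  interpret W: umod W by fact
  from k have X: "mhom V W X1" "mhom V W X2" and Y: "mhom V' V Y1" "mhom V' V Y2"
    and rel0: "\<And>y. y \<in> car V' \<Longrightarrow> X1 (Y2 y) + X2 (Y1 y) = 0"
    and inj: "\<And>y. y \<in> car V' \<Longrightarrow> Y1 y = 0 \<Longrightarrow> Y2 y = 0 \<Longrightarrow> y = 0"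
    and ker: "\<And>u w. u \<in> car V \<Longrightarrow> w \<in> car V \<Longrightarrow> X1 u + X2 w = 0 \<Longrightarrow> \<exists>y\<in>car V'. Y2 y = u \<and> Y1 y = w"
    and surj: "\<And>z. z \<in> car W \<Longrightarrow> \<exists>u\<in>car V. \<exists>w\<in>car V. X1 u + X2 w = z"
    unfolding pencil_exact_def by metis+
  note [simp] = mhomD[OF X(1)] mhomD[OF X(2)] mhomD[OF Y(1)] mhomD[OF Y(2)]
    mhom_0[OF V(1) X(1)] mhom_0[OF V(1) X(2)] mhom_0[OF V'(1) Y(1)] mhom_0[OF V'(1) Y(2)]
  have [simp]: "X1 (Y2 y) = X2 (Y1 y)" if "y \<in> car V'" for y
    using rel0[OF that] that by simp
  have [simp]: "act V Ga v = 0" "act V Gb v = 0" "act V Gc v = 0" if "v \<in> car V" for v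
    using V(2) that by (auto simp: triv_def)
  have [simp]: "act W Ga v = 0" "act W Gb v = 0" "act W Gc v = 0" if "v \<in> car W" for v
    using W(2) that by (auto simp: triv_def)
  have [simp]: "act V' Ga v = 0" "act V' Gb v = 0" "act V' Gc v = 0" if "v \<in> car V'" for v
    using V'(2) that by (auto simp: triv_def)
  have inj2: "x = y" if "x \<in> car V'" "y \<in> car V'" "Y1 x = Y1 y" "Y2 x = Y2 y" for x y
    using inj[of "x + y"] that by simp
  have ker0: "\<exists>y\<in>car V'. u = Y2 y \<and> w = Y1 y" if "u \<in> car V" "w \<in> car V" "X1 u + X2 w = 0" for u w
    using ker[OF that] by metis
  have j: "mhom (Kmod (\<not> d) V' V Y1 Y2) (Pmod d V) (Kker d Y1 Y2)"
    using V V' X Y by (cases d; intro mhomI; clarsimp simp: Kker_def)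
  have f: "mhom (Pmod d V) (Kmod d V W X1 X2) (Kcov d X1 X2)"
    using V W X by (cases d; intro mhomI; clarsimp simp: Kcov_def ac_simps)
  have ji: "inj_on (Kker d Y1 Y2) (car (Kmod (\<not> d) V' V Y1 Y2))"
    by (cases d) (auto simp: Kker_def inj_on_def intro: inj2)
  have "y \<in> Kcov d X1 X2 ` car (Pmod d V)" if "y \<in> car (Kmod d V W X1 X2)" for y
  proof -
    obtain y1 y2 y3 y4 where y: "y = (y1, y2, y3, y4)" by (cases y)
    show ?thesis
    proof (cases d)
      case True
      then have m: "y1 \<in> car V" "y2 \<in> car V" "y3 \<in> car V" "y4 \<in> car W" using that y by auto
      obtain u w where "u \<in> car V" "w \<in> car V" "X1 u + X2 w = y4" using surj[OF m(4)] by blast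
      then show ?thesis using True m
        by (intro rev_image_eqI[of "(y1, y2, y3, u, w, 0, 0, 0)"]) (auto simp: y Kcov_def)
    next
      case False
      then have m: "y1 \<in> car V" "y2 \<in> car W" "y3 \<in> car W" "y4 \<in> car W" using that y by auto
      obtain u w where "u \<in> car V" "w \<in> car V" "X1 u + X2 w = y2" using surj[OF m(2)] by blast
      moreover obtain u' w' where "u' \<in> car V" "w' \<in> car V" "X1 u' + X2 w' = y3" using surj[OF m(3)] by blast
      moreover obtain u'' w'' where "u'' \<in> car V" "w'' \<in> car V" "X1 u'' + X2 w'' = y4" using surj[OF m(4)]
        by blast
      ultimately show ?thesis using False m
        by (intro rev_image_eqI[of "(y1, u, u', u'', w, w', w'', 0)"]) (auto simp: y Kcov_def)
    qed
  qed
  then have fs: "Kcov d X1 X2 ` car (Pmod d V) = car (Kmod d V W X1 X2)"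
    using mhomD(1)[OF f] by blast
  have "Kcov d X1 X2 v = 0 \<longleftrightarrow> v \<in> Kker d Y1 Y2 ` car (Kmod (\<not> d) V' V Y1 Y2)" if v: "v \<in> car (Pmod d V)" for v
  proof
    assume z: "Kcov d X1 X2 v = 0"
    obtain p1 p2 p3 p4 p5 p6 p7 p8 where p: "v = (p1, p2, p3, p4, p5, p6, p7, p8)" by (metis surj_pair)
    have m: "p1 \<in> car V" "p2 \<in> car V" "p3 \<in> car V" "p4 \<in> car V" "p5 \<in> car V" "p6 \<in> car V" "p7 \<in> car V"
      "p8 \<in> car V"
      using v p by auto
    show "v \<in> Kker d Y1 Y2 ` car (Kmod (\<not> d) V' V Y1 Y2)"
    proof (cases d)
      case True
      with z have z': "p1 = 0" "p2 = 0" "p3 = 0" "X1 p4 + X2 p5 = 0" unfolding p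
        by (simp_all add: Kcov_def zero_prod_def)
      obtain y where "y \<in> car V'" "p4 = Y2 y" "p5 = Y1 y" using ker0[OF m(4,5) z'(4)] by blast
      then show ?thesis using True z' m
        by (intro rev_image_eqI[of "(y, p6, p7, p8)"]) (auto simp: p Kker_def)
    next
      case False
      with z have z': "p1 = 0" "X1 p2 + X2 p5 = 0" "X1 p3 + X2 p6 = 0" "X1 p4 + X2 p7 = 0"
        unfolding p by (simp_all add: Kcov_def zero_prod_def)
      obtain y where "y \<in> car V'" "p2 = Y2 y" "p5 = Y1 y" using ker0[OF m(2,5) z'(2)] by blast
      moreover obtain y' where "y' \<in> car V'" "p3 = Y2 y'" "p6 = Y1 y'" using ker0[OF m(3,6) z'(3)] by blast
      moreover obtain y'' where "y'' \<in> car V'" "p4 = Y2 y''" "p7 = Y1 y''" using ker0[OF m(4,7) z'(4)] by blast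
      ultimately show ?thesis using False z' m
        by (intro rev_image_eqI[of "(y, y', y'', p8)"]) (auto simp: p Kker_def)
    qed
  next
    assume "v \<in> Kker d Y1 Y2 ` car (Kmod (\<not> d) V' V Y1 Y2)"
    then show "Kcov d X1 X2 v = 0"
      by (cases d) (auto simp: Kker_def Kcov_def zero_prod_def)
  qed
  then show ?thesis unfolding exact_seq_def using j ji f fs by blast
qed

text \<open>The kernel of \<open>Kcov\<close> lies in the radical.\<close>

lemma Kcov_essential:
  assumes V: "umod V" and W: "umod W" and S: "S \<subseteq> car (Pmod d V)"
    and add: "\<And>v w. v \<in> S \<Longrightarrow> w \<in> S \<Longrightarrow> v + w \<in> S" and act: "\<And>v g. v \<in> S \<Longrightarrow> act (Pmod d V) g v \<in> S"
    and im: "Kcov d X1 X2 ` S = car (Kmod d V W X1 X2)"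
  shows "S = car (Pmod d V)"
proof -
  interpret V: umod V by fact
  interpret W: umod W by fact
  let ?a = "act (Pmod d V) Ga" and ?b = "act (Pmod d V) Gb" and ?c = "act (Pmod d V) Gc"
  show ?thesis
  proof (cases d)
    case True
    then have d: "d = True" by simp
    have s3: "(0, 0, 0, 0, 0, 0, 0, t) \<in> S" and p2': "\<exists>s\<in>car V. (0, t, 0, 0, 0, 0, s, 0) \<in> S"
      if t: "t \<in> car V" for t
    proof -
      have "(0, t, 0, 0) \<in> Kcov d X1 X2 ` S" unfolding im using t by (simp add: d)
      then obtain q1 q2 s1 s2 s3 where y: "(0, t, 0, q1, q2, s1, s2, s3) \<in> S"
        unfolding d by (auto simp: Kcov_def)
      then have m: "q1 \<in> car V" "q2 \<in> car V" "s1 \<in> car V" "s2 \<in> car V" "s3 \<in> car V" using S by auto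
      \<comment> \<open>Adding the image under \<open>c\<close> clears the coordinates of
        \<open>c\<close>-eigenvalue 1. Then \<open>b a\<close> removes \<open>q1\<close> and
        \<open>q2\<close> and keeps \<open>t\<close> at \<open>p2\<close>.\<close>
      from add[OF y act[OF y, of Gc]] have y0: "(0, t, 0, q1, q2, 0, s2, 0) \<in> S"
        using m by (simp add: d)
      have y1: "(0, t, 0, 0, 0, 0, t + s2, 0) \<in> S"
        using act[OF act[OF y0, of Ga], of Gb] by (simp add: d)
      show "\<exists>s\<in>car V. (0, t, 0, 0, 0, 0, s, 0) \<in> S" using y1 t m by (intro bexI[of _ "t + s2"]) auto
      show "(0, 0, 0, 0, 0, 0, 0, t) \<in> S"
        using act[OF act[OF act[OF y1, of Ga], of Ga], of Gb] by (simp add: d)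
    qed
    have s2: "(0, 0, 0, 0, 0, 0, t, 0) \<in> S" if "t \<in> car V" for t using act[OF s3[OF that], of Gb]
      by (simp add: d)
    have s1: "(0, 0, 0, 0, 0, t, 0, 0) \<in> S" if "t \<in> car V" for t using act[OF s2[OF that], of Gb]
      by (simp add: d)
    have p2: "(0, t, 0, 0, 0, 0, 0, 0) \<in> S" if t: "t \<in> car V" for t
    proof -
      obtain s where s: "s \<in> car V" "(0, t, 0, 0, 0, 0, s, 0) \<in> S" using p2'[OF t] by blast
      from add[OF s(2) s2[OF s(1)]] show ?thesis using s(1) by simp
    qed
    have p3: "(0, 0, t, 0, 0, 0, 0, 0) \<in> S" if "t \<in> car V" for t using act[OF p2[OF that], of Ga] by simp
    have q1: "(0, 0, 0, t, 0, 0, 0, 0) \<in> S" if "t \<in> car V" for t using act[OF p3[OF that], of Ga] by simp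
    have p1: "(t, 0, 0, 0, 0, 0, 0, 0) \<in> S" if "t \<in> car V" for t
      using add[OF act[OF p2[OF that], of Gb] s1[OF that]] that by (simp add: d)
    have q2: "(0, 0, 0, 0, t, 0, 0, 0) \<in> S" if "t \<in> car V" for t using act[OF p1[OF that], of Gb]
      by (simp add: d)
    have "(p1, p2, p3, p4, p5, p6, p7, p8) \<in> S" if "(p1, p2, p3, p4, p5, p6, p7, p8) \<in> car (Pmod d V)"
      for p1 p2 p3 p4 p5 p6 p7 p8
      using add[OF p1 add[OF p2 add[OF p3 add[OF q1 add[OF q2 add[OF s1 add[OF s2 s3]]]]]],
          of p1 p2 p3 p4 p5 p6 p7 p8] that by simp
    with S show ?thesis by auto
  next
    case False
    then have d: "d = False" by simp
    have q: "(0, 0, 0, 0, 0, 0, 0, t) \<in> S" and p': "\<exists>s\<in>car V. (t, 0, 0, 0, 0, 0, 0, s) \<in> S"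
      if t: "t \<in> car V" for t
    proof -
      have "(t, 0, 0, 0) \<in> Kcov d X1 X2 ` S" unfolding im using t by (simp add: d)
      then obtain p2 p3 p4 p5 p6 p7 p8 where y: "(t, p2, p3, p4, p5, p6, p7, p8) \<in> S"
        unfolding d by (auto simp: Kcov_def)
      then have m: "p2 \<in> car V" "p3 \<in> car V" "p4 \<in> car V" "p5 \<in> car V" "p6 \<in> car V" "p7 \<in> car V" "p8 \<in> car V"
        using S by auto
      from add[OF y act[OF y, of Gc]] have y0: "(t, 0, p3, 0, 0, p6, 0, p8) \<in> S"
        using m by (simp add: d)
      \<comment> \<open>\<open>b a\<close> fixes the basis vectors \<open>a^2 p\<close> and
        \<open>b^2 p\<close> and sends \<open>p\<close> to \<open>bap\<close>, so
        \<open>1 + b a\<close> clears the middle coordinates.\<close>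
      from add[OF y0 act[OF act[OF y0, of Ga], of Gb]] have y1: "(t, 0, 0, 0, 0, 0, 0, p8 + t) \<in> S"
        using m by (simp add: d)
      show "\<exists>s\<in>car V. (t, 0, 0, 0, 0, 0, 0, s) \<in> S" using y1 t m by (intro bexI[of _ "p8 + t"]) auto
      show "(0, 0, 0, 0, 0, 0, 0, t) \<in> S"
        using act[OF act[OF y1, of Ga], of Gb] by (simp add: d)
    qed
    have p1: "(t, 0, 0, 0, 0, 0, 0, 0) \<in> S" if t: "t \<in> car V" for t
    proof -
      obtain s where s: "s \<in> car V" "(t, 0, 0, 0, 0, 0, 0, s) \<in> S" using p'[OF t] by blast
      from add[OF s(2) q[OF s(1)]] show ?thesis using s(1) by simp
    qed
    have p2: "(0, t, 0, 0, 0, 0, 0, 0) \<in> S" if "t \<in> car V" for t using act[OF p1[OF that], of Ga] by simp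
    have p3: "(0, 0, t, 0, 0, 0, 0, 0) \<in> S" if "t \<in> car V" for t using act[OF p2[OF that], of Ga] by simp
    have p4: "(0, 0, 0, t, 0, 0, 0, 0) \<in> S" if "t \<in> car V" for t using act[OF p3[OF that], of Ga] by simp
    have p7: "(0, 0, 0, 0, 0, 0, t, 0) \<in> S" if "t \<in> car V" for t using act[OF p1[OF that], of Gb]
      by (simp add: d)
    have p6: "(0, 0, 0, 0, 0, t, 0, 0) \<in> S" if "t \<in> car V" for t using act[OF p7[OF that], of Gb]
      by (simp add: d)
    have p5: "(0, 0, 0, 0, t, 0, 0, 0) \<in> S" if "t \<in> car V" for t using act[OF p6[OF that], of Gb]
      by (simp add: d)
    have "(p1, p2, p3, p4, p5, p6, p7, p8) \<in> S" if "(p1, p2, p3, p4, p5, p6, p7, p8) \<in> car (Pmod d V)"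
      for p1 p2 p3 p4 p5 p6 p7 p8
      using add[OF p1 add[OF p2 add[OF p3 add[OF p4 add[OF p5 add[OF p6 add[OF p7 q]]]]]],
          of p1 p2 p3 p4 p5 p6 p7 p8] that by simp
    with S show ?thesis by auto
  qed
qed

subsection \<open>Tensor products with syzygies\<close>

text \<open>
  \<open>A\<^sub>x(r) \<otimes> W\<close> (\<open>d = False\<close>) and \<open>B\<^sub>x(r) \<otimes> W\<close> (\<open>d = True\<close>) for suitable \<open>q1\<close>, \<open>q2\<close>; for \<open>B\<^sub>x(r)\<close>
  the transpose of the nilpotent shift has been turned into the shift by reversing the order of the basis.
\<close>

definition Tmod :: "bool \<Rightarrow> nat \<Rightarrow> 'k \<times> 'k \<Rightarrow> 'k \<times> 'k \<Rightarrow> ('k, 'v::ab_group_add) amod \<Rightarrow> ('k, _) amod" where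
  "Tmod d r q1 q2 W = Kmod d (mpow r W) (mpow r W) (bidiag W q1) (bidiag W q2)"

text \<open>\<open>\<Omega>\<^sup>s(V\<^sub>i)\<close>, where \<open>d\<close> is the parity of \<open>s + i\<close>.\<close>

definition Omod :: "bool \<Rightarrow> nat \<Rightarrow> ('k::field, _) amod" where
  "Omod d s = Kmod d (F (Suc s)) (F s) (trunc s) shift"

lemma umod_Tmod [simp]: "umod W \<Longrightarrow> umod (Tmod d r q1 q2 W)"
  by (simp add: Tmod_def mhom_bidiag)

lemma Tmod_cong:
  assumes W: "umod W" "umod W'" and iso: "W \<approx>\<^sub>m W'"
  shows "Tmod d r q1 q2 W \<approx>\<^sub>m Tmod d r q1 q2 W'"
proof -
  obtain f g where f: "mhom W W' f" and g: "mhom W' W g" and fg: "\<And>v. v \<in> car W \<Longrightarrow> g (f v) = v"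
    "\<And>w. w \<in> car W' \<Longrightarrow> f (g w) = w" using misoE[OF iso W] by metis
  have b: "bij_betw (\<lambda>v i. f (v i)) (car (mpow r W)) (car (mpow r W'))"
    by (rule bij_betwI[where g = "\<lambda>v i. g (v i)"])
      (auto simp: car_mpow fun_eq_iff fg mhomD(1)[OF f] mhomD(1)[OF g] mhom_0[OF W(1) f] mhom_0[OF W(2) g])
  show ?thesis
    unfolding Tmod_def
    by (rule Kmod_cong[OF _ _ _ _ _ _ mhom_mpow[OF W f] b]) (simp_all add: W mhom_bidiag bidiag_mhom[OF W(1) f])
qed

lemma exact_Tmod:
  assumes u: "umod U'" "umod U" "umod U''" and ex: "exact_seq j f U' U U''"
  shows "exact_seq (Kmap (\<lambda>v i. j (v i))) (Kmap (\<lambda>v i. f (v i))) (Tmod d r q1 q2 U') (Tmod d r q1 q2 U)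
    (Tmod d r q1 q2 U'')"
proof -
  note jf = exact_seqD(1,3)[OF ex]
  show ?thesis unfolding Tmod_def
    by (rule exact_Kmap[OF _ _ _ _ _ _ _ _ _ exact_mpow[OF u ex]])
      (simp_all add: u mhom_bidiag bidiag_mhom[OF u(1) jf(1)] bidiag_mhom[OF u(2) jf(2)])
qed

lemma triv_F: "triv (F n)"
  by (auto simp: triv_def act_mpow fun_eq_iff)

lemma V1t_act:
  "act (V1t U) Ga v = (act U Ga (fst v), fst v + act U Ga (fst (snd v)), fst (snd v) + act U Ga (snd (snd v)))"
  "act (V1t U) Gb v = (fst (snd v) + act U Gb (fst v), snd (snd v) + act U Gb (fst (snd v)),
    act U Gb (snd (snd v)))"
  "act (V1t U) (Gs k) v = (act U (Gs k) (fst v), act U (Gs k) (fst (snd v)), act U (Gs k) (snd (snd v)))"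
  by (cases v; simp)+

text \<open>The case \<open>s = 0\<close>, \<open>i = 1\<close> of the induction. The map
  \<open>?f\<close> exchanges families of triples with triples of families.\<close>

lemma Tmod_V1t:
  fixes W :: "('k::field, 'v::ab_group_add) amod"
  assumes W: "umod W" "triv W"
  shows "Tmod d r q1 q2 (V1t W) \<approx>\<^sub>m Tmod (\<not> d) r q1 q2 W \<oplus>\<^sub>m Pmod True (mpow r W)"
proof -
  have t: "triv (mpow r W)"
    using W(2) by (auto simp: triv_def act_mpow car_mpow fun_eq_iff)
  let ?f = "\<lambda>v. (\<lambda>i. fst (v i), \<lambda>i. fst (snd (v i)), \<lambda>i. snd (snd (v i)))"
  have f: "mhom (mpow r (V1t W)) (V1t (mpow r W)) ?f"
    by (rule mhomI) (auto simp: W car_mpow act_mpow fun_eq_iff V1t_act mem_Times_iff)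
  have b: "bij_betw ?f (car (mpow r (V1t W))) (car (V1t (mpow r W)))"
    by (rule bij_betwI[where g = "\<lambda>(x, y, z) i. (x i, y i, z i)"])
      (auto simp: car_mpow fun_eq_iff mem_Times_iff zero_prod_def)
  have "Tmod d r q1 q2 (V1t W) \<approx>\<^sub>m Kmod d (V1t (mpow r W)) (V1t (mpow r W)) (map3 (bidiag W q1))
    (map3 (bidiag W q2))"
    unfolding Tmod_def
    by (rule Kmod_cong[OF _ _ _ _ _ _ f b]) (simp_all add: W mhom_bidiag mhom_map3 bidiag_def V1t_act)
  also have "\<dots> \<approx>\<^sub>m Tmod (\<not> d) r q1 q2 W \<oplus>\<^sub>m Pmod True (mpow r W)"
  proof (cases d)
    case True
    then show ?thesis
      using Kmod_V1t_True[of "mpow r W", OF _ t mhom_bidiag mhom_bidiag] W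
      by (simp add: Tmod_def) (rule miso_sym, simp_all add: W mhom_bidiag mhom_map3)
  next
    case False
    then show ?thesis
      using Kmod_V1t_False[of "mpow r W", OF _ t mhom_bidiag mhom_bidiag] W
      by (simp add: Tmod_def) (rule miso_sym, simp_all add: W mhom_bidiag mhom_map3)
  qed
  finally show ?thesis .
qed

lemma exact_msum_right:
  assumes "umod Q" "exact_seq j f N P M"
  shows "exact_seq (\<lambda>v. (j v, 0)) (map_prod f (\<lambda>v. v)) N (P \<oplus>\<^sub>m Q) (M \<oplus>\<^sub>m Q)"
  using assms(2) umod.zero_mem[OF assms(1)] umod.act_0[OF assms(1)]
  by (auto simp: exact_seq_def mhom_def inj_on_def zero_prod_def image_iff) (metis imageE)

lemma exact_iso:
  assumes "umod M" "umod M'" "exact_seq j f N P M" "mhom M M' \<alpha>" "bij_betw \<alpha> (car M) (car M')"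
  shows "exact_seq j (\<lambda>v. \<alpha> (f v)) N P M'"
proof -
  note f = exact_seqD(3,4)[OF assms(3)]
  have "\<alpha> v = 0 \<longleftrightarrow> v = 0" if "v \<in> car M" for v
    using inj_on_eq_iff[OF bij_betw_imp_inj_on[OF assms(5)] that umod.zero_mem[OF assms(1)]]
    by (simp add: mhom_0[OF assms(1,4)])
  moreover have "(\<lambda>v. \<alpha> (f v)) ` car P = car M'"
    using f(2) bij_betw_imp_surj_on[OF assms(5)] by (simp add: image_image[symmetric])
  ultimately show ?thesis
    using assms(3) mhom_comp[OF f(1) assms(4)] mhomD(1)[OF f(1)] by (simp add: exact_seq_def)
qed

context
  assumes ch: "CHAR('k::field) = 2"
begin

lemma umod_Omod: "umod (Omod d s :: ('k, _) amod)"
  using ch by (simp add: Omod_def mhom_trunc mhom_shift)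

lemma exact_Omod:
  "exact_seq (Kker d (trunc (Suc s)) shift) (Kcov d (trunc s) shift) (Omod (\<not> d) (Suc s)) (Pmod d (F (Suc s)))
    (Omod d s :: ('k, _) amod)"
  unfolding Omod_def using ch by (intro exact_Kcov triv_F pencil_exact_trunc) simp_all

text \<open>For \<open>s = 0\<close> the socle is zero and the top has multiplicity one, so the
  module is simple.\<close>

lemma Omod_False_0: "Omod False 0 \<approx>\<^sub>m (ground :: ('k, 'k) amod)"
proof (rule misoI[where f = "\<lambda>(t, _). t 0" and g = "\<lambda>v. ((\<lambda>i. if i = 0 then v else 0), 0, 0, 0)"])
  show "mhom (Omod False 0) (ground :: ('k, 'k) amod) (\<lambda>(t, _). t 0)"
    by (rule mhomI) (use umod_Omod ch in \<open>auto simp: Omod_def act_mpow\<close>)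
qed (auto simp: Omod_def car_mpow fun_eq_iff)

lemma Omod_True_0: "Omod True 0 \<approx>\<^sub>m V1t (ground :: ('k, 'k) amod)"
proof (rule misoI[where f = "\<lambda>(x, y, z, _). (x 0, y 0, z 0)" and
     g = "\<lambda>(x, y, z). ((\<lambda>i. if i = 0 then x else 0), (\<lambda>i. if i = 0 then y else 0), (\<lambda>i.
       if i = 0 then z else 0), 0)"])
  show "mhom (Omod True 0) (V1t (ground :: ('k, 'k) amod)) (\<lambda>(x, y, z, _). (x 0, y 0, z 0))"
    by (rule mhomI) (use umod_Omod ch in \<open>auto simp: Omod_def act_mpow\<close>)
qed (auto simp: Omod_def car_mpow fun_eq_iff)

end

text \<open>
  The multiplicities of \<open>P\<^sub>0\<close> and \<open>P\<^sub>1\<close> in the product of \<open>A\<^sub>x(r)\<close> (\<open>d = False\<close>) or \<open>B\<^sub>x(r)\<close>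
  (\<open>d = True\<close>) with \<open>\<Omega>\<^sup>s(V\<^sub>i)\<close>, where \<open>o'\<close> says that \<open>s + i\<close> is odd.
\<close>

definition mult_P0 :: "bool \<Rightarrow> bool \<Rightarrow> nat \<Rightarrow> nat \<Rightarrow> nat" where
  "mult_P0 d o' r s = (if d = o' then r * s else 0)"

definition mult_P1 :: "bool \<Rightarrow> bool \<Rightarrow> nat \<Rightarrow> nat \<Rightarrow> nat" where
  "mult_P1 d o' r s = (if d then if o' then r * (s + 1) else 2 * r * s
    else if o' then r * (2 * s + 1) else r * s)"

context
  fixes q1 q2 :: "'k::field \<times> 'k"
  assumes ch: "CHAR('k) = 2" and q: "fst q1 \<noteq> 0 \<or> fst q2 \<noteq> 0"
begin

text \<open>The result depends neither on \<open>d\<close> nor on \<open>e\<close>: adding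
  \<open>V1 \<otimes> U\<close> to \<open>U\<close> gives \<open>P0 \<oplus> 3 P1\<close> both for
  \<open>U = P0\<close> and for \<open>U = P1\<close>.\<close>

lemma Tmod_Pmod:
  "Tmod d r q1 q2 (Pmod e (F n :: ('k, _) amod)) \<approx>\<^sub>m PP (r * n) (3 * (r * n))"
proof -
  let ?U = "mpow r (Pmod e (F n :: ('k, _) amod))"
  have uF: "umod (F m :: ('k, _) amod)" for m using ch by simp
  have "?U \<approx>\<^sub>m Pmod e (mpow r (F n))" by (rule mpow_Pmod[OF uF])
  also have "\<dots> \<approx>\<^sub>m Pmod e (F (r * n))"
    using ch by (intro Pmod_cong mpow_mpow) simp_all
  finally have U: "?U \<approx>\<^sub>m Pmod e (F (r * n))" .
  note 1 = miso_trans[OF U Pmod_PP[OF ch]]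
  have "V1t ?U \<approx>\<^sub>m V1t (Pmod e (F (r * n) :: ('k, _) amod))"
    using ch by (intro V1t_cong U) simp_all
  note 2 = miso_trans[OF this V1t_Pmod[OF ch]]
  have a: "(if e then 0 else r * n) + (if e then r * n else 0) = r * n"
    "(if e then r * n else 0) + (if e then 2 * (r * n) else 3 * (r * n)) = 3 * (r * n)" by simp_all
  have "Tmod d r q1 q2 (Pmod e (F n :: ('k, _) amod)) \<approx>\<^sub>m
    PP ((if e then 0 else r * n) + (if e then r * n else 0))
     ((if e then r * n else 0) + (if e then 2 * (r * n) else 3 * (r * n)))"
    unfolding Tmod_def by (rule Kmod_split[OF ch _ _ _ 1 2]) (use ch in \<open>simp_all add: mhom_bidiag\<close>)
  then show ?thesis unfolding a .
qed

text \<open>The same module is covered twice: by the cover of \<open>W\<close> tensored with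
  \<open>A\<close> or \<open>B\<close>, and by the cover of \<open>?T e\<close> enlarged by the
  identity of \<open>PP m l\<close>. Schanuel's lemma relates the kernels. By \<open>cnt\<close> the
  first middle term exceeds the second by \<open>PP m' l'\<close>, and \<open>cancel_PP\<close>
  removes the common part.\<close>

lemma Tmod_step:
  fixes W :: "('k, 'v::ab_group_add) amod" and W' :: "('k, 'w::ab_group_add) amod"
  assumes W: "umod W" "umod W'" and ex: "exact_seq j f W' (Pmod o' (F n)) W"
    and iso: "Tmod d r q1 q2 W \<approx>\<^sub>m Tmod e r q1 q2 (ground :: ('k, 'k) amod) \<oplus>\<^sub>m PP m l"
    and cnt: "m' + (m + (if e then 0 else r)) = r * n" "l' + (l + (if e then r else 0)) = 3 * (r * n)"
  shows "Tmod d r q1 q2 W' \<approx>\<^sub>m Tmod (\<not> e) r q1 q2 (ground :: ('k, 'k) amod) \<oplus>\<^sub>m PP m' l'"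
proof -
  let ?T = "\<lambda>e. Tmod e r q1 q2 (ground :: ('k, 'k) amod)" and ?P = "Pmod e (F r :: ('k, _) amod)"
    and ?Q = "Tmod d r q1 q2 (Pmod o' (F n :: ('k, _) amod))"
  have uF: "umod (F m :: ('k, _) amod)" for m using ch by simp
  have uP: "umod (Pmod e (F m) :: ('k, _) amod)" for e m using uF by simp
  have uPP: "umod (PP m n :: ('k, _) amod)" for m n using ch by simp
  have uk: "umod (ground :: ('k, 'k) amod)" using ch by simp
  note u = W uP uPP uk uF
  obtain \<alpha> where \<alpha>: "mhom (Tmod d r q1 q2 W) (?T e \<oplus>\<^sub>m PP m l) \<alpha>"
    "bij_betw \<alpha> (car (Tmod d r q1 q2 W)) (car (?T e \<oplus>\<^sub>m PP m l))"
    using iso unfolding miso_def by blast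
  have uT: "umod (Tmod d r q1 q2 W)" "umod (?T e \<oplus>\<^sub>m PP m l)" "umod (Tmod d r q1 q2 W')" "umod ?Q"
    "umod (?T (\<not> e))"
    "umod (?P \<oplus>\<^sub>m PP m l)"
    using u by simp_all
  note ex1 = exact_iso[OF uT(1,2) exact_Tmod[OF W(2) uP W(1) ex, of d r q1 q2] \<alpha>]
  have "exact_seq (Kker e (bidiag (ground :: ('k, 'k) amod) q1) (bidiag (ground :: ('k, 'k) amod) q2))
    (Kcov e (bidiag (ground :: ('k, 'k) amod) q1) (bidiag (ground :: ('k, 'k) amod) q2)) (?T (\<not> e)) ?P (?T e)"
    unfolding Tmod_def using uk by (intro exact_Kcov pencil_exact_bidiag q triv_F) simp_all
  note ex2 = exact_msum_right[OF uPP this, of m l]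
  have ex2: "exact_seq (\<lambda>v. (Kker e (bidiag (ground :: ('k, 'k) amod) q1) (bidiag (ground :: ('k, 'k) amod) q2)
    v, 0)) (map_prod (Kcov e (bidiag (ground :: ('k, 'k) amod) q1) (bidiag (ground :: ('k, 'k) amod) q2)) (\<lambda>v.
    v))
      (?T (\<not> e)) (?P \<oplus>\<^sub>m PP m l) (?T e \<oplus>\<^sub>m PP m l)"
    by (rule ex2)
  have Q: "?Q \<approx>\<^sub>m PP (r * n) (3 * (r * n))" by (rule Tmod_Pmod)
  have "?P \<oplus>\<^sub>m PP m l \<approx>\<^sub>m PP (if e then 0 else r) (if e then r else 0) \<oplus>\<^sub>m PP m l"
    by (intro msum_cong Pmod_PP[OF ch] miso_refl)
  also have "\<dots> \<approx>\<^sub>m PP ((if e then 0 else r) + m) ((if e then r else 0) + l)" by (rule PP_add[OF ch])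
  also have "\<dots> = PP (m + (if e then 0 else r)) (l + (if e then r else 0))" by (simp add: add.commute)
  finally have P': "?P \<oplus>\<^sub>m PP m l \<approx>\<^sub>m PP (m + (if e then 0 else r)) (l + (if e then r else 0))" (is "_ \<approx>\<^sub>m
    PP ?m ?l") .
  note e1 = exact_seqD(3,4)[OF ex1] and e2 = exact_seqD(3,4)[OF ex2]
  obtain h where h: "mhom ?Q (?P \<oplus>\<^sub>m PP m l) h"
    "\<And>v. v \<in> car ?Q \<Longrightarrow>
      map_prod (Kcov e (bidiag (ground :: ('k, 'k) amod) q1) (bidiag (ground :: ('k, 'k) amod) q2)) (\<lambda>v. v)
      (h v) = \<alpha> (Kmap (\<lambda>v i. f (v i)) v)"
    using proj_lift[OF ch uT(6,2) e2 uT(4) Q e1(1)] by metis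
  obtain h' where h': "mhom (?P \<oplus>\<^sub>m PP m l) ?Q h'"
    "\<And>v. v \<in> car (?P \<oplus>\<^sub>m PP m l) \<Longrightarrow> \<alpha> (Kmap (\<lambda>v i. f (v i)) (h' v)) =
      map_prod (Kcov e (bidiag (ground :: ('k, 'k) amod) q1) (bidiag (ground :: ('k, 'k) amod) q2)) (\<lambda>v. v) v"
    using proj_lift[OF ch uT(4,2) e1 uT(6) P' e2(1)] by metis
  have S: "?T (\<not> e) \<oplus>\<^sub>m ?Q \<approx>\<^sub>m Tmod d r q1 q2 W' \<oplus>\<^sub>m (?P \<oplus>\<^sub>m PP m l)"
    by (rule schanuel[OF uT(3,4,2,5,6) ex1 ex2 h h'])
  have "Tmod d r q1 q2 W' \<oplus>\<^sub>m PP ?m ?l \<approx>\<^sub>m Tmod d r q1 q2 W' \<oplus>\<^sub>m (?P \<oplus>\<^sub>m PP m l)"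
    by (intro msum_cong miso_refl miso_sym[OF P'] uT u)
  also have "\<dots> \<approx>\<^sub>m ?T (\<not> e) \<oplus>\<^sub>m ?Q" by (rule miso_sym[OF S]) (simp_all add: u)
  also have "\<dots> \<approx>\<^sub>m ?T (\<not> e) \<oplus>\<^sub>m PP (m' + ?m) (l' + ?l)"
    unfolding cnt by (intro msum_cong miso_refl Q)
  also have "\<dots> \<approx>\<^sub>m ?T (\<not> e) \<oplus>\<^sub>m (PP m' l' \<oplus>\<^sub>m PP ?m ?l)"
    by (intro msum_cong miso_refl miso_sym[OF PP_add[OF ch]]) (simp_all add: u)
  also have "\<dots> \<approx>\<^sub>m (?T (\<not> e) \<oplus>\<^sub>m PP m' l') \<oplus>\<^sub>m PP ?m ?l" by (rule msum_assoc')
  finally show ?thesis by (rule cancel_PP[OF ch, rotated 2]) (simp_all add: u)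
qed

text \<open>The cover of the syzygy number \<open>s\<close> has \<open>n = s + 1\<close> summands,
  and both the parity and the type flip with each step. The closed formulas for the multiplicities
  are the solution of the recursion \<open>cnt\<close>.\<close>

theorem Tmod_Omod:
  "Tmod d r q1 q2 (Omod (i \<noteq> odd s) s) \<approx>\<^sub>m
    Tmod (d \<noteq> (i \<noteq> odd s)) r q1 q2 (ground :: ('k, 'k) amod) \<oplus>\<^sub>m PP (mult_P0 d (i \<noteq> odd s) r s)
      (mult_P1 d (i \<noteq> odd s) r s)"
proof (induction s)
  case 0
  have uk: "umod (ground :: ('k, 'k) amod)" using ch by simp
  show ?case
  proof (cases i)
    case True
    have "Tmod d r q1 q2 (Omod True 0) \<approx>\<^sub>m Tmod d r q1 q2 (V1t (ground :: ('k, 'k) amod))"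
      using uk umod_Omod[OF ch] by (intro Tmod_cong Omod_True_0[OF ch]) simp_all
    also have "\<dots> \<approx>\<^sub>m Tmod (\<not> d) r q1 q2 (ground :: ('k, 'k) amod) \<oplus>\<^sub>m Pmod True (F r)"
      using uk by (intro Tmod_V1t) (auto simp: triv_def)
    also have "\<dots> \<approx>\<^sub>m Tmod (\<not> d) r q1 q2 (ground :: ('k, 'k) amod) \<oplus>\<^sub>m PP 0 r"
      using Pmod_PP[OF ch, of True r] by (intro msum_cong miso_refl) simp
    finally show ?thesis using True by (cases d) (simp_all add: mult_P0_def mult_P1_def)
  next
    case False
    have z: "car (PP 0 0 :: ('k, _) amod) = {0}"
      using car_Pmod_0[OF ch] by (auto simp: PP_def zero_prod_def simp del: Pmod_simps)
    have "Tmod d r q1 q2 (Omod False 0) \<approx>\<^sub>m Tmod d r q1 q2 (ground :: ('k, 'k) amod)"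
      using uk umod_Omod[OF ch] by (intro Tmod_cong Omod_False_0[OF ch]) simp_all
    also have "\<dots> \<approx>\<^sub>m Tmod d r q1 q2 (ground :: ('k, 'k) amod) \<oplus>\<^sub>m PP 0 0"
      using uk ch z by (intro miso_sym[OF msum_trivial]) simp_all
    finally show ?thesis using False by (cases d) (simp_all add: mult_P0_def mult_P1_def)
  qed
next
  case (Suc s)
  have o: "(i \<noteq> odd (Suc s)) = (\<not> (i \<noteq> odd s))" by simp
  have e: "(d \<noteq> (\<not> (i \<noteq> odd s))) = (\<not> (d \<noteq> (i \<noteq> odd s)))" by blast
  show ?case
    unfolding o e
    by (rule Tmod_step[OF umod_Omod[OF ch] umod_Omod[OF ch] exact_Omod[OF ch] Suc])
      (auto simp: mult_P0_def mult_P1_def algebra_simps)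
qed

end

subsection \<open>Matrix modules\<close>

definition vec_fun :: "'k::zero vec \<Rightarrow> nat \<Rightarrow> 'k" where
  "vec_fun v = (\<lambda>i. if i < dim_vec v then v $ i else 0)"

definition mat_op :: "'k::field mat \<Rightarrow> (nat \<Rightarrow> 'k) \<Rightarrow> nat \<Rightarrow> 'k" where
  "mat_op X f = (\<lambda>i. if i < dim_row X then \<Sum>j<dim_col X. X $$ (i, j) * f j else 0)"

lemma car_F: "f \<in> car (F n) \<longleftrightarrow> (\<forall>i\<ge>n. f i = 0)"
  by (simp add: car_mpow)

lemma vec_fun_bij: "bij_betw vec_fun (carrier_vec n) (car (F n :: ('k::field, _) amod))"
proof (rule bij_betwI[where g = "vec n"])
  fix y :: "nat \<Rightarrow> 'k" assume "y \<in> car (F n)"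
  then show "vec_fun (vec n y) = y" by (auto simp: vec_fun_def car_F fun_eq_iff)
qed (auto simp: vec_fun_def car_F)

lemma mat_op_vec_fun:
  assumes "X \<in> carrier_mat m n" "v \<in> carrier_vec n" shows "vec_fun (X *\<^sub>v v) = mat_op X (vec_fun v)"
  using assms by (auto simp: vec_fun_def mat_op_def scalar_prod_def fun_eq_iff lessThan_atLeast0 intro!:
    sum.cong)

lemma mat_op_mem: "X \<in> carrier_mat m n \<Longrightarrow> mat_op X f \<in> car (F m)"
  by (auto simp: mat_op_def car_F)

lemma mat_op_add: "mat_op X (f + g) = mat_op X f + mat_op X g"
  by (auto simp: mat_op_def fun_eq_iff sum.distrib distrib_left)

lemma mat_op_scale: "mat_op X (\<lambda>i. k * f i) = (\<lambda>i. k * mat_op X f i)"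
  by (auto simp: mat_op_def fun_eq_iff sum_distrib_left mult_ac intro!: sum.cong)

lemma mat_op_mult:
  assumes "X \<in> carrier_mat l m" "Y \<in> carrier_mat m n" shows "mat_op (X * Y) f = mat_op X (mat_op Y f)"
proof
  fix i
  have "(\<Sum>j<n. (\<Sum>k<m. X $$ (i, k) * Y $$ (k, j)) * f j) = (\<Sum>k<m. X $$ (i, k) * (\<Sum>j<n. Y $$ (k, j) * f j))"
    by (simp add: sum_distrib_left sum_distrib_right mult.assoc) (rule sum.swap)
  then show "mat_op (X * Y) f i = mat_op X (mat_op Y f) i"
    using assms by (auto simp: mat_op_def scalar_prod_def lessThan_atLeast0)
qed

lemma mat_op_plus: "X \<in> carrier_mat m n \<Longrightarrow> Y \<in> carrier_mat m n \<Longrightarrow> mat_op (X + Y) f = mat_op X f + mat_op Y f"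
  by (auto simp: mat_op_def fun_eq_iff sum.distrib distrib_right)

lemma mat_op_zero: "mat_op (0\<^sub>m m n) f = 0"
  by (auto simp: mat_op_def fun_eq_iff)

lemma mat_op_unitF: "X \<in> carrier_mat m n \<Longrightarrow> i < m \<Longrightarrow> j < n \<Longrightarrow> mat_op X (unitF j) i = X $$ (i, j)"
  by (simp add: mat_op_def unitF_def if_distrib[of "\<lambda>x. _ * x"] cong: if_cong)

lemma mat_op_inj:
  assumes "X \<in> carrier_mat m n" "Y \<in> carrier_mat m n" "\<And>f. f \<in> car (F n) \<Longrightarrow> mat_op X f = mat_op Y f"
  shows "X = Y"
proof (rule eq_matI)
  fix i j assume "i < dim_row Y" "j < dim_col Y"
  then have ij: "i < m" "j < n" using assms by auto
  then show "X $$ (i, j) = Y $$ (i, j)"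
    using mat_op_unitF[OF assms(1) ij] mat_op_unitF[OF assms(2) ij] assms(3)[OF unitF_mem[OF ij(2)]] by simp
qed (use assms in auto)

text \<open>Only the carriers and the scalars are prescribed, so that the lemma serves both
  \<open>F n\<close> and \<open>opmod M\<close>.\<close>

lemma lin_mat_op:
  assumes ch: "CHAR('k::field) = 2" and f: "lin M N f" and M: "umod M" "umod N"
    and c: "car M = car (F n)" "car N = car (F m)"
    and s: "\<And>k v. act M (Gs k) v = (\<lambda>i. k * v i)" "\<And>k v. act N (Gs k) v = (\<lambda>i. (k::'k) * v i)"
  obtains X where "X \<in> carrier_mat m n" "\<And>v. v \<in> car M \<Longrightarrow> mat_op X v = f v"
proof -
  define X where "X = mat m n (\<lambda>(i, j). f (unitF j) i)"
  have X: "X \<in> carrier_mat m n" by (simp add: X_def)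
  have "mat_op X v = f v" if v: "v \<in> car M" for v
  proof -
    have u: "unitF i \<in> car M" if "i < n" for i using unitF_mem[OF that] c(1) by simp
    have "v = (\<Sum>i<n. act M (Gs (v i)) (unitF i))"
      using F_expand[of v n] v c(1) by (simp add: s act_mpow)
    then have "f v = (\<Sum>i<n. f (act M (Gs (v i)) (unitF i)))"
      using lin_sum[OF M f, of "{..<n}" "\<lambda>i. act M (Gs (v i)) (unitF i)"] u M by (simp add: umod.act_mem)
    also have "\<dots> = (\<Sum>i<n. act N (Gs (v i)) (f (unitF i)))"
      by (intro sum.cong) (simp_all add: linD(3)[OF f] u)
    also have "\<dots> = mat_op X v"
    proof
      fix i
      have "f (unitF j) i = 0" if "j < n" "m \<le> i" for j
        using linD(1)[OF f u[OF that(1)]] that by (simp add: c(2) car_F)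
      then show "(\<Sum>i<n. act N (Gs (v i)) (f (unitF i))) i = mat_op X v i"
        by (auto simp: s sum_fun_apply mat_op_def X_def mult.commute intro!: sum.cong)
    qed
    finally show ?thesis by simp
  qed
  with X show thesis using that by blast
qed

definition opmod :: "'k::field um_mod \<Rightarrow> ('k, nat \<Rightarrow> 'k) amod" where
  "opmod M = \<lparr>car = car (F (um_dim M)), act = (\<lambda>g. case g of Ga \<Rightarrow> mat_op (act_a M) | Gb \<Rightarrow> mat_op (act_b M)
    | Gc \<Rightarrow> mat_op (act_c M) | Gs k \<Rightarrow> (\<lambda>f i. k * f i))\<rparr>"

lemma opmod_simps [simp]:
  "car (opmod M) = car (F (um_dim M))" "act (opmod M) Ga = mat_op (act_a M)"
    "act (opmod M) Gb = mat_op (act_b M)"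
  "act (opmod M) Gc = mat_op (act_c M)" "act (opmod M) (Gs k) = (\<lambda>f i. k * f i)"
  by (simp_all add: opmod_def)

text \<open>Only the shapes of the matrices. For \<open>A\<close>, \<open>B\<close>, sums and tensor
  products the relations are obtained afterwards, from a bijection with an explicit module.\<close>

definition um_wf :: "'k::field um_mod \<Rightarrow> bool" where
  "um_wf M \<longleftrightarrow> act_a M \<in> carrier_mat (um_dim M) (um_dim M) \<and> act_b M \<in> carrier_mat (um_dim M) (um_dim M) \<and>
    act_c M \<in> carrier_mat (um_dim M) (um_dim M)"

text \<open>A matrix identity holds as soon as it holds on all coordinate vectors
  (\<open>mat_op_inj\<close>), so the relations correspond one by one.\<close>

lemma um_module_iff:
  fixes M :: "'k::field um_mod"
  assumes ch: "CHAR('k) = 2"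
  shows "um_module M \<longleftrightarrow> um_wf M \<and> umod (opmod M)"
proof (cases "um_wf M")
  case True
  let ?n = "um_dim M"
  define A B C where "A = act_a M" "B = act_b M" "C = act_c M"
  have c: "A \<in> carrier_mat ?n ?n" "B \<in> carrier_mat ?n ?n" "C \<in> carrier_mat ?n ?n"
    using True by (simp_all add: um_wf_def A_B_C_def)
  have m: "mat_op (A * B + B * A) f = mat_op A (mat_op B f) + mat_op B (mat_op A f)"
    "mat_op (A * C + C * A) f = mat_op A (mat_op C f) + mat_op C (mat_op A f)"
    "mat_op (B * C + C * B) f = mat_op B (mat_op C f) + mat_op C (mat_op B f)"
      "mat_op (C ^\<^sub>m 2 + C) f = mat_op C (mat_op C f) + mat_op C f"
    "mat_op (A ^\<^sub>m 4) f = mat_op A (mat_op A (mat_op A (mat_op A f)))"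
      "mat_op (B ^\<^sub>m 4) f = mat_op B (mat_op B (mat_op B (mat_op B f)))" for f
    using c by (simp_all add: mat_op_plus[of _ ?n ?n] mat_op_mult[of _ ?n ?n _ ?n] eval_nat_numeral)
  have cc: "A * B + B * A \<in> carrier_mat ?n ?n" "A * C + C * A \<in> carrier_mat ?n ?n"
    "B * C + C * B \<in> carrier_mat ?n ?n"
    "C ^\<^sub>m 2 + C \<in> carrier_mat ?n ?n" "A ^\<^sub>m 4 \<in> carrier_mat ?n ?n" "B ^\<^sub>m 4 \<in> carrier_mat ?n ?n"
    using c by simp_all
  have F: "umod (F ?n :: ('k, _) amod)" using ch by simp
  interpret F: umod "F ?n :: ('k, _) amod" by fact
  have eqv: "um_module M \<longleftrightarrow> A * B + B * A = C \<and> A * C + C * A = A \<and> B * C + C * B = B \<and>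
      A ^\<^sub>m 4 = 0\<^sub>m ?n ?n \<and> B ^\<^sub>m 4 = 0\<^sub>m ?n ?n \<and> C ^\<^sub>m 2 + C = 0\<^sub>m ?n ?n"
    using c by (simp add: um_module_def Let_def A_B_C_def)
  show ?thesis
  proof
    assume "um_module M"
    then have r: "A * B + B * A = C" "A * C + C * A = A" "B * C + C * B = B"
      "A ^\<^sub>m 4 = 0\<^sub>m ?n ?n" "B ^\<^sub>m 4 = 0\<^sub>m ?n ?n" "C ^\<^sub>m 2 + C = 0\<^sub>m ?n ?n" using eqv by auto
    note r' = m[unfolded r mat_op_zero, symmetric]
    have "umod (opmod M)"
    proof (unfold_locales, goal_cases)
      case (4 v g)
      then show ?case using c by (cases g) (auto simp: A_B_C_def[symmetric] mat_op_mem, simp add: car_F)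
    next
      case (5 v w g)
      then show ?case by (cases g) (auto simp: mat_op_add fun_eq_iff distrib_left)
    next
      case (9 v g k) then show ?case by (auto simp: mat_op_scale)
    next
      case 15 then show ?case by (simp add: A_B_C_def[symmetric] r')
    qed (use F.add_self in \<open>auto simp: A_B_C_def[symmetric] r' fun_eq_iff car_F algebra_simps\<close>)
    with True show "um_wf M \<and> umod (opmod M)" by simp
  next
    assume "um_wf M \<and> umod (opmod M)"
    then interpret M: umod "opmod M" by simp
    have s: "act (opmod M) Ga = mat_op A" "act (opmod M) Gb = mat_op B" "act (opmod M) Gc = mat_op C"
      by (simp_all add: A_B_C_def)
    note rel = M.ab_rel[unfolded s] M.ac_rel[unfolded s] M.bc_rel[unfolded s] M.cc_rel[unfolded s]
      M.a4[unfolded s] M.b4[unfolded s]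
    show "um_module M"
      unfolding eqv
      by (intro conjI; rule mat_op_inj[of _ ?n ?n]) (use rel in \<open>simp_all add: c cc m mat_op_zero\<close>)
  qed
next
  case False
  then show ?thesis by (auto simp: um_module_def um_wf_def Let_def)
qed

lemma opmod_umod: "CHAR('k::field) = 2 \<Longrightarrow> um_module (M :: 'k um_mod) \<Longrightarrow> umod (opmod M)"
  using um_module_iff by blast

text \<open>The matrices inherit the relations from \<open>K\<close>, so a single equivariant
  bijection yields both the module property and the isomorphism.\<close>

lemma um_moduleI:
  fixes M :: "'k::field um_mod"
  assumes ch: "CHAR('k) = 2" and w: "um_wf M" and K: "umod K"
    and f: "mhom (opmod M) K f" "bij_betw f (car (opmod M)) (car K)"
  shows "um_module M \<and> opmod M \<approx>\<^sub>m K"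
proof -
  interpret Fn: umod "F (um_dim M) :: ('k, _) amod" using ch by simp
  have "act (opmod M) g v \<in> car (F (um_dim M))" if "v \<in> car (F (um_dim M))" for v g
    using that w by (cases g) (auto simp: um_wf_def mat_op_mem, simp add: car_F)
  then have "umod (opmod M)"
    by (intro umod_transport[OF K f(1) bij_betw_imp_inj_on[OF f(2)]]) simp_all
  with f w show ?thesis using um_module_iff[OF ch] unfolding miso_def by blast
qed

lemma um_wf_module: "um_module M \<Longrightarrow> um_wf M"
  by (auto simp: um_module_def um_wf_def Let_def)

lemma um_hom_iff:
  assumes "um_wf M" "um_wf N"
  shows "um_hom M N X \<longleftrightarrow> X \<in> carrier_mat (um_dim N) (um_dim M) \<and> mhom (opmod M) (opmod N) (mat_op X)"
proof (cases "X \<in> carrier_mat (um_dim N) (um_dim M)")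
  case True
  have c: "act_a M \<in> carrier_mat (um_dim M) (um_dim M)" "act_b M \<in> carrier_mat (um_dim M) (um_dim M)"
    "act_c M \<in> carrier_mat (um_dim M) (um_dim M)" "act_a N \<in> carrier_mat (um_dim N) (um_dim N)"
    "act_b N \<in> carrier_mat (um_dim N) (um_dim N)" "act_c N \<in> carrier_mat (um_dim N) (um_dim N)"
    using assms by (auto simp: um_wf_def)
  have e: "X * Y = Z * X \<longleftrightarrow> (\<forall>f\<in>car (F (um_dim M)). mat_op X (mat_op Y f) = mat_op Z (mat_op X f))"
    if "Y \<in> carrier_mat (um_dim M) (um_dim M)" "Z \<in> carrier_mat (um_dim N) (um_dim N)" for Y Z
  proof
    assume "X * Y = Z * X"
    then show "\<forall>f\<in>car (F (um_dim M)). mat_op X (mat_op Y f) = mat_op Z (mat_op X f)"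
      using mat_op_mult[OF True that(1)] mat_op_mult[OF that(2) True] by metis
  next
    assume "\<forall>f\<in>car (F (um_dim M)). mat_op X (mat_op Y f) = mat_op Z (mat_op X f)"
    then show "X * Y = Z * X"
      using mat_op_mult[OF True that(1)] mat_op_mult[OF that(2) True] that True
        by (intro mat_op_inj[of _ "um_dim N" "um_dim M"]) auto
  qed
  have "mhom (opmod M) (opmod N) (mat_op X) \<longleftrightarrow>
    (\<forall>g. \<forall>f\<in>car (opmod M). mat_op X (act (opmod M) g f) = act (opmod N) g (mat_op X f))"
    unfolding mhom_def using mat_op_mem[OF True] by (simp add: mat_op_add)
  also have "\<dots> \<longleftrightarrow> X * act_a M = act_a N * X \<and> X * act_b M = act_b N * X \<and> X * act_c M = act_c N * X"
    unfolding e[OF c(1,4)] e[OF c(2,5)] e[OF c(3,6)]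
  proof (intro iffI conjI allI ballI, goal_cases)
    case 1 then show ?case by (metis opmod_simps(1,2))
  next case 2 then show ?case by (metis opmod_simps(1,3))
  next case 3 then show ?case by (metis opmod_simps(1,4))
  next case (4 g f) then show ?case by (cases g) (simp_all add: mat_op_scale)
  qed
  finally show ?thesis using True by (simp add: um_hom_def)
next
  case False
  then show ?thesis by (simp add: um_hom_def)
qed

lemma um_hom_ex:
  fixes M N :: "'k::field um_mod"
  assumes ch: "CHAR('k) = 2" and M: "um_module M" "um_module N" and f: "mhom (opmod M) (opmod N) f"
  obtains X where "um_hom M N X" "\<And>v. v \<in> car (opmod M) \<Longrightarrow> mat_op X v = f v"
proof -
  have u: "umod (opmod M)" "umod (opmod N)" "um_wf M" "um_wf N" using M um_module_iff[OF ch] by auto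
  obtain X where X: "X \<in> carrier_mat (um_dim N) (um_dim M)" "\<And>v. v \<in> car (opmod M) \<Longrightarrow> mat_op X v = f v"
    using lin_mat_op[OF ch mhom_lin[OF f] u(1,2)] by auto
  have "mhom (opmod M) (opmod N) (mat_op X)"
    unfolding mhom_def
    using X(2) mhomD[OF f] u(1) by (simp del: opmod_simps add: umod.add_mem umod.act_mem)
  with X that show thesis using um_hom_iff[OF u(3,4)] by blast
qed

lemma vec_fun_inj: "inj_on vec_fun (carrier_vec n :: 'k::field vec set)"
  and vec_fun_image: "vec_fun ` (carrier_vec n :: 'k vec set) = car (F n)"
  using vec_fun_bij by (auto simp: bij_betw_def)

lemma mat_op_image:
  fixes X :: "'k::field mat"
  assumes "X \<in> carrier_mat m n"
  shows "(*\<^sub>v) X ` carrier_vec n = carrier_vec m \<longleftrightarrow> mat_op X ` car (F n) = car (F m)"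
proof -
  have sub: "(*\<^sub>v) X ` carrier_vec n \<subseteq> carrier_vec m" using assms by auto
  have "mat_op X ` car (F n) = (\<lambda>v. mat_op X (vec_fun v)) ` carrier_vec n"
    by (simp only: vec_fun_image[symmetric] image_image)
  also have "\<dots> = (\<lambda>v. vec_fun (X *\<^sub>v v)) ` carrier_vec n"
    by (rule image_cong[OF refl]) (rule mat_op_vec_fun[OF assms, symmetric])
  also have "\<dots> = vec_fun ` (*\<^sub>v) X ` carrier_vec n"
    by (simp only: image_image)
  finally have "mat_op X ` car (F n) = car (F m) \<longleftrightarrow> vec_fun ` (*\<^sub>v) X ` carrier_vec n = vec_fun ` carrier_vec m"
    by (simp only: vec_fun_image)
  then show ?thesis using inj_on_image_eq_iff[OF vec_fun_inj sub subset_refl] by simp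
qed

lemma mat_op_inj_on:
  fixes X :: "'k::field mat"
  assumes "X \<in> carrier_mat m n"
  shows "inj_on ((*\<^sub>v) X) (carrier_vec n) \<longleftrightarrow> inj_on (mat_op X) (car (F n))"
proof -
  have sub: "(*\<^sub>v) X ` carrier_vec n \<subseteq> carrier_vec m" using assms by auto
  have "inj_on (mat_op X) (car (F n)) \<longleftrightarrow> inj_on (mat_op X \<circ> vec_fun) (carrier_vec n)"
    unfolding vec_fun_image[symmetric] by (rule comp_inj_on_iff[OF vec_fun_inj])
  also have "\<dots> \<longleftrightarrow> inj_on (vec_fun \<circ> (*\<^sub>v) X) (carrier_vec n)"
    by (rule inj_on_cong) (simp add: mat_op_vec_fun[OF assms])
  also have "\<dots> \<longleftrightarrow> inj_on ((*\<^sub>v) X) (carrier_vec n)"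
    using inj_on_imageI2[of vec_fun "(*\<^sub>v) X"] comp_inj_on[of "(*\<^sub>v) X" "carrier_vec n" vec_fun]
      inj_on_subset[OF vec_fun_inj sub] by blast
  finally show ?thesis by simp
qed

lemma um_iso_iff:
  fixes M N :: "'k::field um_mod"
  assumes ch: "CHAR('k) = 2"
  shows "M \<simeq>\<^sub>u N \<longleftrightarrow> um_module M \<and> um_module N \<and> opmod M \<approx>\<^sub>m opmod N"
proof -
  have "(\<exists>X. um_hom M N X \<and> bij_betw ((*\<^sub>v) X) (carrier_vec (um_dim M)) (carrier_vec (um_dim N))) \<longleftrightarrow>
    opmod M \<approx>\<^sub>m opmod N"
    if M: "um_module M" "um_module N"
  proof -
    have w: "um_wf M" "um_wf N" using M um_wf_module by auto
    have e: "bij_betw ((*\<^sub>v) X) (carrier_vec (um_dim M)) (carrier_vec (um_dim N)) \<longleftrightarrow>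
      bij_betw (mat_op X) (car (opmod M)) (car (opmod N))"
      if "um_hom M N X" for X
      using that mat_op_image[of X] mat_op_inj_on[of X] by (auto simp: bij_betw_def um_hom_def)
    show ?thesis
    proof
      assume "\<exists>X. um_hom M N X \<and> bij_betw ((*\<^sub>v) X) (carrier_vec (um_dim M)) (carrier_vec (um_dim N))"
      then show "opmod M \<approx>\<^sub>m opmod N" unfolding miso_def using e um_hom_iff[OF w] by blast
    next
      assume "opmod M \<approx>\<^sub>m opmod N"
      then obtain f where f: "mhom (opmod M) (opmod N) f" "bij_betw f (car (opmod M)) (car (opmod N))"
        unfolding miso_def by blast
      obtain X where X: "um_hom M N X" "\<And>v. v \<in> car (opmod M) \<Longrightarrow> mat_op X v = f v"
        using um_hom_ex[OF ch M f(1)] by blast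
      with f(2) have "bij_betw (mat_op X) (car (opmod M)) (car (opmod N))"
        by (metis bij_betw_cong)
      with X e show "\<exists>X. um_hom M N X \<and> bij_betw ((*\<^sub>v) X) (carrier_vec (um_dim M)) (carrier_vec (um_dim N))"
        by blast
    qed
  qed
  then show ?thesis unfolding um_iso_def by blast
qed

section \<open>Finite-dimensional modules as matrix modules\<close>

definition fin_dim :: "('k::field, 'v::ab_group_add) amod \<Rightarrow> bool" where
  "fin_dim M \<longleftrightarrow> (\<exists>n \<phi>. lin M (F n) \<phi> \<and> bij_betw \<phi> (car M) (car (F n)))"

lemma lin_comp: "lin M N f \<Longrightarrow> lin N L g \<Longrightarrow> lin M L (\<lambda>v. g (f v))"
  by (auto simp: lin_def)

lemma fin_dim_lin:
  assumes "lin M N f" "bij_betw f (car M) (car N)" "fin_dim N" shows "fin_dim M"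
proof -
  obtain n \<phi> where \<phi>: "lin N (F n) \<phi>" "bij_betw \<phi> (car N) (car (F n))" using assms(3) unfolding fin_dim_def
    by blast
  have "bij_betw (\<lambda>v. \<phi> (f v)) (car M) (car (F n))"
    using bij_betw_trans[OF assms(2) \<phi>(2)] by (simp add: comp_def)
  then show ?thesis using lin_comp[OF assms(1) \<phi>(1)] unfolding fin_dim_def by blast
qed

lemma fin_dim_F [simp]: "fin_dim (F n)"
  unfolding fin_dim_def by (intro exI[of _ n] exI[of _ "\<lambda>v. v"]) (auto simp: lin_def bij_betw_def)

lemma fin_dim_msum:
  fixes M :: "('k::field, 'v::ab_group_add) amod" and N :: "('k, 'w::ab_group_add) amod"
  assumes ch: "CHAR('k) = 2" and "fin_dim M" "fin_dim N" shows "fin_dim (M \<oplus>\<^sub>m N)"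
proof -
  obtain m \<phi> where \<phi>: "lin M (F m) \<phi>" "bij_betw \<phi> (car M) (car (F m))" using assms unfolding fin_dim_def
    by blast
  obtain n \<psi> where \<psi>: "lin N (F n) \<psi>" "bij_betw \<psi> (car N) (car (F n))" using assms unfolding fin_dim_def
    by blast
  have "F (m + n) \<approx>\<^sub>m F m \<oplus>\<^sub>m (F n :: ('k, _) amod)" using ch by (intro mpow_add) simp
  then have "F m \<oplus>\<^sub>m F n \<approx>\<^sub>m (F (m + n) :: ('k, _) amod)" by (rule miso_sym) (simp_all add: ch)
  then obtain f where "mhom (F m \<oplus>\<^sub>m F n) (F (m + n) :: ('k, _) amod) f"
    "bij_betw f (car (F m \<oplus>\<^sub>m F n)) (car (F (m + n) :: ('k, _) amod))"
    unfolding miso_def by blast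
  then have v: "fin_dim (F m \<oplus>\<^sub>m (F n :: ('k, _) amod))" using mhom_lin fin_dim_def by blast
  have "lin (M \<oplus>\<^sub>m N) (F m \<oplus>\<^sub>m F n) (map_prod \<phi> \<psi>)"
    using \<phi>(1) \<psi>(1) by (auto simp: lin_def)
  from fin_dim_lin[OF this _ v] show ?thesis using bij_betw_map_prod[OF \<phi>(2) \<psi>(2)] by simp
qed

lemma fin_dim_Kmod:
  fixes V :: "('k::field, 'v::ab_group_add) amod"
  assumes ch: "CHAR('k) = 2" and "fin_dim V" "fin_dim W" shows "fin_dim (Kmod d V W X1 X2)"
proof (cases d)
  case True
  have "lin (Kmod True V W X1 X2) (V \<oplus>\<^sub>m V \<oplus>\<^sub>m V \<oplus>\<^sub>m W) (\<lambda>v. v)" by (auto simp: lin_def)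
  then show ?thesis using True
    by (auto intro!: fin_dim_lin[of _ "V \<oplus>\<^sub>m V \<oplus>\<^sub>m V \<oplus>\<^sub>m W"] fin_dim_msum assms bij_betw_id[unfolded id_def])
next
  case False
  have "lin (Kmod False V W X1 X2) (V \<oplus>\<^sub>m W \<oplus>\<^sub>m W \<oplus>\<^sub>m W) (\<lambda>v. v)" by (auto simp: lin_def)
  then show ?thesis using False
    by (auto intro!: fin_dim_lin[of _ "V \<oplus>\<^sub>m W \<oplus>\<^sub>m W \<oplus>\<^sub>m W"] fin_dim_msum assms bij_betw_id[unfolded id_def])
qed

lemma fin_dim_Pmod:
  fixes V :: "('k::field, 'v::ab_group_add) amod"
  assumes ch: "CHAR('k) = 2" and "fin_dim V" shows "fin_dim (Pmod d V)"
proof -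
  let ?S = "V \<oplus>\<^sub>m V \<oplus>\<^sub>m V \<oplus>\<^sub>m V \<oplus>\<^sub>m V \<oplus>\<^sub>m V \<oplus>\<^sub>m V \<oplus>\<^sub>m V"
  have "lin (Pmod d V) ?S (\<lambda>v. v)" by (auto simp: lin_def)
  then show ?thesis
    by (rule fin_dim_lin) (auto intro!: fin_dim_msum assms bij_betw_id[unfolded id_def])
qed

text \<open>\<open>um_cover\<close> and \<open>um_Omega\<close> choose among matrix modules; the
  explicit modules must be realised by matrices before they can serve as witnesses.\<close>

lemma matrix_model:
  fixes M :: "('k::field, 'v::ab_group_add) amod"
  assumes ch: "CHAR('k) = 2" and M: "umod M" "fin_dim M"
  obtains N where "um_module N" "opmod N \<approx>\<^sub>m M"
proof -
  obtain n \<phi> where \<phi>: "lin M (F n) \<phi>" "bij_betw \<phi> (car M) (car (F n))" using M(2) unfolding fin_dim_def by blast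
  define \<psi> where "\<psi> = inv_into (car M) \<phi>"
  have \<psi>\<phi>: "\<psi> (\<phi> v) = v" if "v \<in> car M" for v
    using bij_betw_inv_into_left[OF \<phi>(2) that] by (simp add: \<psi>_def)
  have \<phi>\<psi>: "\<phi> (\<psi> w) = w" and \<psi>m: "\<psi> w \<in> car M" if "w \<in> car (F n)" for w
    using bij_betw_inv_into_right[OF \<phi>(2) that] bij_betw_imp_surj_on[OF bij_betw_inv_into[OF \<phi>(2)]] that
    by (auto simp: \<psi>_def)
  interpret M: umod M by fact
  interpret Fn: umod "F n :: ('k, _) amod" using ch by simp
  have \<psi>: "lin (F n) M \<psi>"
    unfolding lin_def
  proof (intro conjI ballI allI)
    fix v w k assume v: "v \<in> car (F n :: ('k, _) amod)"
    show "\<psi> v \<in> car M" using v \<psi>m by simp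
    show "\<psi> (act (F n) (Gs k) v) = act M (Gs k) (\<psi> v)"
      using \<psi>\<phi>[of "act M (Gs k) (\<psi> v)"] v by (simp add: linD(3)[OF \<phi>(1)] \<psi>m \<phi>\<psi>)
    assume w: "w \<in> car (F n :: ('k, _) amod)"
    show "\<psi> (v + w) = \<psi> v + \<psi> w"
      using \<psi>\<phi>[of "\<psi> v + \<psi> w"] v w by (simp add: linD(2)[OF \<phi>(1)] \<psi>m \<phi>\<psi>)
  qed
  have ex: "\<exists>X. X \<in> carrier_mat n n \<and> (\<forall>v\<in>car (F n). mat_op X v = \<phi> (act M g (\<psi> v)))" if "g \<in> {Ga, Gb, Gc}"
    for g
  proof -
    have "lin M M (act M g)" using that by (auto simp: lin_def)
    then have "lin (F n) (F n) (\<lambda>v. \<phi> (act M g (\<psi> v)))" by (intro lin_comp[OF lin_comp[OF \<psi>] \<phi>(1)])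
    from lin_mat_op[OF ch this Fn.umod_axioms Fn.umod_axioms refl refl] show ?thesis
      by (metis (no_types, lifting) act_mpow ground_simps(5))
  qed
  obtain A where A: "A \<in> carrier_mat n n" "\<And>v. v \<in> car (F n) \<Longrightarrow> mat_op A v = \<phi> (act M Ga (\<psi> v))" using ex[of Ga]
    by auto
  obtain B where B: "B \<in> carrier_mat n n" "\<And>v. v \<in> car (F n) \<Longrightarrow> mat_op B v = \<phi> (act M Gb (\<psi> v))" using ex[of Gb]
    by auto
  obtain C where C: "C \<in> carrier_mat n n" "\<And>v. v \<in> car (F n) \<Longrightarrow> mat_op C v = \<phi> (act M Gc (\<psi> v))" using ex[of Gc]
    by auto
  let ?N = "\<lparr>um_dim = n, act_a = A, act_b = B, act_c = C\<rparr>"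
  have h: "mhom (opmod ?N) M \<psi>"
    unfolding mhom_def
  proof (intro conjI ballI allI)
    fix v g assume v: "v \<in> car (opmod ?N)"
    show "\<psi> (act (opmod ?N) g v) = act M g (\<psi> v)"
    proof (cases g)
      case (Gs k)
      then show ?thesis using linD(3)[OF \<psi>, of v k] v by (simp add: act_mpow)
    qed (use v in \<open>simp_all add: A B C \<psi>\<phi> \<psi>m\<close>)
  qed (use linD[OF \<psi>] in simp_all)
  have bij: "bij_betw \<psi> (car (opmod ?N)) (car M)"
    using bij_betw_inv_into[OF \<phi>(2)] by (simp add: \<psi>_def)
  have "um_wf ?N" using A B C by (simp add: um_wf_def)
  from um_moduleI[OF ch this M(1) h bij] show thesis using that by blast
qed

subsection \<open>Projective covers and syzygies of matrix modules\<close>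

lemma um_projectiveD:
  fixes P :: "'k::field um_mod"
  assumes ch: "CHAR('k) = 2" and P: "um_projective P" and M: "um_module M" "um_module N"
    and g: "mhom (opmod M) (opmod N) g" "g ` car (opmod M) = car (opmod N)" and f: "mhom (opmod P) (opmod N) f"
  obtains h where "mhom (opmod P) (opmod M) h" "\<And>v. v \<in> car (opmod P) \<Longrightarrow> g (h v) = f v"
proof -
  have PM: "um_module P" using P by (simp add: um_projective_def)
  obtain G where G: "um_hom M N G" "\<And>v. v \<in> car (opmod M) \<Longrightarrow> mat_op G v = g v" using um_hom_ex[OF ch M g(1)]
    by blast
  obtain X where X: "um_hom P N X" "\<And>v. v \<in> car (opmod P) \<Longrightarrow> mat_op X v = f v" using um_hom_ex[OF ch PM M(2) f]
    by blast
  have Gc: "G \<in> carrier_mat (um_dim N) (um_dim M)" using G(1) by (simp add: um_hom_def)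
  have "mat_op G ` car (opmod M) = car (opmod N)" using g(2) G(2) by (metis (no_types, lifting) image_cong)
  then have "um_epi M N G" unfolding um_epi_def using G(1) mat_op_image[OF Gc] by simp
  then obtain H where H: "um_hom P M H" "G * H = X"
    using P M X(1) unfolding um_projective_def by blast
  have Hc: "H \<in> carrier_mat (um_dim M) (um_dim P)" using H(1) by (simp add: um_hom_def)
  have h: "mhom (opmod P) (opmod M) (mat_op H)"
    using H(1) um_hom_iff um_wf_module PM M by blast
  show thesis
  proof (rule that[OF h])
    fix v assume v: "v \<in> car (opmod P)"
    have "g (mat_op H v) = mat_op G (mat_op H v)" using G(2) mhomD(1)[OF h v] by simp
    then show "g (mat_op H v) = f v" using mat_op_mult[OF Gc Hc] H(2) X(2)[OF v] by simp
  qed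
qed

lemma um_projectiveI:
  fixes P :: "'k::field um_mod"
  assumes ch: "CHAR('k) = 2" and P: "um_module P" and iso: "opmod P \<approx>\<^sub>m PP m n"
  shows "um_projective P"
  unfolding um_projective_def
proof (intro conjI P allI impI)
  fix M N g f assume M: "um_module M" and N: "um_module N" and g: "um_epi M N g" and f: "um_hom P N f"
  have u: "umod (opmod M)" "umod (opmod N)" "umod (opmod P)" "um_wf M" "um_wf N" "um_wf P"
    using M N P um_module_iff[OF ch] by auto
  have gc: "g \<in> carrier_mat (um_dim N) (um_dim M)" and fc: "f \<in> carrier_mat (um_dim N) (um_dim P)"
    using g f by (simp_all add: um_hom_def um_epi_def)
  have gh: "mhom (opmod M) (opmod N) (mat_op g)" "mat_op g ` car (opmod M) = car (opmod N)"
    using g um_hom_iff[OF u(4,5)] mat_op_image[OF gc] by (auto simp: um_epi_def)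
  have fh: "mhom (opmod P) (opmod N) (mat_op f)" using f um_hom_iff[OF u(6,5)] by blast
  obtain h where h: "mhom (opmod P) (opmod M) h" "\<And>v. v \<in> car (opmod P) \<Longrightarrow> mat_op g (h v) = mat_op f v"
    using proj_lift[OF ch u(1,2) gh u(3) iso fh] by metis
  obtain H where H: "um_hom P M H" "\<And>v. v \<in> car (opmod P) \<Longrightarrow> mat_op H v = h v" using um_hom_ex[OF ch P M h(1)]
    by blast
  have Hc: "H \<in> carrier_mat (um_dim M) (um_dim P)" using H(1) by (simp add: um_hom_def)
  have "g * H = f"
    by (rule mat_op_inj[OF mult_carrier_mat[OF gc Hc] fc]) (use h H in \<open>simp add: mat_op_mult[OF gc Hc]\<close>)
  with H show "\<exists>h. um_hom P M h \<and> g * h = f" by blast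
qed

lemma um_epi_iff:
  assumes "um_wf M" "um_wf N"
  shows "um_epi M N X \<longleftrightarrow> X \<in> carrier_mat (um_dim N) (um_dim M) \<and> mhom (opmod M) (opmod N) (mat_op X) \<and>
    mat_op X ` car (opmod M) = car (opmod N)"
  using um_hom_iff[OF assms] mat_op_image[of X "um_dim N" "um_dim M"] by (auto simp: um_epi_def)

lemma um_essentialD:
  fixes P :: "'k::field um_mod"
  assumes ch: "CHAR('k) = 2" and e: "um_essential_epi P M f" and u: "um_module P" "um_module M" "um_module N"
    and g: "mhom (opmod N) (opmod P) g" "(\<lambda>v. mat_op f (g v)) ` car (opmod N) = car (opmod M)"
  shows "g ` car (opmod N) = car (opmod P)"
proof -
  have w: "um_wf P" "um_wf M" "um_wf N" using u um_wf_module by auto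
  obtain G where G: "um_hom N P G" "\<And>v. v \<in> car (opmod N) \<Longrightarrow> mat_op G v = g v" using um_hom_ex[OF ch u(3,1) g(1)]
    by blast
  have f: "um_epi P M f" using e by (simp add: um_essential_epi_def)
  then have fc: "f \<in> carrier_mat (um_dim M) (um_dim P)" and fh: "mhom (opmod P) (opmod M) (mat_op f)"
    using um_epi_iff[OF w(1,2)] by auto
  have Gc: "G \<in> carrier_mat (um_dim P) (um_dim N)" and Gh: "mhom (opmod N) (opmod P) (mat_op G)"
    using G(1) um_hom_iff[OF w(3,1)] by auto
  have fG: "mat_op (f * G) = (\<lambda>v. mat_op f (mat_op G v))" using mat_op_mult[OF fc Gc] by blast
  have "mat_op (f * G) ` car (opmod N) = car (opmod M)"
    unfolding g(2)[symmetric] fG using G(2) by (intro image_cong) auto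
  then have "um_epi N M (f * G)"
    unfolding um_epi_iff[OF w(3,2)] using fc Gc mhom_comp[OF Gh fh] by (simp add: fG)
  then have "um_epi N P G" using e u(3) G(1) unfolding um_essential_epi_def by blast
  then have "mat_op G ` car (opmod N) = car (opmod P)" using um_epi_iff[OF w(3,1)] by simp
  then show ?thesis using G(2) by (metis (no_types, lifting) image_cong)
qed

text \<open>Lift \<open>f\<close> through \<open>f'\<close> to \<open>h\<close>. It is onto because
  \<open>f'\<close> is essential, so it has a section \<open>s\<close> because \<open>P'\<close> is
  projective. As \<open>s\<close> lies over \<open>M\<close> and \<open>f\<close> is essential,
  \<open>s\<close> is onto as well, which makes \<open>h\<close> injective.\<close>

lemma cover_unique:
  fixes P :: "'k::field um_mod"
  assumes ch: "CHAR('k) = 2" and c: "um_projective_cover P M f" "um_projective_cover P' M f'"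
  obtains h where "mhom (opmod P) (opmod P') h" "bij_betw h (car (opmod P)) (car (opmod P'))"
    "\<And>v. v \<in> car (opmod P) \<Longrightarrow> mat_op f' (h v) = mat_op f v"
proof -
  have pr: "um_projective P" "um_projective P'" and es: "um_essential_epi P M f" "um_essential_epi P' M f'"
    and M: "um_module M" using c by (auto simp: um_projective_cover_def)
  then have P: "um_module P" "um_module P'" by (auto simp: um_projective_def)
  note w = um_wf_module[OF M] um_wf_module[OF P(1)] um_wf_module[OF P(2)]
  have f: "mhom (opmod P) (opmod M) (mat_op f)" "mat_op f ` car (opmod P) = car (opmod M)"
    using es(1) um_epi_iff[OF w(2,1)] by (auto simp: um_essential_epi_def)
  have f': "mhom (opmod P') (opmod M) (mat_op f')" "mat_op f' ` car (opmod P') = car (opmod M)"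
    using es(2) um_epi_iff[OF w(3,1)] by (auto simp: um_essential_epi_def)
  obtain h where h: "mhom (opmod P) (opmod P') h" "\<And>v. v \<in> car (opmod P) \<Longrightarrow> mat_op f' (h v) = mat_op f v"
    using um_projectiveD[OF ch pr(1) P(2) M f' f(1)] by metis
  have "(\<lambda>v. mat_op f' (h v)) ` car (opmod P) = car (opmod M)"
    using f(2) h(2) by (metis (no_types, lifting) image_cong)
  from um_essentialD[OF ch es(2) P(2) M P(1) h(1) this] have hs: "h ` car (opmod P) = car (opmod P')" .
  obtain s where s: "mhom (opmod P') (opmod P) s" "\<And>v. v \<in> car (opmod P') \<Longrightarrow> h (s v) = v"
    using um_projectiveD[OF ch pr(2) P(1) P(2) h(1) hs mhom_id] by metis
  have "mat_op f (s v) = mat_op f' v" if "v \<in> car (opmod P')" for v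
    using h(2)[OF mhomD(1)[OF s(1) that]] s(2)[OF that] by simp
  then have "(\<lambda>v. mat_op f (s v)) ` car (opmod P') = car (opmod M)"
    using f'(2) by (metis (no_types, lifting) image_cong)
  from um_essentialD[OF ch es(1) P(1) M P(2) s(1) this] have ss: "s ` car (opmod P') = car (opmod P)" .
  have "inj_on h (car (opmod P))"
  proof (rule inj_onI)
    fix x y assume "x \<in> car (opmod P)" "y \<in> car (opmod P)" "h x = h y"
    moreover obtain x' y' where "x = s x'" "x' \<in> car (opmod P')" "y = s y'" "y' \<in> car (opmod P')"
      using ss calculation by blast
    ultimately show "x = y" using s(2) by metis
  qed
  with hs have "bij_betw h (car (opmod P)) (car (opmod P'))" by (simp add: bij_betw_def)
  then show thesis using that h by blast
qed

lemma mat_op_kernel: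
  fixes X :: "'k::field mat"
  assumes "X \<in> carrier_mat n l" "f \<in> carrier_mat m n"
  shows "(*\<^sub>v) X ` carrier_vec l = mat_kernel f \<longleftrightarrow> mat_op X ` car (F l) = {v \<in> car (F n). mat_op f v = 0}"
proof -
  have sub: "(*\<^sub>v) X ` carrier_vec l \<subseteq> carrier_vec n" "mat_kernel f \<subseteq> carrier_vec n"
    using assms by (auto simp: mat_kernel_def)
  have z: "f *\<^sub>v v = 0\<^sub>v m \<longleftrightarrow> mat_op f (vec_fun v) = 0" if v: "v \<in> carrier_vec n" for v
  proof -
    have "f *\<^sub>v v \<in> carrier_vec m" using assms(2) v by simp
    then have "f *\<^sub>v v = 0\<^sub>v m \<longleftrightarrow> vec_fun (f *\<^sub>v v) = vec_fun (0\<^sub>v m)"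
      using inj_on_eq_iff[OF vec_fun_inj, of "f *\<^sub>v v" m "0\<^sub>v m"] by simp
    also have "vec_fun (0\<^sub>v m :: 'k vec) = 0" by (auto simp: vec_fun_def fun_eq_iff)
    finally show ?thesis unfolding mat_op_vec_fun[OF assms(2) v] .
  qed
  have "vec_fun ` mat_kernel f = {v \<in> vec_fun ` carrier_vec n. mat_op f v = 0}"
    using assms(2) z by (auto simp: mat_kernel_def)
  then have k: "vec_fun ` mat_kernel f = {v \<in> car (F n). mat_op f v = 0}" by (simp only: vec_fun_image)
  have "mat_op X ` car (F l) = (\<lambda>v. mat_op X (vec_fun v)) ` carrier_vec l"
    by (simp only: vec_fun_image[symmetric] image_image)
  also have "\<dots> = (\<lambda>v. vec_fun (X *\<^sub>v v)) ` carrier_vec l"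
    by (rule image_cong[OF refl]) (rule mat_op_vec_fun[OF assms(1), symmetric])
  also have "\<dots> = vec_fun ` (*\<^sub>v) X ` carrier_vec l"
    by (simp only: image_image)
  finally show ?thesis using inj_on_image_eq_iff[OF vec_fun_inj sub] k by simp
qed

lemma um_exact:
  assumes w: "um_wf N" "um_wf P" "um_wf M" and j: "um_mono N P j" and f: "um_epi P M f"
  shows "(*\<^sub>v) j ` carrier_vec (um_dim N) = mat_kernel f \<longleftrightarrow>
    exact_seq (mat_op j) (mat_op f) (opmod N) (opmod P) (opmod M)"
proof -
  have jc: "j \<in> carrier_mat (um_dim P) (um_dim N)" "mhom (opmod N) (opmod P) (mat_op j)"
    "inj_on (mat_op j) (car (opmod N))"
    using j um_hom_iff[OF w(1,2)] mat_op_inj_on[of j "um_dim P" "um_dim N"] by (auto simp: um_mono_def)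
  have fc: "f \<in> carrier_mat (um_dim M) (um_dim P)" "mhom (opmod P) (opmod M) (mat_op f)"
    "mat_op f ` car (opmod P) = car (opmod M)"
    using f um_epi_iff[OF w(2,3)] by auto
  have "mat_op j ` car (opmod N) \<subseteq> car (opmod P)" using mhomD(1)[OF jc(2)] by blast
  then show ?thesis
    unfolding mat_op_kernel[OF jc(1) fc(1)] exact_seq_def using jc fc by auto
qed

lemma exact_transport:
  assumes u: "umod N" "umod P" "umod M" "umod N'" "umod P'" "umod M'" and ex: "exact_seq j f N P M"
    and n: "mhom N' N n" "bij_betw n (car N') (car N)" and p: "mhom P P' p" "bij_betw p (car P) (car P')"
    and m: "mhom M M' m" "bij_betw m (car M) (car M')"
    and q: "mhom P' P q" "\<And>v. v \<in> car P \<Longrightarrow> q (p v) = v" "\<And>v. v \<in> car P' \<Longrightarrow> p (q v) = v"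
  shows "exact_seq (\<lambda>v. p (j (n v))) (\<lambda>v. m (f (q v))) N' P' M'"
proof -
  from exact_iso[OF u(3,6) ex m] have ex: "exact_seq j (\<lambda>v. m (f v)) N P M'" .
  note j = exact_seqD(1,2)[OF ex] and f = exact_seqD(3,4)[OF ex] and ker = exact_seqD(5)[OF ex]
  have "inj_on (\<lambda>v. p (j (n v))) (car N')"
    using bij_betw_imp_inj_on[OF n(2)] bij_betw_imp_inj_on[OF p(2)] j(2) mhomD(1)[OF n(1)] mhomD(1)[OF j(1)]
    by (auto simp: inj_on_def)
  moreover have qs: "q ` car P' = car P"
    using q mhomD(1)[OF p(1)] mhomD(1)[OF q(1)] by force
  have "(\<lambda>v. m (f (q v))) ` car P' = (\<lambda>v. m (f v)) ` q ` car P'" by (simp only: image_image)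
  then have "(\<lambda>v. m (f (q v))) ` car P' = car M'" by (simp only: qs f(2))
  moreover have "m (f (q v)) = 0 \<longleftrightarrow> v \<in> (\<lambda>v. p (j (n v))) ` car N'" if v: "v \<in> car P'" for v
  proof -
    have "m (f (q v)) = 0 \<longleftrightarrow> q v \<in> j ` n ` car N'"
      using ker[OF mhomD(1)[OF q(1) v]] bij_betw_imp_surj_on[OF n(2)] by simp
    also have "\<dots> \<longleftrightarrow> v \<in> (\<lambda>v. p (j (n v))) ` car N'"
      using q(2,3) v mhomD(1)[OF n(1)] mhomD(1)[OF j(1)] by (auto simp: image_iff) metis+
    finally show ?thesis .
  qed
  ultimately show ?thesis
    unfolding exact_seq_def
    using mhom_comp[OF mhom_comp[OF n(1) j(1)] p(1)] mhom_comp[OF q(1) f(1)] by blast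
qed

text \<open>The sequence \<open>exact_Omod\<close> carried over to matrices. It supplies the
  existence behind both choices and, with \<open>cover_unique\<close>, identifies the chosen
  modules.\<close>

lemma um_cover_step:
  fixes M :: "'k::field um_mod"
  assumes ch: "CHAR('k) = 2" and M: "um_module M" and iso: "opmod M \<approx>\<^sub>m Omod d s"
  obtains P N f j where "um_projective_cover P M f" "um_module N" "um_mono N P j"
    "(*\<^sub>v) j ` carrier_vec (um_dim N) = mat_kernel f"
    "opmod P \<approx>\<^sub>m Pmod d (F (Suc s))" "opmod N \<approx>\<^sub>m Omod (\<not> d) (Suc s)"
proof -
  let ?P = "Pmod d (F (Suc s)) :: ('k, _) amod" and ?N = "Omod (\<not> d) (Suc s) :: ('k, _) amod"
    and ?M = "Omod d s :: ('k, _) amod"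
  have u: "umod ?P" "umod ?N" "umod ?M" using ch umod_Omod[OF ch] by simp_all
  have "fin_dim ?P" "fin_dim ?N" unfolding Omod_def using ch by (simp_all add: fin_dim_Pmod fin_dim_Kmod)
  then obtain P N where P: "um_module P" "opmod P \<approx>\<^sub>m ?P" and N: "um_module N" "opmod N \<approx>\<^sub>m ?N"
    using matrix_model[OF ch] u by metis
  note uu = opmod_umod[OF ch P(1)] opmod_umod[OF ch N(1)] opmod_umod[OF ch M]
  note w = um_wf_module[OF P(1)] um_wf_module[OF N(1)] um_wf_module[OF M]
  obtain n where n: "mhom (opmod N) ?N n" "bij_betw n (car (opmod N)) (car ?N)"
    using N(2) unfolding miso_def by blast
  obtain q where q: "mhom (opmod P) ?P q" "bij_betw q (car (opmod P)) (car ?P)"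
    using P(2) unfolding miso_def by blast
  obtain p where p: "mhom ?P (opmod P) p" "\<And>v. v \<in> car (opmod P) \<Longrightarrow> p (q v) = v" "\<And>v. v \<in> car ?P \<Longrightarrow> q (p v) = v"
    using mhom_inv[OF uu(1) u(1) q] by metis
  have pb: "bij_betw p (car ?P) (car (opmod P))"
    by (rule bij_betwI[where g = q]) (use p mhomD(1)[OF p(1)] mhomD(1)[OF q(1)] in auto)
  obtain m where m: "mhom ?M (opmod M) m" "bij_betw m (car ?M) (car (opmod M))"
    using miso_sym[OF iso uu(3) u(3)] unfolding miso_def by blast
  define \<pi> where "\<pi> = Kcov d (trunc s) (shift :: (nat \<Rightarrow> 'k) \<Rightarrow> _)"
  obtain j0 where ex0: "exact_seq j0 \<pi> ?N ?P ?M"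
    using exact_Omod[OF ch] unfolding \<pi>_def by blast
  note \<pi>h = exact_seqD(3)[OF ex0]
  have ex: "exact_seq (\<lambda>v. p (j0 (n v))) (\<lambda>v. m (\<pi> (q v))) (opmod N) (opmod P) (opmod M)"
    by (rule exact_transport[OF u(2,1,3) uu(2,1,3) ex0 n p(1) pb m q(1) p(3) p(2)])
  note jh = exact_seqD(1)[OF ex] and fh = exact_seqD(3)[OF ex]
  obtain J where J: "um_hom N P J" "\<And>v. v \<in> car (opmod N) \<Longrightarrow> mat_op J v = p (j0 (n v))"
    using um_hom_ex[OF ch N(1) P(1) jh] by blast
  obtain X where X: "um_hom P M X" "\<And>v. v \<in> car (opmod P) \<Longrightarrow> mat_op X v = m (\<pi> (q v))"
    using um_hom_ex[OF ch P(1) M fh] by blast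
  have Jc: "J \<in> carrier_mat (um_dim P) (um_dim N)" and Xc: "X \<in> carrier_mat (um_dim M) (um_dim P)"
    using J(1) X(1) by (simp_all add: um_hom_def)
  have Jh: "mhom (opmod N) (opmod P) (mat_op J)" and Xh: "mhom (opmod P) (opmod M) (mat_op X)"
    using um_hom_iff[OF w(2,1)] um_hom_iff[OF w(1,3)] J(1) X(1) by auto
  have "inj_on (mat_op J) (car (opmod N))" "mat_op J ` car (opmod N) = (\<lambda>v. p (j0 (n v))) ` car (opmod N)"
    "mat_op X ` car (opmod P) = (\<lambda>v. m (\<pi> (q v))) ` car (opmod P)"
    using ex inj_on_cong[of "car (opmod N)" "mat_op J" "\<lambda>v. p (j0 (n v))"] J(2) X(2)
    by (auto simp: exact_seq_def simp del: opmod_simps cong: image_cong)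
  then have ex': "exact_seq (mat_op J) (mat_op X) (opmod N) (opmod P) (opmod M)"
    using ex Jh Xh X(2) unfolding exact_seq_def by simp
  have mono: "um_mono N P J"
    using J(1) ex' mat_op_inj_on[OF Jc] by (simp add: um_mono_def exact_seq_def)
  have epi: "um_epi P M X"
    using um_epi_iff[OF w(1,3)] Xc ex' by (simp add: exact_seq_def)
  have ker: "(*\<^sub>v) J ` carrier_vec (um_dim N) = mat_kernel X"
    using um_exact[OF w(2,1,3) mono epi] ex' by blast
  have proj: "um_projective P"
    by (rule um_projectiveI[OF ch P(1) miso_trans[OF P(2) Pmod_PP[OF ch]]])
  have "um_essential_epi P M X"
    unfolding um_essential_epi_def
  proof (intro conjI epi allI impI)
    fix L G assume L: "um_module L" and G: "um_hom L P G" and GX: "um_epi L M (X * G)"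
    note wL = um_wf_module[OF L]
    have Gc: "G \<in> carrier_mat (um_dim P) (um_dim L)" and Gh: "mhom (opmod L) (opmod P) (mat_op G)"
      using G um_hom_iff[OF wL w(1)] by auto
    note g = mhomD[OF Gh]
    note q' = mhomD[OF q(1)]
    have XG: "(\<lambda>v. mat_op X (mat_op G v)) ` car (opmod L) = car (opmod M)"
      using GX um_epi_iff[OF wL w(3)] mat_op_mult[OF Xc Gc] by (metis (no_types, lifting) image_cong)
    interpret L: umod "opmod L" by (rule opmod_umod[OF ch L])
    \<comment> \<open>Essentiality is checked in the explicit model: \<open>S\<close> is the image
      of \<open>L\<close> there, a submodule that still maps onto the quotient, so
      \<open>Kcov_essential\<close> applies.\<close>
    define S where "S = (\<lambda>v. q (mat_op G v)) ` car (opmod L)"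
    have "S = car ?P"
    proof (rule Kcov_essential[of "F (Suc s)" "F s" S d "trunc s" shift])
      show "S \<subseteq> car ?P" using g(1) q'(1) unfolding S_def by blast
      show "v + w \<in> S" if vw: "v \<in> S" "w \<in> S" for v w
      proof -
        obtain x y where xy: "x \<in> car (opmod L)" "v = q (mat_op G x)" "y \<in> car (opmod L)" "w = q (mat_op G y)"
          using vw unfolding S_def by blast
        then have "v + w = q (mat_op G (x + y))" by (simp add: g q' del: opmod_simps)
        then show ?thesis using xy L.add_mem unfolding S_def by blast
      qed
      show "act ?P h v \<in> S" if v: "v \<in> S" for v h
      proof -
        obtain x where x: "x \<in> car (opmod L)" "v = q (mat_op G x)" using v unfolding S_def by blast
        then have "act ?P h v = q (mat_op G (act (opmod L) h x))" by (simp add: g q' del: opmod_simps)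
        then show ?thesis using x L.act_mem unfolding S_def by blast
      qed
      have "\<pi> ` S \<subseteq> car ?M"
        using mhomD(1)[OF \<pi>h] g(1) q'(1) unfolding S_def by blast
      moreover have "m ` \<pi> ` S = m ` car ?M"
        unfolding bij_betw_imp_surj_on[OF m(2)] XG[symmetric] S_def image_image
        using X(2) g(1) by (intro image_cong) (simp_all del: opmod_simps)
      ultimately have "\<pi> ` S = car ?M"
        using inj_on_image_eq_iff[OF bij_betw_imp_inj_on[OF m(2)]] by blast
      then show "Kcov d (trunc s) shift ` S = car (Kmod d (F (Suc s)) (F s) (trunc s) shift)"
        by (simp only: \<pi>_def Omod_def)
    qed (use ch in simp_all)
    then have "mat_op G ` car (opmod L) = car (opmod P)"
    proof -
      have "mat_op G ` car (opmod L) \<subseteq> car (opmod P)" using g(1) by blast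
      moreover have "q ` mat_op G ` car (opmod L) = q ` car (opmod P)"
        using \<open>S = car ?P\<close> by (simp only: S_def image_image bij_betw_imp_surj_on[OF q(2)])
      ultimately show ?thesis using inj_on_image_eq_iff[OF bij_betw_imp_inj_on[OF q(2)]] by blast
    qed
    then show "um_epi L P G" unfolding um_epi_iff[OF wL w(1)] using Gc Gh by blast
  qed
  with proj M have "um_projective_cover P M X" by (simp add: um_projective_cover_def)
  from that[OF this N(1) mono ker P(2) N(2)] show thesis .
qed

text \<open>The chosen module is the kernel of some projective cover; \<open>cover_unique\<close>
  matches that cover with the explicit one, and \<open>kernel_iso\<close> then matches the
  kernels.\<close>

lemma um_Omega_step:
  fixes M :: "'k::field um_mod"
  assumes ch: "CHAR('k) = 2" and M: "um_module M" and iso: "opmod M \<approx>\<^sub>m Omod d s"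
  shows "um_module (um_Omega M) \<and> opmod (um_Omega M) \<approx>\<^sub>m Omod (\<not> d) (Suc s)"
proof -
  obtain P N f j where c: "um_projective_cover P M f" "um_module N" "um_mono N P j"
    "(*\<^sub>v) j ` carrier_vec (um_dim N) = mat_kernel f" "opmod N \<approx>\<^sub>m Omod (\<not> d) (Suc s)"
    using um_cover_step[OF ch M iso] by metis
  have "um_module (um_Omega M) \<and> (\<exists>P f j. um_projective_cover P M f \<and> um_mono (um_Omega M) P j \<and>
      (*\<^sub>v) j ` carrier_vec (um_dim (um_Omega M)) = mat_kernel f)"
    unfolding um_Omega_def by (rule someI_ex) (use c in blast)
  then obtain P' f' j' where c': "um_module (um_Omega M)" "um_projective_cover P' M f'"
    "um_mono (um_Omega M) P' j'"
    "(*\<^sub>v) j' ` carrier_vec (um_dim (um_Omega M)) = mat_kernel f'" by blast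
  have P: "um_module P" "um_epi P M f" "um_module P'" "um_epi P' M f'"
    using c(1) c'(2) by (auto simp: um_projective_cover_def um_projective_def um_essential_epi_def)
  note w = um_wf_module[OF M] um_wf_module[OF P(1)] um_wf_module[OF P(3)] um_wf_module[OF c(2)]
    um_wf_module[OF c'(1)]
  have e: "exact_seq (mat_op j) (mat_op f) (opmod N) (opmod P) (opmod M)"
    using um_exact[OF w(4,2,1) c(3) P(2)] c(4) by blast
  have e': "exact_seq (mat_op j') (mat_op f') (opmod (um_Omega M)) (opmod P') (opmod M)"
    using um_exact[OF w(5,3,1) c'(3) P(4)] c'(4) by blast
  note u = opmod_umod[OF ch c'(1)] opmod_umod[OF ch c(2)] opmod_umod[OF ch P(1)]
  obtain h where h: "mhom (opmod P') (opmod P) h" "bij_betw h (car (opmod P')) (car (opmod P))"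
    "\<And>v. v \<in> car (opmod P') \<Longrightarrow> mat_op f (h v) = mat_op f' v" using cover_unique[OF ch c'(2) c(1)] by metis
  have "opmod (um_Omega M) \<approx>\<^sub>m opmod N"
    by (rule kernel_iso[OF u e' e h(1,2)]) (rule h(3))
  then show ?thesis using c'(1) miso_trans c(5) by blast
qed

lemma um_cover_iso:
  fixes M :: "'k::field um_mod"
  assumes ch: "CHAR('k) = 2" and M: "um_module M" and iso: "opmod M \<approx>\<^sub>m Omod d s"
  shows "um_module (um_cover M) \<and> opmod (um_cover M) \<approx>\<^sub>m Pmod d (F (Suc s))"
proof -
  obtain P f where c: "um_projective_cover P M f" "opmod P \<approx>\<^sub>m Pmod d (F (Suc s))"
    using um_cover_step[OF ch M iso] by metis
  have "\<exists>f. um_projective_cover (um_cover M) M f"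
    unfolding um_cover_def by (rule someI_ex) (use c in blast)
  then obtain f' where c': "um_projective_cover (um_cover M) M f'" by blast
  obtain h where h: "mhom (opmod (um_cover M)) (opmod P) h"
    "bij_betw h (car (opmod (um_cover M))) (car (opmod P))"
    using cover_unique[OF ch c' c(1)] by metis
  then have "opmod (um_cover M) \<approx>\<^sub>m opmod P" unfolding miso_def by blast
  then show ?thesis using c' miso_trans[OF _ c(2)] by (auto simp: um_projective_cover_def um_projective_def)
qed

section \<open>Sums, simple modules, syzygies and projectives as matrix modules\<close>

lemma sum_lessThan_add: "(\<Sum>j<m + n. g j) = (\<Sum>j<m. g j) + (\<Sum>j<n. g (m + j :: nat) :: 'a::comm_monoid_add)"
  by (induction n) (simp_all add: add.assoc)

lemma mat_op_diag_sum:
  assumes "A \<in> carrier_mat m m" "B \<in> carrier_mat n n"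
  shows "i < m \<Longrightarrow> mat_op (diag_sum A B) f i = mat_op A f i"
    "mat_op (diag_sum A B) f (m + i) = mat_op B (\<lambda>i. f (m + i)) i"
  using assms by (auto simp: mat_op_def diag_sum_def sum_lessThan_add)

lemma um_sum_abs:
  fixes M N :: "'k::field um_mod"
  assumes ch: "CHAR('k) = 2" and M: "um_module M" "um_module N"
  shows "um_module (M \<oplus>\<^sub>u N) \<and> opmod (M \<oplus>\<^sub>u N) \<approx>\<^sub>m opmod M \<oplus>\<^sub>m opmod N"
proof -
  note w = um_wf_module[OF M(1)] um_wf_module[OF M(2)]
  let ?m = "um_dim M" and ?n = "um_dim N"
  have c: "act_a M \<in> carrier_mat ?m ?m" "act_b M \<in> carrier_mat ?m ?m" "act_c M \<in> carrier_mat ?m ?m"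
    "act_a N \<in> carrier_mat ?n ?n" "act_b N \<in> carrier_mat ?n ?n" "act_c N \<in> carrier_mat ?n ?n"
    using w by (auto simp: um_wf_def)
  have dc: "A \<in> carrier_mat ?m ?m \<Longrightarrow> B \<in> carrier_mat ?n ?n \<Longrightarrow> diag_sum A B \<in> carrier_mat (?m + ?n) (?m + ?n)"
    for A B :: "'k mat"
    by (auto simp: diag_sum_def)
  have wS: "um_wf (M \<oplus>\<^sub>u N)" using c by (simp add: um_wf_def um_sum_def dc)
  let ?f = "\<lambda>f. ((\<lambda>i. if i < ?m then f i else 0), (\<lambda>i. f (?m + i)))"
  have cut: "mat_op A (\<lambda>i. if i < ?m then f i else 0) = mat_op A f" if "A \<in> carrier_mat ?m ?m" for A
    and f :: "nat \<Rightarrow> 'k"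
    using that by (auto simp: mat_op_def fun_eq_iff intro!: sum.cong)
  have out: "mat_op A f i = 0" if "A \<in> carrier_mat ?m ?m" "\<not> i < ?m" for A and f :: "nat \<Rightarrow> 'k" and i
    using that by (auto simp: mat_op_def)
  have f: "mhom (opmod (M \<oplus>\<^sub>u N)) (opmod M \<oplus>\<^sub>m opmod N) ?f"
    unfolding mhom_def
  proof (intro conjI ballI allI)
    fix v g assume v: "v \<in> car (opmod (M \<oplus>\<^sub>u N))"
    show "?f (act (opmod (M \<oplus>\<^sub>u N)) g v) = act (opmod M \<oplus>\<^sub>m opmod N) g (?f v)"
      by (cases g) (simp_all add: um_sum_def fun_eq_iff cut c out
          mat_op_diag_sum[OF c(1,4)] mat_op_diag_sum[OF c(2,5)] mat_op_diag_sum[OF c(3,6)])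
  qed (auto simp: um_sum_def car_F)
  have b: "bij_betw ?f (car (opmod (M \<oplus>\<^sub>u N))) (car (opmod M \<oplus>\<^sub>m opmod N))"
    by (rule bij_betwI[where g = "\<lambda>(f, g) i. if i < ?m then f i else g (i - ?m)"])
      (auto simp: um_sum_def car_F fun_eq_iff)
  show ?thesis by (rule um_moduleI[OF ch wS _ f b]) (use opmod_umod[OF ch] M in simp)
qed

lemma um_mult_abs:
  fixes C :: "'k::field um_mod"
  assumes ch: "CHAR('k) = 2" and C: "um_module C" "opmod C \<approx>\<^sub>m Pmod d ground"
  shows "um_module (um_mult n C) \<and> opmod (um_mult n C) \<approx>\<^sub>m Pmod d (F n)"
proof (induction n)
  case 0
  have F0: "car (F 0 :: ('k, _) amod) = {0}" by (rule car_mpow_0) (simp add: ch)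
  have "um_module (um_zero :: 'k um_mod) \<and> opmod (um_zero :: 'k um_mod) \<approx>\<^sub>m F 0"
  proof (rule um_moduleI[OF ch])
    show "mhom (opmod (um_zero :: 'k um_mod)) (F 0) (\<lambda>v. 0)"
      using umod.act_0[of "F 0 :: ('k, _) amod"] ch by (auto simp: mhom_def um_zero_def F0)
  qed (use ch F0 in \<open>auto simp: um_wf_def um_zero_def bij_betw_def\<close>)
  then have m: "um_module (um_zero :: 'k um_mod)" by blast
  have "opmod (um_zero :: 'k um_mod) \<approx>\<^sub>m Pmod d (F 0 :: ('k, _) amod)"
    using opmod_umod[OF ch m] F0 car_Pmod_0[OF ch] ch
      by (intro miso_zero) (simp_all add: um_zero_def del: Pmod_simps)
  with m show ?case by simp
next
  case (Suc n)
  have uk: "umod (ground :: ('k, 'k) amod)" using ch by simp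
  have s: "um_module (C \<oplus>\<^sub>u um_mult n C)" "opmod (C \<oplus>\<^sub>u um_mult n C) \<approx>\<^sub>m opmod C \<oplus>\<^sub>m opmod (um_mult n C)"
    using um_sum_abs[OF ch C(1)] Suc by auto
  note s(2)
  also have "opmod C \<oplus>\<^sub>m opmod (um_mult n C) \<approx>\<^sub>m Pmod d ground \<oplus>\<^sub>m Pmod d (F n)"
    using Suc C by (intro msum_cong) simp_all
  also have "\<dots> \<approx>\<^sub>m Pmod d (F n) \<oplus>\<^sub>m Pmod d ground" by (rule msum_comm)
  also have "\<dots> \<approx>\<^sub>m Pmod d (F n \<oplus>\<^sub>m ground)"
    using ch by (intro miso_sym[OF Pmod_msum]) simp_all
  also have "\<dots> \<approx>\<^sub>m Pmod d (F (Suc n))"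
    using ch by (intro Pmod_cong miso_sym[OF mpow_Suc]) simp_all
  finally show ?case using s(1) by simp
qed

lemma mat_op_cols3:
  "u \<in> carrier_vec 3 \<Longrightarrow> v \<in> carrier_vec 3 \<Longrightarrow> w \<in> carrier_vec 3 \<Longrightarrow>
    mat_op (mat_of_cols 3 [u, v, w]) f = (\<lambda>i. if i < 3 then u $ i * f 0 + v $ i * f 1 + w $ i * f 2 else 0)"
  by (auto simp: mat_op_def mat_of_cols_index fun_eq_iff eval_nat_numeral)

lemma um_V_abs:
  fixes i :: nat
  assumes ch: "CHAR('k::field) = 2" and i: "i \<in> {0, 1}"
  shows "um_module (um_V i :: 'k um_mod) \<and> opmod (um_V i :: 'k um_mod) \<approx>\<^sub>m Omod (i = 1) 0"
proof -
  have F0: "v \<in> car (F 0 :: ('k, _) amod) \<Longrightarrow> v = 0" for v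
    using car_mpow_0[of "ground :: ('k, 'k) amod"] ch by auto
  show ?thesis
  proof (cases "i = 0")
    case True
    let ?V = "um_V0 :: 'k um_mod"
    have f: "mhom (opmod ?V) (Omod False 0) (\<lambda>f. (f, 0, 0, 0))"
      using umod_Omod[OF ch, of False 0] unfolding mhom_def
    proof (intro conjI ballI allI, goal_cases)
      case (3 g v)
      then show ?case
        by (cases g) (auto simp: um_V0_def Omod_def act_mpow mat_op_zero fun_eq_iff trunc_def shift_def car_F)
    qed (auto simp: um_V0_def Omod_def car_F)
    have b: "bij_betw (\<lambda>f. (f, 0, 0, 0)) (car (opmod ?V)) (car (Omod False 0 :: ('k, _) amod))"
      by (rule bij_betwI[where g = fst]) (auto simp: um_V0_def Omod_def car_F fun_eq_iff)
    have "um_module ?V \<and> opmod ?V \<approx>\<^sub>m Omod False 0"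
      by (rule um_moduleI[OF ch _ umod_Omod[OF ch] f b]) (simp add: um_wf_def um_V0_def)
    then show ?thesis using True by (simp add: um_V_def)
  next
    case False
    then have i: "i = 1" using i by simp
    let ?V = "um_V1 :: 'k um_mod"
    have c3: "mat_of_cols 3 [u, v, w] \<in> carrier_mat 3 3" for u v w :: "'k vec"
      using mat_of_cols_carrier(1)[of 3 "[u, v, w]"] by (simp add: numeral_3_eq_3)
    let ?c = "\<lambda>x i. if i = (0::nat) then x else (0::'k)"
    let ?f = "\<lambda>f. (?c (f 0), ?c (f 1), ?c (f 2), \<lambda>_. 0)"
    have f: "mhom (opmod ?V) (Omod True 0) ?f"
      unfolding mhom_def
    proof (intro conjI ballI allI, goal_cases)
      case (3 g v)
      then show ?case
        by (cases g) (auto simp: um_V1_def Let_def Omod_def act_mpow mat_op_cols3 fun_eq_iff trunc_def shift_def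
          car_F)
    qed (auto simp: um_V1_def Let_def Omod_def car_F fun_eq_iff)
    have b: "bij_betw ?f (car (opmod ?V)) (car (Omod True 0 :: ('k, _) amod))"
    proof (rule bij_betwI[where g = "\<lambda>(x, y, z, t) i. if i = 0 then x 0 else if i = 1 then y 0 else
      if i = 2 then z 0 else 0"])
      show "?f \<in> car (opmod ?V) \<rightarrow> car (Omod True 0)" using mhomD(1)[OF f] by blast
    next
      fix v assume "v \<in> car (opmod ?V)"
      then have "v i = 0" if "3 \<le> i" for i using that by (auto simp: um_V1_def Let_def car_F)
      then show "(case ?f v of (x, y, z, t) \<Rightarrow> \<lambda>i. if i = 0 then x 0 else if i = 1 then y 0 else
        if i = 2 then z 0 else 0) = v"
        by (auto simp: fun_eq_iff)
    qed (auto simp: um_V1_def Let_def Omod_def car_F fun_eq_iff)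
    have "um_module ?V \<and> opmod ?V \<approx>\<^sub>m Omod True 0"
      by (rule um_moduleI[OF ch _ umod_Omod[OF ch] f b]) (simp add: um_wf_def um_V1_def Let_def c3)
    then show ?thesis using i by (simp add: um_V_def)
  qed
qed

lemma um_Omega_abs:
  fixes i :: nat
  assumes ch: "CHAR('k::field) = 2" and i: "i \<in> {0, 1}"
  shows "um_module ((um_Omega ^^ s) (um_V i :: 'k um_mod)) \<and>
    opmod ((um_Omega ^^ s) (um_V i :: 'k um_mod)) \<approx>\<^sub>m Omod ((i = 1) \<noteq> odd s) s"
proof (induction s)
  case 0
  then show ?case using um_V_abs[OF assms] by simp
next
  case (Suc s)
  have e: "((i = 1) \<noteq> odd (Suc s)) = (\<not> ((i = 1) \<noteq> odd s))" by auto
  have "(um_Omega ^^ Suc s) (um_V i) = um_Omega ((um_Omega ^^ s) (um_V i :: 'k um_mod))" by simp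
  then show ?case unfolding e using um_Omega_step[OF ch conjunct1[OF Suc] conjunct2[OF Suc]] by metis
qed

lemma um_P_abs:
  assumes ch: "CHAR('k::field) = 2"
  shows "um_module (um_P m n :: 'k um_mod) \<and> opmod (um_P m n :: 'k um_mod) \<approx>\<^sub>m PP m n"
proof -
  have uk: "umod (ground :: ('k, 'k) amod)" using ch by simp
  have "um_module (um_mult n (um_cover (um_V i :: 'k um_mod))) \<and>
      opmod (um_mult n (um_cover (um_V i :: 'k um_mod))) \<approx>\<^sub>m Pmod (i = 1) (F n)" if i: "i \<in> {0, 1}" for n i
  proof (rule um_mult_abs[OF ch])
    have c: "um_module (um_cover (um_V i :: 'k um_mod))"
      "opmod (um_cover (um_V i :: 'k um_mod)) \<approx>\<^sub>m Pmod (i = 1) (F (Suc 0))"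
      using um_cover_iso[OF ch] um_V_abs[OF ch i] by blast+
    note c(2)
    also have "Pmod (i = 1) (F (Suc 0) :: ('k, _) amod) \<approx>\<^sub>m Pmod (i = 1) ground"
      using uk mpow_1[OF uk] by (intro Pmod_cong) simp_all
    finally show "opmod (um_cover (um_V i :: 'k um_mod)) \<approx>\<^sub>m Pmod (i = 1) ground" .
    show "um_module (um_cover (um_V i :: 'k um_mod))" by (rule c(1))
  qed
  from this[of 0 m] this[of 1 n] show ?thesis
    unfolding um_P_def PP_def using um_sum_abs[OF ch] msum_cong miso_trans by fastforce
qed

subsection \<open>The modules \<open>A\<^sub>x(r)\<close> and \<open>B\<^sub>x(r)\<close>\<close>

text \<open>The coefficients of \<open>X1\<close> and \<open>X2\<close> in the sense of
  \<open>bidiag\<close>. The vectors \<open>z_(4k+1), ..., z_(4k+4)\<close> form block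
  \<open>k\<close>; the terms of \<open>a z_i\<close> and \<open>b z_i\<close> in the previous block
  make up the shift. The second branch is the convention for \<open>x1 = x2\<close>. In both
  branches a nonzero \<open>x\<close> gives a nonzero leading coefficient in one of the two
  pairs.\<close>

definition A_pencil :: "'k::field \<times> 'k \<Rightarrow> ('k \<times> 'k) \<times> ('k \<times> 'k)" where
  "A_pencil x = (if fst x \<noteq> snd x then (x, (snd x, fst x)) else ((1, 0), (1, 1)))"

lemma um_wf_A: "um_wf (um_A x r)" and um_dim_A: "um_dim (um_A x r) = 4 * r"
proof -
  have "mat_of_cols (4 * r) (map h [1..<4 * r + 1]) \<in> carrier_mat (4 * r) (4 * r)" for h :: "nat \<Rightarrow> 'a vec"
    using mat_of_cols_carrier(1)[of "4 * r" "map h [1..<4 * r + 1]"] by (simp del: upt_Suc)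
  then show "um_wf (um_A x r)" "um_dim (um_A x r) = 4 * r" by (simp_all add: um_wf_def um_A_def del: upt_Suc)
qed

lemma um_wf_B: "um_wf (um_B x r)" and um_dim_B: "um_dim (um_B x r) = 4 * r"
  using um_wf_A[of x r] by (simp_all add: um_wf_def um_B_def um_dual_def um_dim_A)

lemmas um_A_dim = carrier_matD[OF um_wf_A[unfolded um_wf_def um_dim_A, THEN conjunct1]]
  carrier_matD[OF um_wf_A[unfolded um_wf_def um_dim_A, THEN conjunct2, THEN conjunct1]]
  carrier_matD[OF um_wf_A[unfolded um_wf_def um_dim_A, THEN conjunct2, THEN conjunct2]]

lemmas um_B_dim = carrier_matD[OF um_wf_B[unfolded um_wf_def um_dim_B, THEN conjunct1]]
  carrier_matD[OF um_wf_B[unfolded um_wf_def um_dim_B, THEN conjunct2, THEN conjunct1]]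
  carrier_matD[OF um_wf_B[unfolded um_wf_def um_dim_B, THEN conjunct2, THEN conjunct2]]

lemma um_A_index:
  assumes "i < 4 * r" "j < 4 * r"
  shows "act_a (um_A x r) $$ (i, j) = A_img_a x r (Suc j) $ i"
    "act_b (um_A x r) $$ (i, j) = A_img_b x r (Suc j) $ i"
    "act_c (um_A x r) $$ (i, j) = A_img_c r (Suc j) $ i"
  using assms by (simp_all add: um_A_def mat_of_cols_index del: upt_Suc)

text \<open>Rows and columns count from 0, so column \<open>4 * k\<close> belongs to
  \<open>z_(4k+1)\<close>. The guard \<open>0 < k\<close> matters: for \<open>k = 0\<close> the
  truncated difference \<open>4 * k - 3\<close> would point to row 0.\<close>

lemma um_A_entry_a:
  assumes "k < r" "i < 4 * r"
  shows "act_a (um_A x r) $$ (i, 4 * k) = (if i = 4 * k + 1 then fst (fst (A_pencil x)) else 0) +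
      (if 0 < k \<and> i = 4 * k - 3 then snd (fst (A_pencil x)) else 0)"
    "act_a (um_A x r) $$ (i, 4 * k + 1) = (if i = 4 * k + 2 then 1 else 0)"
    "act_a (um_A x r) $$ (i, 4 * k + 2) = (if i = 4 * k + 3 then 1 else 0)"
    "act_a (um_A x r) $$ (i, 4 * k + 3) = 0"
  using assms
  by (auto simp: um_A_index A_img_a_def um_z_def Let_def A_pencil_def mod_Suc numeral_3_eq_3)

lemma um_A_entry_b:
  assumes "k < r" "i < 4 * r"
  shows "act_b (um_A x r) $$ (i, 4 * k) = (if i = 4 * k + 3 then fst (snd (A_pencil x)) else 0) +
      (if 0 < k \<and> i = 4 * k - 1 then snd (snd (A_pencil x)) else 0)"
    "act_b (um_A x r) $$ (i, 4 * k + 1) = 0"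
    "act_b (um_A x r) $$ (i, 4 * k + 2) = (if i = 4 * k + 1 then 1 else 0)"
    "act_b (um_A x r) $$ (i, 4 * k + 3) = (if i = 4 * k + 2 then 1 else 0)"
  using assms
  by (auto simp: um_A_index A_img_b_def um_z_def Let_def A_pencil_def mod_Suc numeral_3_eq_3)

lemma um_A_entry_c:
  assumes "k < r" "i < 4 * r"
  shows "act_c (um_A x r) $$ (i, 4 * k) = 0"
    "act_c (um_A x r) $$ (i, 4 * k + 1) = (if i = 4 * k + 1 then 1 else 0)"
    "act_c (um_A x r) $$ (i, 4 * k + 2) = 0"
    "act_c (um_A x r) $$ (i, 4 * k + 3) = (if i = 4 * k + 3 then 1 else 0)"
  using assms
  by (auto simp: um_A_index A_img_c_def um_z_def numeral_3_eq_3)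

lemma sum_4:
  "(\<Sum>i<4 * r. g i) = (\<Sum>k<r. g (4 * k) + g (4 * k + 1) + g (4 * k + 2) + g (4 * k + 3 :: nat)
    :: 'a::comm_monoid_add)"
  by (induction r) (simp_all add: eval_nat_numeral ac_simps)

lemma mod4_eqs:
  "(4 * k + 1 = 4 * k' + 2) = False" "(4 * k + 1 = 4 * k' + 3) = False" "(4 * k + 2 = 4 * k' + 1) = False"
  "(4 * k + 2 = 4 * k' + 3) = False" "(4 * k + 3 = 4 * k' + 1) = False" "(4 * k + 3 = 4 * k' + 2) = False"
  "(4 * k = 4 * k' + 1) = False" "(4 * k = 4 * k' + 2) = False" "(4 * k = 4 * k' + 3) = False"
  "(4 * k + 1 = 4 * k' + 1) = (k' = k)" "(4 * k + 2 = 4 * k' + 2) = (k' = k)"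
    "(4 * k + 3 = 4 * k' + 3) = (k' = k)"
  "(0 < k' \<and> 4 * k + 1 = 4 * k' - 3) = (k' = Suc k)" "(0 < k' \<and> 4 * k + 3 = 4 * k' - 1) = (k' = Suc k)"
  "(0 < k' \<and> 4 * k + 1 = 4 * k' - 1) = False" "(0 < k' \<and> 4 * k + 2 = 4 * k' - 1) = False"
    "(0 < k' \<and> 4 * k = 4 * k' - 1) = False"
  "(0 < k' \<and> 4 * k + 3 = 4 * k' - 3) = False" "(0 < k' \<and> 4 * k + 2 = 4 * k' - 3) = False"
    "(0 < k' \<and> 4 * k = 4 * k' - 3) = False"
  for k k' :: nat
  by presburger+

lemma if_mult: "(if b then x else 0) * y = (if b then x * y else (0::'a::mult_zero))"
  by simp

lemma if_conj: "(if P \<and> Q then x else 0) = (if Q then if P then x else 0 else 0)"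
  by simp

text \<open>Extending the top coordinates by zero lets the last block be treated like the
  others.\<close>

lemma um_A_row:
  fixes w :: "nat \<Rightarrow> 'k::field"
  assumes k: "k < r"
  defines "t \<equiv> \<lambda>k. if k < r then w (4 * k) else 0"
  shows "mat_op (act_a (um_A x r)) w (4 * k) = 0"
    "mat_op (act_a (um_A x r)) w (4 * k + 1) = fst (fst (A_pencil x)) * t k + snd (fst (A_pencil x))
      * t (Suc k)"
    "mat_op (act_a (um_A x r)) w (4 * k + 2) = w (4 * k + 1)"
    "mat_op (act_a (um_A x r)) w (4 * k + 3) = w (4 * k + 2)"
    "mat_op (act_b (um_A x r)) w (4 * k) = 0"
    "mat_op (act_b (um_A x r)) w (4 * k + 1) = w (4 * k + 2)"
    "mat_op (act_b (um_A x r)) w (4 * k + 2) = w (4 * k + 3)"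
    "mat_op (act_b (um_A x r)) w (4 * k + 3) = fst (snd (A_pencil x)) * t k + snd (snd (A_pencil x))
      * t (Suc k)"
    "mat_op (act_c (um_A x r)) w (4 * k) = 0"
    "mat_op (act_c (um_A x r)) w (4 * k + 1) = w (4 * k + 1)"
    "mat_op (act_c (um_A x r)) w (4 * k + 2) = 0"
    "mat_op (act_c (um_A x r)) w (4 * k + 3) = w (4 * k + 3)"
  using k by (simp_all add: mat_op_def um_A_dim sum_4 um_A_entry_a um_A_entry_b um_A_entry_c mod4_eqs
    distrib_right if_mult sum.distrib t_def
    del: One_nat_def add_Suc_right add_2_eq_Suc' cong: sum.cong_simp)

text \<open>Column sums for \<open>A\<close> are row sums for the transposed matrices, which
  describe \<open>B\<close>.\<close>

lemma um_A_col:
  fixes w :: "nat \<Rightarrow> 'k::field"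
  assumes k: "k < r"
  shows "(\<Sum>i<4 * r. act_a (um_A x r) $$ (i, 4 * k) * w i) =
      fst (fst (A_pencil x)) * w (4 * k + 1) + snd (fst (A_pencil x)) * (if 0 < k then w (4 * k - 3) else 0)"
    "(\<Sum>i<4 * r. act_a (um_A x r) $$ (i, 4 * k + 1) * w i) = w (4 * k + 2)"
    "(\<Sum>i<4 * r. act_a (um_A x r) $$ (i, 4 * k + 2) * w i) = w (4 * k + 3)"
    "(\<Sum>i<4 * r. act_a (um_A x r) $$ (i, 4 * k + 3) * w i) = 0"
    "(\<Sum>i<4 * r. act_b (um_A x r) $$ (i, 4 * k) * w i) =
      fst (snd (A_pencil x)) * w (4 * k + 3) + snd (snd (A_pencil x)) * (if 0 < k then w (4 * k - 1) else 0)"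
    "(\<Sum>i<4 * r. act_b (um_A x r) $$ (i, 4 * k + 1) * w i) = 0"
    "(\<Sum>i<4 * r. act_b (um_A x r) $$ (i, 4 * k + 2) * w i) = w (4 * k + 1)"
    "(\<Sum>i<4 * r. act_b (um_A x r) $$ (i, 4 * k + 3) * w i) = w (4 * k + 2)"
    "(\<Sum>i<4 * r. act_c (um_A x r) $$ (i, 4 * k) * w i) = 0"
    "(\<Sum>i<4 * r. act_c (um_A x r) $$ (i, 4 * k + 1) * w i) = w (4 * k + 1)"
    "(\<Sum>i<4 * r. act_c (um_A x r) $$ (i, 4 * k + 2) * w i) = 0"
    "(\<Sum>i<4 * r. act_c (um_A x r) $$ (i, 4 * k + 3) * w i) = w (4 * k + 3)"
  using k
  by (simp_all add: um_A_entry_a um_A_entry_b um_A_entry_c distrib_right if_mult if_conj sum.distrib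
     del: One_nat_def add_Suc_right add_2_eq_Suc' cong: sum.cong_simp) auto

section \<open>Tensor products in coordinates\<close>

lemma sum_mult_index: "(\<Sum>q<m * n. g q) = (\<Sum>i<m. \<Sum>j<n. g (i * n + j :: nat) :: 'a::comm_monoid_add)"
proof (induction m)
  case (Suc m)
  have "(\<Sum>q<Suc m * n. g q) = (\<Sum>q<m * n + n. g q)" by (simp add: add.commute)
  then show ?case unfolding sum_lessThan_add using Suc by simp
qed simp

lemma mat_op_tensor:
  fixes f :: "nat \<Rightarrow> 'k::field"
  assumes A: "A \<in> carrier_mat m m" and B: "B \<in> carrier_mat n n" and ij: "i < m" "j < n"
  shows "mat_op (kron A (1\<^sub>m n) + kron (1\<^sub>m m) B) f (i * n + j) =
    (\<Sum>i'<m. A $$ (i, i') * f (i' * n + j)) + (\<Sum>j'<n. B $$ (j, j') * f (i * n + j'))"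
proof -
  have lt: "i' * n + j' < m * n" if "i' < m" "j' < n" for i' j'
  proof -
    have "i' * n + j' < Suc i' * n" using that by simp
    also have "\<dots> \<le> m * n" using that by (intro mult_le_mono1) simp
    finally show ?thesis .
  qed
  have dm: "(i' * n + j') div n = i'" "(i' * n + j') mod n = j'" if "j' < n" for i' j' using that by simp_all
  have kc: "kron A (1\<^sub>m n) \<in> carrier_mat (m * n) (m * n)" "kron (1\<^sub>m m) B \<in> carrier_mat (m * n) (m * n)"
    using A B by (auto simp: kron_def)
  have k1: "kron A (1\<^sub>m n) $$ (i * n + j, i' * n + j') = (if j' = j then A $$ (i, i') else 0)"
    and k2: "kron (1\<^sub>m m) B $$ (i * n + j, i' * n + j') = (if i' = i then B $$ (j, j') else 0)"
    if "i' < m" "j' < n" for i' j'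
    using A B ij that lt by (auto simp: kron_def dm)
  have 1: "mat_op (kron A (1\<^sub>m n)) f (i * n + j) = (\<Sum>i'<m. A $$ (i, i') * f (i' * n + j))"
  proof -
    have "mat_op (kron A (1\<^sub>m n)) f (i * n + j) = (\<Sum>q<m * n. kron A (1\<^sub>m n) $$ (i * n + j, q) * f q)"
      using kc(1) lt[OF ij] by (simp add: mat_op_def)
    also have "\<dots> = (\<Sum>i'<m. \<Sum>j'<n. (if j' = j then A $$ (i, i') * f (i' * n + j') else 0))"
      unfolding sum_mult_index by (intro sum.cong refl) (simp add: k1)
    also have "\<dots> = (\<Sum>i'<m. A $$ (i, i') * f (i' * n + j))" using ij by simp
    finally show ?thesis .
  qed
  have 2: "mat_op (kron (1\<^sub>m m) B) f (i * n + j) = (\<Sum>j'<n. B $$ (j, j') * f (i * n + j'))"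
  proof -
    have "mat_op (kron (1\<^sub>m m) B) f (i * n + j) = (\<Sum>q<m * n. kron (1\<^sub>m m) B $$ (i * n + j, q) * f q)"
      using kc(2) lt[OF ij] by (simp add: mat_op_def)
    also have "\<dots> = (\<Sum>i'<m. \<Sum>j'<n. (if i' = i then B $$ (j, j') * f (i' * n + j') else 0))"
      unfolding sum_mult_index by (intro sum.cong refl) (simp add: k2)
    also have "\<dots> = (\<Sum>j'<n. \<Sum>i'<m. (if i' = i then B $$ (j, j') * f (i' * n + j') else 0))" by (rule sum.swap)
    also have "\<dots> = (\<Sum>j'<n. B $$ (j, j') * f (i * n + j'))" using ij by simp
    finally show ?thesis .
  qed
  show ?thesis using mat_op_plus[OF kc] 1 2 by simp
qed

definition blk :: "nat \<Rightarrow> (nat \<Rightarrow> 'k::zero) \<Rightarrow> nat \<Rightarrow> nat \<Rightarrow> 'k" where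
  "blk n f i = (\<lambda>j. if j < n then f (i * n + j) else 0)"

text \<open>
  Row \<open>4k + e\<close> of the matrices of \<open>A\<^sub>x(r)\<close> (counted from 0) belongs to the coordinate \<open>t, x, y, z\<close> of
  \<open>Tmod False\<close> for \<open>e = 0, 1, 2, 3\<close>.  The permutation \<open>\<rho>\<close> is the identity for \<open>A\<^sub>x(r)\<close> and the reversal
  of all rows for \<open>B\<^sub>x(r)\<close>, which matches the coordinates \<open>x, y, z, t\<close> of \<open>Tmod True\<close>.
\<close>

definition slice :: "nat \<Rightarrow> nat \<Rightarrow> (nat \<Rightarrow> nat) \<Rightarrow> nat \<Rightarrow> (nat \<Rightarrow> 'k::zero) \<Rightarrow> nat \<Rightarrow> nat \<Rightarrow> 'k" where
  "slice r n \<rho> e f = (\<lambda>k. if k < r then blk n f (\<rho> (4 * k + e)) else (\<lambda>j. 0))"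

definition slices :: "nat \<Rightarrow> nat \<Rightarrow> (nat \<Rightarrow> nat) \<Rightarrow> (nat \<Rightarrow> 'k::zero) \<Rightarrow> _" where
  "slices r n \<rho> f = (slice r n \<rho> 0 f, slice r n \<rho> 1 f, slice r n \<rho> 2 f, slice r n \<rho> 3 f)"

definition unslice :: "nat \<Rightarrow> nat \<Rightarrow> (nat \<Rightarrow> nat) \<Rightarrow> _ \<Rightarrow> nat \<Rightarrow> 'k::zero" where
  "unslice r n \<rho> = (\<lambda>(t, x, y, z) p. if p < 4 * r * n then let i = \<rho> (p div n) in
     (if i mod 4 = 0 then t else if i mod 4 = 1 then x else
       if i mod 4 = 2 then y else z) (i div 4) (p mod n) else 0)"

lemma slices_bij:
  fixes W :: "('k::field, nat \<Rightarrow> 'k) amod"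
  assumes \<rho>: "\<And>i. i < 4 * r \<Longrightarrow> \<rho> i < 4 * r" "\<And>i. i < 4 * r \<Longrightarrow> \<rho> (\<rho> i) = i" and W: "car W = car (F n)"
  shows "bij_betw (slices r n \<rho>) (car (F (4 * r * n))) (car (Tmod d r q1 q2 W))"
proof -
  have car: "car (Tmod d r q1 q2 W) = {f. (\<forall>i j. n \<le> j \<longrightarrow> f i j = 0) \<and>
    (\<forall>i\<ge>r. f i = 0)} \<times> {f. (\<forall>i j. n \<le> j \<longrightarrow> f i j = 0) \<and> (\<forall>i\<ge>r. f i = 0)}
     \<times> {f. (\<forall>i j. n \<le> j \<longrightarrow> f i j = 0) \<and> (\<forall>i\<ge>r. f i = 0)} \<times> {f. (\<forall>i j. n \<le> j \<longrightarrow> f i j = 0) \<and> (\<forall>i\<ge>r. f i = 0)}"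
    by (cases d) (auto simp: Tmod_def car_mpow W car_F)
  have lt: "i * n + j < 4 * r * n" if "i < 4 * r" "j < n" for i j
  proof -
    have "i * n + j < Suc i * n" using that by simp
    also have "\<dots> \<le> 4 * r * n" using that by (intro mult_le_mono1) simp
    finally show ?thesis .
  qed
  show ?thesis
  proof (rule bij_betwI[where g = "unslice r n \<rho>"])
    show "slices r n \<rho> \<in> car (F (4 * r * n)) \<rightarrow> car (Tmod d r q1 q2 W)"
      unfolding car by (auto simp: slices_def slice_def blk_def fun_eq_iff)
    show "unslice r n \<rho> \<in> car (Tmod d r q1 q2 W) \<rightarrow> car (F (4 * r * n))"
      by (auto simp: unslice_def car_F)
  next
    fix f :: "nat \<Rightarrow> 'k" assume f: "f \<in> car (F (4 * r * n))"
    show "unslice r n \<rho> (slices r n \<rho> f) = f"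
    proof
      fix p
      show "unslice r n \<rho> (slices r n \<rho> f) p = f p"
      proof (cases "p < 4 * r * n")
        case True
        then have n: "0 < n" and i: "p div n < 4 * r" using less_mult_imp_div_less[of p "4 * r" n]
          by (auto intro: Nat.gr0I)
        define i where "i = \<rho> (p div n)"
        have i4: "i < 4 * r" and \<rho>i: "\<rho> i = p div n" using \<rho> i by (simp_all add: i_def)
        have k: "i div 4 < r" using i4 by simp
        have e: "4 * (i div 4) + i mod 4 = i" by simp
        have "slice r n \<rho> (i mod 4) f (i div 4) (p mod n) = f p"
          using k n by (simp add: slice_def blk_def e \<rho>i)
        moreover have "i mod 4 = 0 \<or> i mod 4 = 1 \<or> i mod 4 = 2 \<or> i mod 4 = 3" by presburger
        ultimately show ?thesis
          using True by (auto simp: unslice_def slices_def Let_def i_def[symmetric])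
      next
        case False
        then show ?thesis using f by (simp add: unslice_def slices_def car_F)
      qed
    qed
  next
    fix v assume v: "v \<in> car (Tmod d r q1 q2 W)"
    obtain t x y z where [simp]: "v = (t, x, y, z)" by (cases v)
    have val: "unslice r n \<rho> v (\<rho> (4 * k + e) * n + j) =
        (if e = 0 then t else if e = 1 then x else if e = 2 then y else z) k j"
      if "k < r" "j < n" "e < 4" for k j e
    proof -
      have "4 * k + e < 4 * r" using that by simp
      moreover have "(4 * k + e) mod 4 = e" "(4 * k + e) div 4 = k" using that by simp_all
      ultimately show ?thesis using that \<rho> lt[of "\<rho> (4 * k + e)" j] by (simp add: unslice_def Let_def)
    qed
    show "slices r n \<rho> (unslice r n \<rho> v) = v"
      using v val[of _ _ 0] val[of _ _ 1] val[of _ _ 2] val[of _ _ 3] unfolding car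
      by (auto simp: slices_def slice_def blk_def fun_eq_iff)
  qed
qed

lemma mat_op_row: "A \<in> carrier_mat m n \<Longrightarrow> i < m \<Longrightarrow> mat_op A w i = (\<Sum>j<n. A $$ (i, j) * w j)"
  by (simp add: mat_op_def)

text \<open>The two summands separate: \<open>A\<close> combines different blocks at a fixed
  position \<open>j\<close>, while \<open>B\<close> acts inside each block.\<close>

lemma slice_mat_op:
  fixes f :: "nat \<Rightarrow> 'k::field"
  assumes "\<And>i. i < 4 * r \<Longrightarrow> \<rho> i < 4 * r" "A \<in> carrier_mat (4 * r) (4 * r)" "B \<in> carrier_mat n n" "e < 4"
  shows "slice r n \<rho> e (mat_op (kron A (1\<^sub>m n) + kron (1\<^sub>m (4 * r)) B) f) =
    (\<lambda>k j. if k < r \<and> j < n then mat_op A (\<lambda>i. f (i * n + j)) (\<rho> (4 * k + e)) else 0) +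
    (\<lambda>k. mat_op B (slice r n \<rho> e f k))"
proof (intro ext)
  fix k j
  have "mat_op B (\<lambda>j. 0) = 0" for B :: "'k mat" by (auto simp: mat_op_def fun_eq_iff)
  moreover have "mat_op B (blk n f i) j = (if j < n then \<Sum>j'<n. B $$ (j, j') * f (i * n + j') else 0)" for i
    using assms(3) by (auto simp: mat_op_def blk_def)
  ultimately show "slice r n \<rho> e (mat_op (kron A (1\<^sub>m n) + kron (1\<^sub>m (4 * r)) B) f) k j =
    ((\<lambda>k j. if k < r \<and> j < n then mat_op A (\<lambda>i. f (i * n + j)) (\<rho> (4 * k + e)) else 0) +
    (\<lambda>k. mat_op B (slice r n \<rho> e f k))) k j"
    using assms(1)[of "4 * k + e"] assms(4) mat_op_tensor[OF assms(2,3), of "\<rho> (4 * k + e)" j f]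
      mat_op_row[OF assms(2), of "\<rho> (4 * k + e)"]
    by (simp add: slice_def) (simp add: blk_def)
qed

lemma um_wf_tensor: "um_wf M \<Longrightarrow> um_wf N \<Longrightarrow> um_wf (M \<otimes>\<^sub>u N)"
  by (auto simp: um_wf_def um_tensor_def Let_def kron_def)

text \<open>An equality of matrices and not just an isomorphism; it makes the description of
  \<open>A\<close> and \<open>B\<close> themselves a special case of that of their tensor
  products.\<close>

lemma um_tensor_V0:
  assumes "um_wf M" shows "M \<otimes>\<^sub>u um_V0 = M"
proof -
  have "kron X (1\<^sub>m 1) + kron (1\<^sub>m (um_dim M)) (0\<^sub>m 1 1) = X"
    if "X \<in> carrier_mat (um_dim M) (um_dim M)" for X :: "'a mat"
    using that by (intro eq_matI) (auto simp: kron_def)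
  then show ?thesis using assms by (simp add: um_tensor_def um_V0_def um_wf_def Let_def)
qed

definition rev4 :: "nat \<Rightarrow> nat \<Rightarrow> nat" where
  "rev4 r i = 4 * r - 1 - i"

lemma um_B_index:
  assumes "CHAR('k::field) = 2" "i < 4 * r" "j < 4 * r"
  shows "act_a (um_B x r :: 'k um_mod) $$ (i, j) = act_a (um_A x r) $$ (j, i)"
    "act_b (um_B x r :: 'k um_mod) $$ (i, j) = act_b (um_A x r) $$ (j, i)"
    "act_c (um_B x r :: 'k um_mod) $$ (i, j) = act_c (um_A x r) $$ (j, i)"
proof -
  have neg: "- y = y" for y :: 'k using umod_ground_add_self[OF assms(1), of y] by (metis add_eq_0_iff)
  show "act_a (um_B x r :: 'k um_mod) $$ (i, j) = act_a (um_A x r) $$ (j, i)"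
    "act_b (um_B x r :: 'k um_mod) $$ (i, j) = act_b (um_A x r) $$ (j, i)"
    "act_c (um_B x r :: 'k um_mod) $$ (i, j) = act_c (um_A x r) $$ (j, i)"
    using um_wf_A[of x r] assms(2,3) by (auto simp: um_B_def um_dual_def um_wf_def um_dim_A neg)
qed

lemma um_B_sum:
  assumes "CHAR('k::field) = 2" "m < 4 * r"
  shows "mat_op (act_a (um_B x r :: 'k um_mod)) w m = (\<Sum>i<4 * r. act_a (um_A x r) $$ (i, m) * w i)"
    "mat_op (act_b (um_B x r :: 'k um_mod)) w m = (\<Sum>i<4 * r. act_b (um_A x r) $$ (i, m) * w i)"
    "mat_op (act_c (um_B x r :: 'k um_mod)) w m = (\<Sum>i<4 * r. act_c (um_A x r) $$ (i, m) * w i)"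
  using assms by (simp_all add: mat_op_def um_B_dim um_B_index cong: sum.cong_simp)

lemma rev4_eqs:
  assumes "l < r" "k = r - 1 - l"
  shows "rev4 r (4 * k) = 4 * l + 3" "rev4 r (4 * k + 1) = 4 * l + 2" "rev4 r (4 * k + 2) = 4 * l + 1"
    "rev4 r (4 * k + 3) = 4 * l" "0 < l \<Longrightarrow> rev4 r (4 * Suc k + 2) = 4 * l - 3"
      "0 < l \<Longrightarrow> rev4 r (4 * Suc k) = 4 * l - 1"
    "Suc k < r \<longleftrightarrow> 0 < l"
  using assms by (auto simp: rev4_def)

text \<open>Reversing all rows does two things: it identifies the dual of \<open>V1\<close> with
  \<open>V1\<close>, and it turns the transposed shift back into the shift.\<close>

lemma um_B_row:
  fixes w :: "nat \<Rightarrow> 'k::field"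
  assumes ch: "CHAR('k) = 2" and k: "k < r"
  shows "mat_op (act_a (um_B x r)) w (rev4 r (4 * k)) = 0" (is ?g1)
    "mat_op (act_a (um_B x r)) w (rev4 r (4 * k + 1)) = w (rev4 r (4 * k))" (is ?g2)
    "mat_op (act_a (um_B x r)) w (rev4 r (4 * k + 2)) = w (rev4 r (4 * k + 1))" (is ?g3)
    "mat_op (act_a (um_B x r)) w (rev4 r (4 * k + 3)) =
      fst (fst (A_pencil x)) * w (rev4 r (4 * k + 2)) + snd (fst (A_pencil x))
        * (if Suc k < r then w (rev4 r (4 * Suc k + 2)) else 0)" (is ?g4)
    "mat_op (act_b (um_B x r)) w (rev4 r (4 * k)) = w (rev4 r (4 * k + 1))" (is ?g5)
    "mat_op (act_b (um_B x r)) w (rev4 r (4 * k + 1)) = w (rev4 r (4 * k + 2))" (is ?g6)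
    "mat_op (act_b (um_B x r)) w (rev4 r (4 * k + 2)) = 0" (is ?g7)
    "mat_op (act_b (um_B x r)) w (rev4 r (4 * k + 3)) =
      fst (snd (A_pencil x)) * w (rev4 r (4 * k)) + snd (snd (A_pencil x))
        * (if Suc k < r then w (rev4 r (4 * Suc k)) else 0)" (is ?g8)
    "mat_op (act_c (um_B x r)) w (rev4 r (4 * k)) = w (rev4 r (4 * k))" (is ?g9)
    "mat_op (act_c (um_B x r)) w (rev4 r (4 * k + 1)) = 0" (is ?g10)
    "mat_op (act_c (um_B x r)) w (rev4 r (4 * k + 2)) = w (rev4 r (4 * k + 2))" (is ?g11)
    "mat_op (act_c (um_B x r)) w (rev4 r (4 * k + 3)) = 0" (is ?g12)
proof -
  \<comment> \<open>The reversal sends row \<open>4 * k + e\<close> to row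
    \<open>4 * l + 3 - e\<close>, so block \<open>k + 1\<close> corresponds to block
    \<open>l - 1\<close>.\<close>
  define l where "l = r - 1 - k"
  have l: "l < r" "k = r - 1 - l" using k by (simp_all add: l_def)
  have m: "4 * l < 4 * r" "4 * l + 1 < 4 * r" "4 * l + 2 < 4 * r" "4 * l + 3 < 4 * r" using l by simp_all
  note e = rev4_eqs[OF l] um_B_sum[OF ch m(1)] um_B_sum[OF ch m(2)] um_B_sum[OF ch m(3)] um_B_sum[OF ch m(4)]
    um_A_col[OF l(1), of x w]
  show ?g1 ?g2 ?g3 ?g4 ?g5 ?g6 ?g7 ?g8 ?g9 ?g10 ?g11 ?g12
    by (simp_all only: e cong: if_cong)
qed

definition um_AB :: "bool \<Rightarrow> 'k::field \<times> 'k \<Rightarrow> nat \<Rightarrow> 'k um_mod" where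
  "um_AB d x r = (if d then um_B x r else um_A x r)"

text \<open>The multiplicity spaces become powers of \<open>N\<close> that keep the action of
  \<open>N\<close>, since the generators are primitive. That the product is a module comes out of
  the same bijection.\<close>

lemma um_tensor_AB:
  fixes N :: "'k::field um_mod"
  assumes ch: "CHAR('k) = 2" and N: "um_module N"
  shows "um_module (um_AB d x r \<otimes>\<^sub>u N) \<and>
    opmod (um_AB d x r \<otimes>\<^sub>u N) \<approx>\<^sub>m Tmod d r (fst (A_pencil x)) (snd (A_pencil x)) (opmod N)"
proof -
  let ?M = "um_AB d x r" and ?n = "um_dim N" and ?K = "Tmod d r (fst (A_pencil x)) (snd (A_pencil x)) (opmod N)"
  let ?T = "?M \<otimes>\<^sub>u N"
  have d: "um_dim ?M = 4 * r" and wM: "um_wf ?M" by (simp_all add: um_AB_def um_dim_A um_dim_B um_wf_A um_wf_B)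
  note w = wM um_wf_module[OF N]
  have c: "act_a ?M \<in> carrier_mat (4 * r) (4 * r)" "act_b ?M \<in> carrier_mat (4 * r) (4 * r)"
    "act_c ?M \<in> carrier_mat (4 * r) (4 * r)" "act_a N \<in> carrier_mat ?n ?n" "act_b N \<in> carrier_mat ?n ?n"
    "act_c N \<in> carrier_mat ?n ?n"
    using w by (auto simp: um_wf_def d)
  have T: "um_dim ?T = 4 * r * ?n" "act_a ?T = kron (act_a ?M) (1\<^sub>m ?n) + kron (1\<^sub>m (4 * r)) (act_a N)"
    "act_b ?T = kron (act_b ?M) (1\<^sub>m ?n) + kron (1\<^sub>m (4 * r)) (act_b N)"
    "act_c ?T = kron (act_c ?M) (1\<^sub>m ?n) + kron (1\<^sub>m (4 * r)) (act_c N)"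
    by (simp_all add: um_tensor_def Let_def d)
  define \<rho> where "\<rho> = (if d then rev4 r else (\<lambda>i. i))"
  have \<rho>: "i < 4 * r \<Longrightarrow> \<rho> i < 4 * r" "i < 4 * r \<Longrightarrow> \<rho> (\<rho> i) = i" for i
    by (simp_all add: \<rho>_def rev4_def)
  let ?s = "slices r ?n \<rho>"
  note sl = slices_def slice_mat_op[of r \<rho>, OF \<rho>(1)] c act_mpow T
  have b: "bij_betw ?s (car (opmod ?T)) (car ?K)"
    using slices_bij[of r \<rho> "opmod N" ?n, OF \<rho>] by (simp add: T)
  have "mhom (opmod ?T) ?K ?s"
    unfolding mhom_def
  proof (intro conjI ballI allI)
    fix v w g assume v: "v \<in> car (opmod ?T)"
    show "?s v \<in> car ?K" using b v by (auto simp: bij_betw_def)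
    show "?s (v + w) = ?s v + ?s w" by (auto simp: slices_def slice_def blk_def fun_eq_iff)
    have *: "?s (mat_op (act_a ?T) v) = act ?K Ga (?s v)" "?s (mat_op (act_b ?T) v) = act ?K Gb (?s v)"
      "?s (mat_op (act_c ?T) v) = act ?K Gc (?s v)"
      by (simp_all only: sl, simp_all only: Tmod_def \<rho>_def um_AB_def)
        (cases d; simp add: act_mpow del: One_nat_def; auto simp: fun_eq_iff bidiag_def slice_def blk_def
          um_A_row
          um_B_row[OF ch] simp del: One_nat_def add_2_eq_Suc' add_Suc_right mult_Suc_right)+
    show "?s (act (opmod ?T) g v) = act ?K g (?s v)"
    proof (cases g)
      case (Gs k)
      then show ?thesis
        by (cases d) (auto simp: slices_def Tmod_def act_mpow fun_eq_iff slice_def blk_def)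
    qed (simp_all only: opmod_simps *)
  qed
  then show ?thesis
    using um_moduleI[OF ch um_wf_tensor[OF w] _ _ b] opmod_umod[OF ch N] by simp
qed

lemma um_AB_abs:
  fixes x :: "'k::field \<times> 'k"
  assumes ch: "CHAR('k) = 2"
  shows "um_module (um_AB d x r) \<and> opmod (um_AB d x r) \<approx>\<^sub>m Tmod d r (fst (A_pencil x)) (snd (A_pencil x))
    ground"
proof -
  have V: "um_module (um_V0 :: 'k um_mod)" "opmod (um_V0 :: 'k um_mod) \<approx>\<^sub>m Omod False 0"
    using um_V_abs[OF ch, of 0] by (simp_all add: um_V_def)
  have e: "um_AB d x r \<otimes>\<^sub>u um_V0 = um_AB d x r"
    by (rule um_tensor_V0) (simp add: um_AB_def um_wf_A um_wf_B)
  have "Tmod d r (fst (A_pencil x)) (snd (A_pencil x)) (opmod (um_V0 :: 'k um_mod)) \<approx>\<^sub>m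
    Tmod d r (fst (A_pencil x)) (snd (A_pencil x)) ground"
    using ch by (intro Tmod_cong opmod_umod[OF ch] V(1) miso_trans[OF V(2) Omod_False_0[OF ch]]) simp_all
  then show ?thesis using um_tensor_AB[OF ch V(1), of d x r] miso_trans unfolding e by blast
qed

theorem um_AB_tensor_Omega:
  fixes x :: "'k::field \<times> 'k"
  assumes ch: "CHAR('k) = 2" and x: "x \<noteq> (0, 0)" and i: "i \<in> {0, 1}"
  shows "um_AB d x r \<otimes>\<^sub>u (um_Omega ^^ s) (um_V i) \<simeq>\<^sub>u
    um_AB (d \<noteq> odd (s + i)) x r \<oplus>\<^sub>u um_P (mult_P0 d (odd (s + i)) r s) (mult_P1 d (odd (s + i)) r s)"
proof -
  let ?W = "(um_Omega ^^ s) (um_V i) :: 'k um_mod" and ?q1 = "fst (A_pencil x)" and ?q2 = "snd (A_pencil x)"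
  have q: "fst ?q1 \<noteq> 0 \<or> fst ?q2 \<noteq> 0"
    using x by (cases x) (auto simp: A_pencil_def)
  have o: "((i = 1) \<noteq> odd s) = odd (s + i)" using i by auto
  note W = um_Omega_abs[OF ch i, of s, unfolded o]
  note A = um_AB_abs[OF ch, of "d \<noteq> odd (s + i)" x r] and P = um_P_abs[OF ch]
  note T = um_tensor_AB[OF ch conjunct1[OF W], of d x r]
  note S = um_sum_abs[OF ch conjunct1[OF A] conjunct1[OF P]]
  note uW = opmod_umod[OF ch conjunct1[OF W]]
  have uk: "umod (ground :: ('k, 'k) amod)" using ch by simp
  note conjunct2[OF T]
  also have "Tmod d r ?q1 ?q2 (opmod ?W) \<approx>\<^sub>m Tmod d r ?q1 ?q2 (Omod (odd (s + i)) s)"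
    by (rule Tmod_cong[OF uW umod_Omod[OF ch] conjunct2[OF W]])
  also have "\<dots> \<approx>\<^sub>m Tmod (d \<noteq> odd (s + i)) r ?q1 ?q2 ground \<oplus>\<^sub>m PP (mult_P0 d (odd (s + i)) r s)
    (mult_P1 d (odd (s + i)) r s)"
    using Tmod_Omod[OF ch q, of d r "i = 1" s] unfolding o .
  also have "\<dots> \<approx>\<^sub>m opmod (um_AB (d \<noteq> odd (s + i)) x r) \<oplus>\<^sub>m opmod (um_P (mult_P0 d (odd (s + i)) r s)
    (mult_P1 d (odd (s + i)) r s))"
    by (intro msum_cong miso_sym[OF conjunct2[OF A]] miso_sym[OF conjunct2[OF P]] opmod_umod[OF ch]
      conjunct1[OF A] conjunct1[OF P])
      (simp_all add: ch)
  also have "\<dots> \<approx>\<^sub>m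
    opmod (um_AB (d \<noteq> odd (s + i)) x r \<oplus>\<^sub>u um_P (mult_P0 d (odd (s + i)) r s) (mult_P1 d (odd (s + i)) r s))"
    by (intro miso_sym[OF conjunct2[OF S]] umod_msum opmod_umod[OF ch] conjunct1[OF A] conjunct1[OF P]
      conjunct1[OF S])
  finally show ?thesis
    unfolding um_iso_iff[OF ch] using conjunct1[OF T] conjunct1[OF S] by blast
qed

theorem proposition4p11:
  fixes x :: "'k::alg_closed_field \<times> 'k" and r s i :: nat
  assumes "CHAR('k) = 2"
    and "r \<ge> 1"
    and "x \<noteq> (0, 0)"
    and "i \<in> {0, 1}"
  shows
    "(even (s + i) \<longrightarrow>
        um_A x r \<otimes>\<^sub>u (um_Omega ^^ s) (um_V i) \<simeq>\<^sub>u um_A x r \<oplus>\<^sub>u um_P (r * s) (r * s)) \<and>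
     (odd (s + i) \<longrightarrow>
        um_A x r \<otimes>\<^sub>u (um_Omega ^^ s) (um_V i) \<simeq>\<^sub>u um_B x r \<oplus>\<^sub>u um_P 0 (r * (2 * s + 1))) \<and>
     (even (s + i) \<longrightarrow>
        um_B x r \<otimes>\<^sub>u (um_Omega ^^ s) (um_V i) \<simeq>\<^sub>u um_B x r \<oplus>\<^sub>u um_P 0 (2 * r * s)) \<and>
     (odd (s + i) \<longrightarrow>
        um_B x r \<otimes>\<^sub>u (um_Omega ^^ s) (um_V i) \<simeq>\<^sub>u um_A x r \<oplus>\<^sub>u um_P (r * s) (r * (s + 1)))"
  using um_AB_tensor_Omega[OF assms(1,3,4), of False r s] um_AB_tensor_Omega[OF assms(1,3,4), of True r s]
  by (auto simp: um_AB_def mult_P0_def mult_P1_def)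

end
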